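(* Let $c>1$, $\alpha\in(0,2]$, and let $X=\{X(t):t\ge0\}$ be a $(c^{1/\alpha},c)$-semistable L\'evy process on $\mathbb{R}$. For a Borel set $B\subseteq\mathbb{R}_+=[0,\infty)$ let $Gr_X(B)=\{(t,X(t)):t\in B\}\subseteq\mathbb{R}^2$ be the graph of $X$ over $B$. Then for every Borel set $B\subseteq\mathbb{R}_+$ we have almost surely $$\dim_H Gr_X(B)=\begin{cases}\dim_H B\cdot\max(\alpha,1), & \text{if } \alpha\dim_H B\le 1,\\[2pt] 1+\dim_H B-\dfrac1\alpha, & \text{if } \alpha\dim_H B>1,\end{cases}$$ where $\dim_H$ denotes Hausdorff dimension.
   Context: A L\'evy process $X=\{X(t)\}_{t\ge0}$ in $\mathbb{R}$ is a stochastically continuous process with c\`adl\`ag paths, with stationary and independent increments, and with $X(0)=0$ almost surely. For $c>1$ and $\alpha\in(0,2]$, a L\'evy process $X$ on $\mathbb{R}$ is called $(c^{1/\alpha},c)$-semistable if the distribution of $X(1)$ is full (in dimension one: not concentrated at a single point) and the processes $\{X(ct)\}_{t\ge0}$ and $\{c^{1/\alpha}X(t)\}_{t\ge0}$ have the same finite-dimensional distributions. Hausdorff dimension: for $F\subseteq\mathbb{R}^n$ and $s\ge0$, $\mathcal{H}^s(F)=\lim_{\delta\to0}\inf\{\sum_{i\ge1}|F_i|^s: |F_i|\le\delta,\ F\subseteq\bigcup_i F_i\}$ with $|F_i|$ the diameter of $F_i$, and $\dim_H F=\inf\{s:\mathcal{H}^s(F)=0\}$. *)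

theory Defs
  imports "HOL-Probability.Probability"
begin

section \<open>Hausdorff dimension\<close>

text \<open>
  The power \<open>|A|\<^sup>s\<close>. The case distinction fixes \<open>|{}|\<^sup>s = 0\<close> and \<open>|A|\<^sup>0 = 1\<close> for every
  nonempty \<open>A\<close>, whereas \<open>powr\<close> would give \<open>0 powr 0 = 0\<close>.
\<close>

definition diameter_pow :: "'a::metric_space set \<Rightarrow> real \<Rightarrow> ennreal" where
  "diameter_pow A s =
     (if A = {} then 0 else if s = 0 then 1 else ennreal (diameter A powr s))"

text \<open>
  Boundedness is required explicitly because \<open>diameter\<close> is real-valued and unspecified
  on unbounded sets. Members of a cover may be empty, so finite covers are included.
\<close>

definition delta_covers :: "real \<Rightarrow> 'a::metric_space set \<Rightarrow> (nat \<Rightarrow> 'a set) set" where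
  "delta_covers \<delta> F =
     {C. (\<forall>i. bounded (C i) \<and> diameter (C i) \<le> \<delta>) \<and> F \<subseteq> (\<Union>i. C i)}"

definition hausdorff_premeasure :: "real \<Rightarrow> real \<Rightarrow> 'a::metric_space set \<Rightarrow> ennreal" where
  "hausdorff_premeasure s \<delta> F = (INF C\<in>delta_covers \<delta> F. \<Sum>i. diameter_pow (C i) s)"

definition hausdorff_measure :: "real \<Rightarrow> 'a::metric_space set \<Rightarrow> ennreal" where
  "hausdorff_measure s F = Lim (at_right 0) (\<lambda>\<delta>. hausdorff_premeasure s \<delta> F)"

text \<open>
  In \<open>n\<close>-dimensional Euclidean space \<open>hausdorff_measure s\<close> vanishes for \<open>s > n\<close>, so the
  infimum is over a nonempty set that is bounded below, and it is an ordinary real number.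
  The type \<open>real \<times> real\<close> carries the Euclidean metric.
\<close>

definition hausdorff_dim :: "'a::euclidean_space set \<Rightarrow> real" where
  "hausdorff_dim F = Inf {s. 0 \<le> s \<and> hausdorff_measure s F = 0}"

lemma hausdorff_premeasure_antimono:
  assumes "\<delta> \<le> \<delta>'"
  shows "hausdorff_premeasure s \<delta>' F \<le> hausdorff_premeasure s \<delta> F"
  unfolding hausdorff_premeasure_def
proof (rule INF_superset_mono)
  show "delta_covers \<delta> F \<subseteq> delta_covers \<delta>' F"
    unfolding delta_covers_def using assms by (auto intro: order_trans)
qed simp

lemma tendsto_hausdorff_premeasure:
  "((\<lambda>\<delta>. hausdorff_premeasure s \<delta> F) \<longlongrightarrow> (SUP \<delta>\<in>{0<..}. hausdorff_premeasure s \<delta> F))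
     (at_right 0)"
proof (rule increasing_tendsto)
  show "\<forall>\<^sub>F \<delta> in at_right 0.
      hausdorff_premeasure s \<delta> F \<le> (SUP \<delta>\<in>{0<..}. hausdorff_premeasure s \<delta> F)"
    by (auto simp: eventually_at_filter intro!: always_eventually SUP_upper)
next
  fix x assume "x < (SUP \<delta>\<in>{0<..}. hausdorff_premeasure s \<delta> F)"
  then obtain d where d: "d > 0" "x < hausdorff_premeasure s d F"
    by (auto simp: less_SUP_iff)
  have "x < hausdorff_premeasure s \<delta> F" if "\<delta> < d" for \<delta>
    using d(2) hausdorff_premeasure_antimono[of \<delta> d s F] that by (meson less_imp_le less_le_trans)
  then show "\<forall>\<^sub>F \<delta> in at_right 0. x < hausdorff_premeasure s \<delta> F"
    using d(1) by (auto simp: eventually_at_right_field)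
qed

lemma hausdorff_measure_eq_SUP:
  "hausdorff_measure s F = (SUP \<delta>\<in>{0<..}. hausdorff_premeasure s \<delta> F)"
  unfolding hausdorff_measure_def
  by (intro tendsto_Lim tendsto_hausdorff_premeasure) simp

section \<open>Semistable Levy processes\<close>

definition cadlag :: "(real \<Rightarrow> real) \<Rightarrow> bool" where
  "cadlag f \<longleftrightarrow>
     (\<forall>t\<ge>0. continuous (at_right t) f) \<and> (\<forall>t>0. \<exists>l. (f \<longlongrightarrow> l) (at_left t))"

text \<open>
  Processes are functions on all of \<open>real\<close>, of which only the values at times \<open>t \<ge> 0\<close> matter.
\<close>

locale levy_process = prob_space M
  for M :: "'a measure" and X :: "real \<Rightarrow> 'a \<Rightarrow> real" +
  assumes measurable_X: "\<And>t. 0 \<le> t \<Longrightarrow> random_variable borel (X t)"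
    and X_0: "AE \<omega> in M. X 0 \<omega> = 0"
    and stochastically_continuous:
      "\<And>t \<epsilon>. 0 \<le> t \<Longrightarrow> 0 < \<epsilon> \<Longrightarrow>
        ((\<lambda>s. prob {\<omega> \<in> space M. \<bar>X s \<omega> - X t \<omega>\<bar> > \<epsilon>}) \<longlongrightarrow> 0) (at t within {0..})"
    and cadlag_paths: "\<And>\<omega>. \<omega> \<in> space M \<Longrightarrow> cadlag (\<lambda>t. X t \<omega>)"
    and stationary_increments:
      "\<And>s h. 0 \<le> s \<Longrightarrow> 0 \<le> h \<Longrightarrow>
        distr M borel (\<lambda>\<omega>. X (s + h) \<omega> - X s \<omega>) = distr M borel (\<lambda>\<omega>. X h \<omega> - X 0 \<omega>)"
    and independent_increments:
      "\<And>(n::nat) t. 0 \<le> t 0 \<Longrightarrow> (\<forall>i<n. t i < t (Suc i)) \<Longrightarrow>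
        indep_vars (\<lambda>_. borel) (\<lambda>i \<omega>. X (t (Suc i)) \<omega> - X (t i) \<omega>) {..<n}"

definition finite_dim_distr ::
  "'a measure \<Rightarrow> (real \<Rightarrow> 'a \<Rightarrow> real) \<Rightarrow> real set \<Rightarrow> (real \<Rightarrow> real) measure" where
  "finite_dim_distr M Y J = distr M (\<Pi>\<^sub>M t\<in>J. borel) (\<lambda>\<omega>. \<lambda>t\<in>J. Y t \<omega>)"

text \<open>The \<open>(c\<^bsup>1/\<alpha>\<^esup>, c)\<close>-semistable processes.\<close>

locale semistable_levy_process = levy_process M X
  for M :: "'a measure" and X :: "real \<Rightarrow> 'a \<Rightarrow> real" +
  fixes \<alpha> c :: real
  assumes c_gt_1: "1 < c"
    and alpha_pos: "0 < \<alpha>"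
    and alpha_le_2: "\<alpha> \<le> 2"
    and full: "\<not> (\<exists>a. prob {\<omega> \<in> space M. X 1 \<omega> = a} = 1)"
    and semi_selfsimilar:
      "\<And>J. finite J \<Longrightarrow> J \<subseteq> {0..} \<Longrightarrow>
        finite_dim_distr M (\<lambda>t. X (c * t)) J =
        finite_dim_distr M (\<lambda>t \<omega>. c powr (1 / \<alpha>) * X t \<omega>) J"

definition process_graph ::
  "(real \<Rightarrow> 'a \<Rightarrow> real) \<Rightarrow> real set \<Rightarrow> 'a \<Rightarrow> (real \<times> real) set" where
  "process_graph X B \<omega> = {(t, X t \<omega>) | t. t \<in> B}"

end

theory Submission
  imports Defs "HOL-Real_Asymp.Real_Asymp"
begin

text \<open>
  Upper bounds: let \<open>B\<close> be covered by intervals of lengths \<open>h = c\<^bsup>-k\<^esup>\<close>. By semi-selfsimilarity there is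
  one \<open>y\<close> such that, over every such interval, \<open>X\<close> oscillates by more than \<open>y h\<^bsup>1/\<alpha>\<^esup>\<close> with probability at
  most \<open>1/2\<close>; by independence of the increments the number of pieces of oscillation at most
  \<open>y h\<^bsup>1/\<alpha>\<^esup>\<close> into which the path has to be cut has expectation at most \<open>2\<close>. The graph over one piece
  is covered by a single set or, if \<open>\<alpha> > 1\<close>, by about \<open>h\<^bsup>1/\<alpha>-1\<^esup>\<close> squares of side \<open>h\<close>.

  Lower bounds: for \<open>\<alpha> \<le> 1\<close> project the graph to the time axis. For \<open>\<alpha> > 1\<close> a compact subset of the
  Borel set \<open>B\<close> (Choquet capacitability) carries a Frostman measure \<open>\<mu>\<close>, and the expected
  \<open>\<gamma>\<close>-energy of its image on the graph is finite. The necessary estimate for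
  \<open>E (h\<^sup>2 + X(h)\<^sup>2)\<^bsup>-\<gamma>/2\<^esup>\<close> follows from the decay
  \<open>|E exp(i \<xi> X(h))| \<le> C exp(-b h\<^bsup>1/\<alpha>\<^esup> |\<xi>|)\<close>, where fullness enters.
\<close>

section \<open>Hausdorff content\<close>

text \<open>Scaling is available only by the factors c^-k. Covers are therefore rounded to lengths
  c^-k, and frequencies are reduced to one shell
  \<open>1 <= |\<xi>| <= c powr (1 / \<alpha>)\<close>; both cost constants. The content of a random
  graph is not known to be measurable, so it is never integrated: it is bounded by a measurable
  random cost, or kept positive by a measurable energy. The infimum in \<open>hausdorff_dim\<close>
  is informative only if some exponent is null, so each lower bound on the dimension is paired with
  a null exponent supplied by the upper bound. For \<alpha> > 1 both regimes come from one estimate: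
  the expected kernel over a time step h has order
  \<open>h powr (- ((\<gamma> - \<theta>) + \<theta> / \<alpha>))\<close>, for every \<theta> in
  [0,1] below \<gamma>. Taking \<theta> just below \<gamma> \<le> 1 gives an exponent near
  \<gamma>/\<alpha>, and \<theta> = 1 < \<gamma> gives \<gamma> - 1 + 1/\<alpha>. Comparing these
  with the dimension of \<open>B\<close> produces the two formulas and the threshold between
  them.\<close>

lemma ennreal_le_suminf: "f n \<le> (\<Sum>n. f n :: ennreal)"
  using sum_le_suminf[of f "{n}"] by (simp add: summableI)

text \<open>Covers of all sizes are allowed: for \<open>s > 0\<close> this vanishes exactly when
  \<open>hausdorff_measure s\<close> does (\<open>hausdorff_measure_eq_0_iff\<close>), and there is
  no limit in the scale to carry through the estimates.\<close>

definition hausdorff_content :: "real \<Rightarrow> 'a::metric_space set \<Rightarrow> ennreal" where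
  "hausdorff_content s F =
     (INF C\<in>{C. (\<forall>i. bounded (C i)) \<and> F \<subseteq> (\<Union>i. C i)}. \<Sum>i::nat. diameter_pow (C i) s)"

lemma hausdorff_content_le:
  assumes "\<And>i. bounded (C i)" "F \<subseteq> (\<Union>i. C i)"
  shows "hausdorff_content s F \<le> (\<Sum>i. diameter_pow (C i) s)"
  unfolding hausdorff_content_def using assms by (intro INF_lower) auto

lemma hausdorff_content_less_iff:
  "hausdorff_content s F < e \<longleftrightarrow>
     (\<exists>C. (\<forall>i. bounded (C i)) \<and> F \<subseteq> (\<Union>i. C i) \<and> (\<Sum>i. diameter_pow (C i) s) < e)"
  unfolding hausdorff_content_def by (auto simp: INF_less_iff)

lemma hausdorff_content_mono: "F \<subseteq> G \<Longrightarrow> hausdorff_content s F \<le> hausdorff_content s G"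
  unfolding hausdorff_content_def by (rule INF_superset_mono) auto

lemma hausdorff_content_le_premeasure:
  "hausdorff_content s F \<le> hausdorff_premeasure s \<delta> F"
  unfolding hausdorff_content_def hausdorff_premeasure_def delta_covers_def
  by (rule INF_superset_mono) auto

lemma hausdorff_content_le_measure: "hausdorff_content s F \<le> hausdorff_measure s F"
  unfolding hausdorff_measure_eq_SUP
  by (rule order_trans[OF hausdorff_content_le_premeasure[of s F 1]]) (auto intro: SUP_upper)

text \<open>A cover of total cost below \<open>\<delta> powr s\<close> has no member of diameter
  above \<delta>, so cheap covers are automatically fine.\<close>

lemma hausdorff_measure_eq_0I:
  fixes F :: "'a::metric_space set"
  assumes s: "s > 0" and 0: "hausdorff_content s F = 0"
  shows "hausdorff_measure s F = 0"
proof -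
  have "hausdorff_premeasure s \<delta> F = 0" if "\<delta> > 0" for \<delta>
  proof (rule ccontr)
    assume ne: "hausdorff_premeasure s \<delta> F \<noteq> 0"
    define e where "e = min (hausdorff_premeasure s \<delta> F) (ennreal (\<delta> powr s))"
    have "e > 0" using ne that by (simp add: e_def zero_less_iff_neq_zero)
    then obtain C where C: "\<And>i. bounded (C i)" "F \<subseteq> (\<Union>i. C i)" "(\<Sum>i. diameter_pow (C i) s) < e"
      using 0 hausdorff_content_less_iff[of s F e] by auto
    have "diameter (C i) \<le> \<delta>" for i
    proof (rule ccontr)
      assume a: "\<not> diameter (C i) \<le> \<delta>"
      then have ne: "C i \<noteq> {}" using that by (auto simp: diameter_def)
      have "ennreal (\<delta> powr s) \<le> diameter_pow (C i) s"
        using a ne s that by (auto simp: diameter_pow_def intro!: ennreal_leI powr_mono2)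
      also have "\<dots> \<le> (\<Sum>i. diameter_pow (C i) s)"
        by (rule ennreal_le_suminf)
      also have "\<dots> < e" by fact
      finally show False by (simp add: e_def)
    qed
    then have "C \<in> delta_covers \<delta> F" using C by (auto simp: delta_covers_def)
    then have "hausdorff_premeasure s \<delta> F \<le> (\<Sum>i. diameter_pow (C i) s)"
      unfolding hausdorff_premeasure_def by (rule INF_lower)
    with C(3) show False by (auto simp: e_def)
  qed
  then show ?thesis unfolding hausdorff_measure_eq_SUP by (auto simp: SUP_eq_const)
qed

lemma hausdorff_measure_eq_0_iff:
  "s > 0 \<Longrightarrow> hausdorff_measure s F = 0 \<longleftrightarrow> hausdorff_content s F = 0"
  using hausdorff_measure_eq_0I hausdorff_content_le_measure[of s F] by auto

text \<open>A nonempty member costs 1 at exponent 0, so a cover of cost below 1 has only empty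
  members. This settles the exponent to which the comparison with the content does not
  apply.\<close>

lemma hausdorff_measure_0_eq_0_iff: "hausdorff_measure 0 F = 0 \<longleftrightarrow> F = {}"
proof
  assume "hausdorff_measure 0 F = 0"
  then have "hausdorff_content 0 F < 1" using hausdorff_content_le_measure[of 0 F] by auto
  then obtain C where C: "F \<subseteq> (\<Union>i. C i)" "(\<Sum>i::nat. diameter_pow (C i) 0) < 1"
    unfolding hausdorff_content_less_iff by auto
  have "C i = {}" for i
  proof (rule ccontr)
    assume "C i \<noteq> {}"
    then have "1 \<le> diameter_pow (C i) 0" by (simp add: diameter_pow_def)
    also have "\<dots> \<le> (\<Sum>i. diameter_pow (C i) 0)"
      by (rule ennreal_le_suminf)
    finally show False using C(2) by auto
  qed
  then show "F = {}" using C by auto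
next
  assume F: "F = {}"
  have "hausdorff_premeasure 0 \<delta> F = 0" if "\<delta> > 0" for \<delta>
  proof -
    have "hausdorff_premeasure 0 \<delta> F \<le> (\<Sum>i. diameter_pow ((\<lambda>_. {}::'a set) i) 0)"
      unfolding hausdorff_premeasure_def using that F
      by (intro INF_lower) (auto simp: delta_covers_def diameter_def)
    then show ?thesis by (simp add: diameter_pow_def)
  qed
  then show "hausdorff_measure 0 F = 0" unfolding hausdorff_measure_eq_SUP by (auto simp: SUP_eq_const)
qed

lemma hausdorff_content_UN:
  fixes F :: "nat \<Rightarrow> 'a::metric_space set"
  shows "hausdorff_content s (\<Union>i. F i) \<le> (\<Sum>i. hausdorff_content s (F i))"
proof (rule ennreal_le_epsilon)
  fix e :: real assume fin: "(\<Sum>i. hausdorff_content s (F i)) < top" and e: "0 < e"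
  have "\<exists>C. (\<forall>j. bounded (C j)) \<and> F i \<subseteq> (\<Union>j::nat. C j) \<and>
       (\<Sum>j. diameter_pow (C j) s) \<le> hausdorff_content s (F i) + e * (1/2)^Suc i" for i
  proof -
    have "hausdorff_content s (F i) < top"
      using fin sum_le_suminf[of "\<lambda>i. hausdorff_content s (F i)" "{i}"]
      by (auto simp: summableI intro: le_less_trans)
    then have "hausdorff_content s (F i) < hausdorff_content s (F i) + e * (1/2)^Suc i"
      using e ennreal_add_left_cancel_less[of "hausdorff_content s (F i)" 0 "ennreal (e * (1/2)^Suc i)"] by simp
    then show ?thesis unfolding hausdorff_content_less_iff by (meson less_imp_le)
  qed
  then obtain C where C: "\<And>i j. bounded (C i j)" "\<And>i. F i \<subseteq> (\<Union>j::nat. C i j)"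
     "\<And>i. (\<Sum>j. diameter_pow (C i j) s) \<le> hausdorff_content s (F i) + e * (1/2)^Suc i" by metis
  define D where "D = (\<lambda>p. case prod_decode p of (i,j) \<Rightarrow> C i j)"
  have "(\<Union>i. F i) \<subseteq> (\<Union>p. D p)"
  proof
    fix x assume "x \<in> (\<Union>i. F i)"
    then obtain i j where "x \<in> C i j" using C(2) by blast
    then have "x \<in> D (prod_encode (i,j))" by (simp add: D_def)
    then show "x \<in> (\<Union>p. D p)" by blast
  qed
  then have "hausdorff_content s (\<Union>i. F i) \<le> (\<Sum>p. diameter_pow (D p) s)"
    by (intro hausdorff_content_le) (auto simp: D_def C split: prod.splits)
  also have "\<dots> = (\<Sum>i. \<Sum>j. diameter_pow (C i j) s)"
    using suminf_ennreal_2dimen[where f="\<lambda>(i,j). diameter_pow (C i j) s", OF refl]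
    by (simp add: D_def case_prod_beta)
  also have "\<dots> \<le> (\<Sum>i. hausdorff_content s (F i) + e * (1/2)^Suc i)"
    using C(3) by (intro suminf_le) (auto simp: summableI)
  also have "\<dots> = (\<Sum>i. hausdorff_content s (F i)) + (\<Sum>i. ennreal (e * (1/2)^Suc i))"
    by (subst suminf_add) (auto simp: summableI)
  also have "(\<Sum>i. ennreal (e * (1/2)^Suc i)) = ennreal e"
    using sums_mult[OF power_half_series, of e] e by (intro suminf_ennreal_eq) auto
  finally show "hausdorff_content s (\<Union>i. F i) \<le> (\<Sum>i. hausdorff_content s (F i)) + ennreal e" .
qed

lemma hausdorff_content_empty [simp]: "hausdorff_content s {} = 0"
  using hausdorff_content_le[of "\<lambda>_. {}" "{}" s] by (simp add: diameter_pow_def)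

lemma hausdorff_content_le_diameter_pow:
  assumes "bounded F" shows "hausdorff_content s F \<le> diameter_pow F s"
proof -
  have "hausdorff_content s F \<le> (\<Sum>i. diameter_pow (if i = (0::nat) then F else {}) s)"
    using assms by (intro hausdorff_content_le) auto
  also have "\<dots> = (\<Sum>i\<in>{0::nat}. diameter_pow (if i = (0::nat) then F else {}) s)"
    by (rule suminf_finite) (auto simp: diameter_pow_def)
  finally show ?thesis by simp
qed

lemma hausdorff_content_UN_finite:
  assumes "finite I"
  shows "hausdorff_content s (\<Union>i\<in>I. F i) \<le> (\<Sum>i\<in>I. hausdorff_content s (F i))"
  using assms
proof induction
  case (insert i I)
  have "(\<Union>j\<in>insert i I. F j) = (\<Union>k::nat. if k = 0 then F i else if k = 1 then (\<Union>j\<in>I. F j) else {})"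
    by (auto split: if_splits)
  also have "hausdorff_content s \<dots> \<le> (\<Sum>k. hausdorff_content s (if k = 0 then F i else if k = 1 then (\<Union>j\<in>I. F j) else {}))"
    by (rule hausdorff_content_UN)
  also have "\<dots> = (\<Sum>k\<in>{0,1::nat}. hausdorff_content s (if k = 0 then F i else if k = 1 then (\<Union>j\<in>I. F j) else {}))"
    by (rule suminf_finite) auto
  also have "\<dots> \<le> hausdorff_content s (F i) + (\<Sum>j\<in>I. hausdorff_content s (F j))"
    using insert by (auto intro: add_left_mono)
  finally show ?case using insert by simp
qed simp

text \<open>A cover of total cost below 1 has members of diameter at most 1, on which powers
  decrease as the exponent grows. Hence the null exponents form an up-set and the infimum in
  \<open>hausdorff_dim\<close> is a threshold.\<close>

lemma hausdorff_measure_eq_0_mono: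
  fixes F :: "'a::metric_space set"
  assumes 0: "hausdorff_measure s F = 0" and st: "0 \<le> s" "s \<le> t"
  shows "hausdorff_measure t F = 0"
proof (cases "s = t \<or> F = {}")
  case True
  then show ?thesis
  proof
    assume "F = {}"
    then show ?thesis using hausdorff_measure_0_eq_0_iff[of F] hausdorff_measure_eq_0_iff[of t F] st
      by (cases "t = 0") auto
  qed (use 0 in simp)
next
  case False
  then have s: "s > 0" using 0 st hausdorff_measure_0_eq_0_iff[of F] by (cases "s = 0") auto
  have h0: "hausdorff_content s F = 0" using 0 s hausdorff_measure_eq_0_iff by blast
  have *: "hausdorff_content t F \<le> ennreal e" if e: "0 < e" "e \<le> 1" for e :: real
  proof -
    obtain C where C: "\<And>i. bounded (C i)" "F \<subseteq> (\<Union>i. C i)" "(\<Sum>i. diameter_pow (C i) s) < ennreal e"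
      using h0 e hausdorff_content_less_iff[of s F "ennreal e"] by auto
    have "diameter_pow (C i) t \<le> diameter_pow (C i) s" for i
    proof -
      have "diameter_pow (C i) s \<le> (\<Sum>i. diameter_pow (C i) s)"
        by (rule ennreal_le_suminf)
      also have "\<dots> < ennreal 1" using C(3) e by (metis ennreal_leI order_less_le_trans)
      finally have "C i = {} \<or> diameter (C i) powr s < 1"
        using s by (auto simp: diameter_pow_def split: if_splits)
      moreover have "diameter (C i) \<le> 1" if "diameter (C i) powr s < 1"
      proof (rule ccontr)
        assume "\<not> diameter (C i) \<le> 1"
        then have "1 powr s \<le> diameter (C i) powr s" using s by (intro powr_mono2) auto
        then show False using that by simp
      qed
      ultimately show ?thesis using s st diameter_ge_0[OF C(1)[of i]]
        by (auto simp: diameter_pow_def intro!: ennreal_leI powr_mono')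
    qed
    then have "(\<Sum>i. diameter_pow (C i) t) \<le> (\<Sum>i. diameter_pow (C i) s)"
      by (intro suminf_le) (auto simp: summableI)
    then show ?thesis using hausdorff_content_le[of C F t] C by (meson less_imp_le order_trans)
  qed
  have "hausdorff_content t F \<le> 0"
  proof (rule ennreal_le_epsilon)
    fix e :: real assume "0 < e"
    then have "hausdorff_content t F \<le> ennreal (min e 1)" by (intro *) auto
    also have "\<dots> \<le> ennreal e" by (intro ennreal_leI) auto
    finally show "hausdorff_content t F \<le> 0 + ennreal e" by simp
  qed
  then show ?thesis using s st by (intro hausdorff_measure_eq_0I) auto
qed

lemma hausdorff_dim_le:
  "hausdorff_measure s F = 0 \<Longrightarrow> 0 \<le> s \<Longrightarrow> hausdorff_dim F \<le> s"
  unfolding hausdorff_dim_def by (intro cInf_lower) (auto intro: bdd_belowI)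

text \<open>The null exponent \<open>s\<close> guarantees that the infimum is taken over a nonempty
  set; otherwise it would be an unspecified real.\<close>

lemma hausdorff_dim_geI:
  assumes "hausdorff_measure s F = 0" "0 \<le> s"
    and "\<And>t. 0 < t \<Longrightarrow> t < d \<Longrightarrow> hausdorff_measure t F \<noteq> 0"
  shows "d \<le> hausdorff_dim F"
  unfolding hausdorff_dim_def
proof (rule cInf_greatest)
  show "{s. 0 \<le> s \<and> hausdorff_measure s F = 0} \<noteq> {}" using assms by auto
  fix x assume x: "x \<in> {s. 0 \<le> s \<and> hausdorff_measure s F = 0}"
  show "d \<le> x"
  proof (rule ccontr)
    assume "\<not> d \<le> x"
    then obtain t where t: "x < t" "t < d" using dense by (metis not_le)
    then show False using hausdorff_measure_eq_0_mono[of x F t] assms(3)[of t] x by auto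
  qed
qed

lemma hausdorff_measure_projection_eq_0:
  fixes f :: "'a::metric_space \<Rightarrow> 'b::metric_space"
  assumes lip: "\<And>x y. dist (f x) (f y) \<le> dist x y" and 0: "hausdorff_measure s F = 0" and s: "0 \<le> s"
  shows "hausdorff_measure s (f ` F) = 0"
proof (cases "s = 0")
  case False
  then have s: "s > 0" using s by simp
  have "hausdorff_content s (f ` F) \<le> hausdorff_content s F"
    unfolding hausdorff_content_def[of s F]
  proof (rule INF_greatest)
    fix C :: "nat \<Rightarrow> 'a set" assume "C \<in> {C. (\<forall>i. bounded (C i)) \<and> F \<subseteq> (\<Union>i. C i)}"
    then have C: "\<And>i. bounded (C i)" "F \<subseteq> (\<Union>i. C i)" by auto
    have d: "bounded (f ` C i)" "f ` C i \<noteq> {} \<Longrightarrow> diameter (f ` C i) \<le> diameter (C i)" for i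
    proof -
      have *: "dist u v \<le> diameter (C i)" if "u \<in> f ` C i" "v \<in> f ` C i" for u v
        using that diameter_bounded_bound[OF C(1)[of i]] order_trans[OF lip] by auto
      then show "bounded (f ` C i)" unfolding bounded_two_points by blast
      show "f ` C i \<noteq> {} \<Longrightarrow> diameter (f ` C i) \<le> diameter (C i)"
        using * unfolding diameter_def by (auto intro!: cSUP_least)
    qed
    have "hausdorff_content s (f ` F) \<le> (\<Sum>i. diameter_pow (f ` C i) s)"
    proof (rule hausdorff_content_le)
      show "bounded (f ` C i)" for i by (rule d(1))
      show "f ` F \<subseteq> (\<Union>i. f ` C i)" unfolding image_UN[symmetric] using C(2) by (rule image_mono)
    qed
    also have "\<dots> \<le> (\<Sum>i. diameter_pow (C i) s)"
      using d s by (intro suminf_le) (auto simp: summableI diameter_pow_def diameter_ge_0 intro!: ennreal_leI powr_mono2)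
    finally show "hausdorff_content s (f ` F) \<le> (\<Sum>i. diameter_pow (C i) s)" .
  qed
  then show ?thesis using 0 s hausdorff_measure_eq_0_iff[of s F] by (intro hausdorff_measure_eq_0I) auto
qed (use 0 in \<open>simp add: hausdorff_measure_0_eq_0_iff\<close>)

text \<open>A unit interval is covered by n + 2 intervals of length 1/(n + 1), at a cost of order
  n^(1 - s), which tends to 0.\<close>

lemma hausdorff_measure_real_eq_0:
  fixes F :: "real set" assumes s: "1 < s" shows "hausdorff_measure s F = 0"
proof (rule hausdorff_measure_eq_0I)
  have unit: "hausdorff_content s {x::real..x+1} = 0" for x
  proof -
    have "hausdorff_content s {x..x+1} \<le> ennreal (2 * real (Suc n) powr (1 - s))" for n :: nat
    proof -
      define I where "I = (\<lambda>k. {x + real k / Suc n .. x + (real k + 1) / Suc n})"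
      \<comment> \<open>The index \<open>Suc n\<close> serves the right endpoint
        \<open>y = x + 1\<close>.\<close>
      have "y \<in> (\<Union>k\<in>{..Suc n}. I k)" if "y \<in> {x..x+1}" for y
      proof -
        define k where "k = nat \<lfloor>(y - x) * Suc n\<rfloor>"
        have "(y - x) * Suc n \<le> 1 * real (Suc n)" using that by (intro mult_right_mono) auto
        moreover have "0 \<le> (y-x) * Suc n" using that by auto
        ultimately have "0 \<le> \<lfloor>(y - x) * Suc n\<rfloor>" "\<lfloor>(y - x) * Suc n\<rfloor> \<le> int (Suc n)"
          using floor_mono[of "(y - x) * Suc n" "1 * real (Suc n)"] by auto
        then have "k \<le> Suc n" "real k \<le> (y-x)*Suc n" "(y-x)*Suc n \<le> real k + 1"
          using of_int_floor_le[of "(y - x) * Suc n"] real_of_int_floor_add_one_ge[of "(y - x) * Suc n"]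
          unfolding k_def by (simp_all only: nat_le_iff of_nat_nat)
        then have "k \<in> {..Suc n}" "y \<in> I k" unfolding I_def by (auto simp: field_simps)
        then show ?thesis by blast
      qed
      then have "hausdorff_content s {x..x+1} \<le> hausdorff_content s (\<Union>k\<in>{..Suc n}. I k)"
        by (intro hausdorff_content_mono) auto
      also have "\<dots> \<le> (\<Sum>k\<in>{..Suc n}. hausdorff_content s (I k))" by (rule hausdorff_content_UN_finite) simp
      also have "\<dots> \<le> (\<Sum>k\<in>{..Suc n}. ennreal ((1 / Suc n) powr s))"
      proof (rule sum_mono)
        fix k
        have "hausdorff_content s (I k) \<le> diameter_pow (I k) s"
          by (rule hausdorff_content_le_diameter_pow) (simp add: I_def)
        also have "diameter (I k) = 1 / Suc n"
        proof -
          have "x + real k / Suc n \<le> x + (real k + 1)/Suc n" by (simp add: divide_right_mono)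
          then show ?thesis unfolding I_def by (simp add: diameter_closed_interval field_simps)
        qed
        then have "diameter_pow (I k) s \<le> ennreal ((1 / Suc n) powr s)"
          using s by (auto simp: diameter_pow_def)
        finally show "hausdorff_content s (I k) \<le> ennreal ((1 / Suc n) powr s)" .
      qed
      also have "\<dots> = ennreal ((real n + 2) * (1 / Suc n) powr s)"
        by (subst sum_ennreal) auto
      also have "\<dots> \<le> ennreal (2 * real (Suc n) * (1 / Suc n) powr s)"
        by (intro ennreal_leI mult_right_mono) auto
      also have "2 * real (Suc n) * (1 / Suc n) powr s = 2 * real (Suc n) powr (1 - s)"
        by (simp add: powr_diff powr_divide)
      finally show ?thesis .
    qed
    moreover have "(\<lambda>n. ennreal (2 * real (Suc n) powr (1 - s))) \<longlonglongrightarrow> ennreal 0"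
      using s by (intro tendsto_ennrealI) real_asymp
    ultimately have "hausdorff_content s {x..x+1} \<le> ennreal 0"
      by (intro tendsto_lowerbound) (auto intro: always_eventually)
    then show ?thesis by simp
  qed
  have "F \<subseteq> (\<Union>k. {of_int (int_decode k)..of_int (int_decode k)+1})"
  proof
    fix y :: real
    have "y \<in> {of_int (int_decode (int_encode \<lfloor>y\<rfloor>))..of_int (int_decode (int_encode \<lfloor>y\<rfloor>))+1}"
      by simp
    then show "y \<in> (\<Union>k. {of_int (int_decode k)..of_int (int_decode k)+1})" by blast
  qed
  then have "hausdorff_content s F \<le> (\<Sum>k::nat. hausdorff_content s {of_int (int_decode k)..of_int (int_decode k)+1::real})"
    using hausdorff_content_mono hausdorff_content_UN order_trans by blast
  then show "hausdorff_content s F = 0" by (simp add: unit)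
qed (use s in simp)

section \<open>Net contents and capacitability\<close>

text \<open>Abstracts the dyadic intervals. Nestedness makes any two members through a common point
  comparable; finiteness of the supersets puts every member of a family below a maximal one.\<close>

locale set_net =
  fixes N :: "'a set set" and w :: "'a set \<Rightarrow> ennreal"
  assumes nested: "P \<in> N \<Longrightarrow> Q \<in> N \<Longrightarrow> P \<subseteq> Q \<or> Q \<subseteq> P \<or> P \<inter> Q = {}"
    and finite_supersets: "P \<in> N \<Longrightarrow> finite {Q\<in>N. P \<subseteq> Q}"
begin

text \<open>Integrating over the counting measure spares an enumeration of the family and makes
  Fatou's lemma applicable.\<close>

definition cost :: "'a set set \<Rightarrow> ennreal" where
  "cost S = (\<integral>\<^sup>+Q. w Q * indicator S Q \<partial>count_space UNIV)"

definition net_content :: "'a set \<Rightarrow> ennreal" where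
  "net_content A = (INF S\<in>{S. S \<subseteq> N \<and> A \<subseteq> \<Union>S}. cost S)"

definition maximal_members :: "'a set set \<Rightarrow> 'a set set" where
  "maximal_members S = {P\<in>S. \<forall>Q\<in>S. P \<subseteq> Q \<longrightarrow> Q = P}"

lemma net_content_le: "S \<subseteq> N \<Longrightarrow> A \<subseteq> \<Union>S \<Longrightarrow> net_content A \<le> cost S"
  unfolding net_content_def by (rule INF_lower) auto

lemma net_content_mono: "A \<subseteq> B \<Longrightarrow> net_content A \<le> net_content B"
  unfolding net_content_def by (rule INF_superset_mono) auto

lemma net_content_less_iff:
  "net_content A < e \<longleftrightarrow> (\<exists>S. S \<subseteq> N \<and> A \<subseteq> \<Union>S \<and> cost S < e)"
  unfolding net_content_def by (auto simp: INF_less_iff)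

lemma maximal_membersD: "P \<in> maximal_members S \<Longrightarrow> Q \<in> S \<Longrightarrow> P \<subseteq> Q \<Longrightarrow> Q = P"
  by (simp add: maximal_members_def)

lemma maximal_members_subset: "maximal_members S \<subseteq> S"
  by (auto simp: maximal_members_def)

lemma maximal_members_above:
  assumes "S \<subseteq> N" "P \<in> S"
  shows "\<exists>Q\<in>maximal_members S. P \<subseteq> Q"
proof -
  have "finite {Q\<in>S. P \<subseteq> Q}"
    using assms by (intro finite_subset[OF _ finite_supersets[of P]]) auto
  then obtain Q where "Q \<in> {Q\<in>S. P \<subseteq> Q}" "\<And>R. R \<in> {Q\<in>S. P \<subseteq> Q} \<Longrightarrow> Q \<subseteq> R \<Longrightarrow> Q = R"
    using finite_has_maximal[of "{Q\<in>S. P \<subseteq> Q}"] assms by auto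
  then show ?thesis by (intro bexI[of _ Q]) (auto simp: maximal_members_def)
qed

lemma Union_maximal_members: "S \<subseteq> N \<Longrightarrow> \<Union>(maximal_members S) = \<Union>S"
  using maximal_members_above maximal_members_subset by blast

text \<open>Makes the stagewise merging of covers agree with taking the maximal members of the whole
  union at once.\<close>

lemma maximal_members_Un:
  assumes "S \<subseteq> N" "T \<subseteq> N"
  shows "maximal_members (maximal_members S \<union> T) = maximal_members (S \<union> T)"
proof (intro equalityI subsetI)
  fix P assume P: "P \<in> maximal_members (maximal_members S \<union> T)"
  have "Q = P" if Q: "Q \<in> S" "P \<subseteq> Q" for Q
  proof -
    obtain R where R: "R \<in> maximal_members S" "Q \<subseteq> R" using maximal_members_above[OF assms(1) Q(1)] by auto
    then have "R = P" using Q by (intro maximal_membersD[OF P]) auto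
    then show ?thesis using R Q by simp
  qed
  moreover have "Q = P" if "Q \<in> T" "P \<subseteq> Q" for Q
    using maximal_membersD[OF P, of Q] that by simp
  moreover have "P \<in> S \<union> T" using P maximal_members_subset by blast
  ultimately show "P \<in> maximal_members (S \<union> T)" unfolding maximal_members_def by blast
next
  fix P assume "P \<in> maximal_members (S \<union> T)"
  then show "P \<in> maximal_members (maximal_members S \<union> T)" unfolding maximal_members_def by blast
qed

text \<open>\<open>D\<close> collects the members that lie inside some member of \<open>S\<close>
  and inside some member of \<open>T\<close>. It covers \<open>A\<close>, because two members
  through one point are comparable. A set that is maximal in the union and also in \<open>D\<close>
  belongs to both \<open>S\<close> and \<open>T\<close>, so nothing is counted more often on the
  left than on the right.\<close>

lemma cost_submodular:
  assumes "S \<subseteq> N" "T \<subseteq> N" "A \<subseteq> \<Union>S" "A \<subseteq> \<Union>T"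
  shows "cost (maximal_members (S \<union> T)) + net_content A \<le> cost S + cost T"
proof -
  define D where "D = {W \<in> S \<union> T. (\<exists>P\<in>S. W \<subseteq> P) \<and> (\<exists>Q\<in>T. W \<subseteq> Q)}"
  have "x \<in> \<Union>D" if x: "x \<in> A" for x
  proof -
    obtain P Q where PQ: "x \<in> P" "P \<in> S" "x \<in> Q" "Q \<in> T" using assms x by blast
    then have "P \<subseteq> Q \<or> Q \<subseteq> P" using nested assms by blast
    then show ?thesis using PQ unfolding D_def by blast
  qed
  then have "net_content A \<le> cost D" using assms by (intro net_content_le) (auto simp: D_def)
  then have "cost (maximal_members (S \<union> T)) + net_content A \<le> cost (maximal_members (S \<union> T)) + cost D"
    by (rule add_left_mono)
  also have "\<dots> = (\<integral>\<^sup>+Q. w Q * (indicator (maximal_members (S \<union> T)) Q + indicator D Q) \<partial>count_space UNIV)"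
    unfolding cost_def by (simp add: nn_integral_add[symmetric] distrib_left)
  also have "\<dots> \<le> (\<integral>\<^sup>+Q. w Q * (indicator S Q + indicator T Q) \<partial>count_space UNIV)"
  proof (intro nn_integral_mono mult_left_mono)
    fix Q
    show "indicator (maximal_members (S \<union> T)) Q + indicator D Q \<le> (indicator S Q + indicator T Q :: ennreal)"
    proof (cases "Q \<in> S \<and> Q \<in> T")
      case False
      have "Q \<notin> maximal_members (S \<union> T) \<or> Q \<notin> D"
        using False by (auto simp: maximal_members_def D_def)
      then show ?thesis using False by (auto simp: indicator_def maximal_members_def D_def)
    qed (auto simp: indicator_def)
  qed simp
  also have "\<dots> = cost S + cost T"
    unfolding cost_def by (simp add: nn_integral_add[symmetric] distrib_left)
  finally show ?thesis .
qed

text \<open>Nearly optimal covers of the \<open>A n\<close> are merged one after the other; by submodularity each merge costs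
  no more than the increase of the content plus the error of the new cover.\<close>

lemma net_content_incseq:
  assumes A: "incseq A"
  shows "net_content (\<Union>n. A n) \<le> (SUP n. net_content (A n))"
proof (rule ennreal_le_epsilon)
  define L where "L = (SUP n. net_content (A n))"
  fix e :: real assume fin: "(SUP n. net_content (A n)) < top" and e: "0 < e"
  have L: "net_content (A n) \<le> L" for n unfolding L_def by (auto intro: SUP_upper)
  have fin': "net_content (A n) < top" for n using L[of n] fin unfolding L_def by simp
  define d where "d n = ennreal (e * (1/2)^Suc n)" for n
  have "\<exists>S. S \<subseteq> N \<and> A n \<subseteq> \<Union>S \<and> cost S \<le> net_content (A n) + d n" for n
  proof -
    have "net_content (A n) < net_content (A n) + d n"
      using fin'[of n] e ennreal_add_left_cancel_less[of "net_content (A n)" 0 "d n"] by (simp add: d_def)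
    then show ?thesis unfolding net_content_less_iff by (meson less_imp_le)
  qed
  then obtain S where S: "\<And>n. S n \<subseteq> N" "\<And>n. A n \<subseteq> \<Union>(S n)" "\<And>n. cost (S n) \<le> net_content (A n) + d n"
    by metis
  define U where "U n = maximal_members (\<Union>i\<le>n. S i)" for n
  define V where "V = maximal_members (\<Union>i. S i)"
  have UN: "(\<Union>i\<le>n. S i) \<subseteq> N" for n using S(1) by auto
  have Ucover: "A n \<subseteq> \<Union>(U n)" for n
    unfolding U_def Union_maximal_members[OF UN] using S(2)[of n] by blast
  have Usub: "U n \<subseteq> N" for n using UN[of n] maximal_members_subset unfolding U_def by blast
  have dfin: "d n < top" for n by (simp add: d_def)
  have Ucost: "cost (U n) \<le> net_content (A n) + (\<Sum>i\<le>n. d i)" for n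
  proof (induction n)
    case 0
    have "cost (U 0) \<le> cost (S 0)"
      unfolding cost_def U_def using maximal_members_subset[of "S 0"]
      by (auto intro!: nn_integral_mono mult_left_mono simp: indicator_def)
    then show ?case using S(3)[of 0] by auto
  next
    case (Suc n)
    have eq: "U (Suc n) = maximal_members (U n \<union> S (Suc n))"
      using maximal_members_Un[OF UN[of n] S(1)[of "Suc n"]] by (simp add: U_def atMost_Suc Un_commute)
    have "A n \<subseteq> \<Union>(S (Suc n))" using S(2)[of "Suc n"] incseq_SucD[OF A, of n] by blast
    then have "cost (U (Suc n)) + net_content (A n) \<le> cost (U n) + cost (S (Suc n))"
      unfolding eq using Usub S(1) Ucover by (intro cost_submodular) auto
    also have "\<dots> \<le> (net_content (A n) + (\<Sum>i\<le>n. d i)) + (net_content (A (Suc n)) + d (Suc n))"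
      using Suc S(3) by (intro add_mono) auto
    also have "\<dots> = (net_content (A (Suc n)) + (\<Sum>i\<le>Suc n. d i)) + net_content (A n)"
      by (simp add: ac_simps)
    finally show ?case using fin'[of n] by (auto simp: add.commute[of _ "net_content (A n)"] ennreal_add_left_cancel_le)
  qed
  have sumd: "(\<Sum>i\<le>n. d i) \<le> ennreal e" for n
  proof -
    have "(\<Sum>i\<le>n. d i) \<le> (\<Sum>i. d i)" by (intro sum_le_suminf) (auto simp: summableI)
    also have "\<dots> = ennreal e" unfolding d_def
      using sums_mult[OF power_half_series, of e] e by (intro suminf_ennreal_eq) auto
    finally show ?thesis .
  qed
  have "net_content (\<Union>n. A n) \<le> cost V"
  proof (rule net_content_le)
    have VN: "(\<Union>i. S i) \<subseteq> N" using S by auto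
    then show "V \<subseteq> N" using maximal_members_subset unfolding V_def by blast
    show "(\<Union>n. A n) \<subseteq> \<Union>V" unfolding V_def Union_maximal_members[OF VN] using S(2) by blast
  qed
  \<comment> \<open>A member that is maximal among all the \<open>S i\<close> is maximal in every
    stage \<open>U n\<close> that has seen it. So \<open>V\<close> is contained in the limit
    inferior of the \<open>U n\<close>, and Fatou's lemma bounds its cost.\<close>
  also have "\<dots> \<le> (\<integral>\<^sup>+Q. liminf (\<lambda>n. w Q * indicator (U n) Q) \<partial>count_space UNIV)"
    unfolding cost_def
  proof (intro nn_integral_mono)
    fix Q
    show "w Q * indicator V Q \<le> liminf (\<lambda>n. w Q * indicator (U n) Q)"
    proof (cases "Q \<in> V")
      case True
      then obtain i where i: "Q \<in> S i" by (auto simp: V_def maximal_members_def)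
      have "Q \<in> U n" if "i \<le> n" for n
        using True i that by (auto simp: U_def V_def maximal_members_def)
      then have "\<forall>\<^sub>F n in sequentially. w Q \<le> w Q * indicator (U n) Q"
        by (auto simp: eventually_sequentially indicator_def)
      then show ?thesis using True by (simp add: Liminf_bounded)
    qed simp
  qed
  also have "\<dots> \<le> liminf (\<lambda>n. cost (U n))"
    unfolding cost_def by (rule nn_integral_liminf) simp
  also have "\<dots> \<le> liminf (\<lambda>n::nat. L + ennreal e)"
    using Ucost L sumd by (intro Liminf_mono always_eventually allI) (meson add_mono order_trans)
  also have "\<dots> = L + ennreal e" by (simp add: Liminf_const)
  finally show "net_content (\<Union>n. A n) \<le> (SUP n. net_content (A n)) + ennreal e" unfolding L_def .
qed

lemma net_content_Un: "net_content (A \<union> B) \<le> net_content A + net_content B"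
proof (rule ennreal_le_epsilon)
  fix e :: real assume fin: "net_content A + net_content B < top" and e: "0 < e"
  have "net_content A < net_content A + ennreal (e/2)" "net_content B < net_content B + ennreal (e/2)"
    using fin e ennreal_add_left_cancel_less[of "net_content A" 0 "ennreal (e/2)"]
       ennreal_add_left_cancel_less[of "net_content B" 0 "ennreal (e/2)"] by auto
  then obtain S T where ST: "S \<subseteq> N" "A \<subseteq> \<Union>S" "cost S < net_content A + ennreal (e/2)"
     "T \<subseteq> N" "B \<subseteq> \<Union>T" "cost T < net_content B + ennreal (e/2)" unfolding net_content_less_iff by metis
  have "net_content (A \<union> B) \<le> cost (S \<union> T)" using ST by (intro net_content_le) auto
  also have "\<dots> \<le> cost S + cost T" unfolding cost_def
    by (subst nn_integral_add[symmetric]) (auto intro!: nn_integral_mono simp: indicator_def)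
  also have "\<dots> \<le> (net_content A + ennreal (e/2)) + (net_content B + ennreal (e/2))"
    using ST by (intro add_mono) auto
  also have "\<dots> = net_content A + net_content B + ennreal e"
    using e by (simp add: ac_simps ennreal_plus[symmetric] del: ennreal_plus)
  finally show "net_content (A \<union> B) \<le> net_content A + net_content B + ennreal e" .
qed

lemma net_content_empty [simp]: "net_content {} = 0"
  using net_content_le[of "{}" "{}"] by (simp add: cost_def)

lemma net_content_le_weight: "Q \<in> N \<Longrightarrow> A \<subseteq> Q \<Longrightarrow> net_content A \<le> w Q"
  using net_content_le[of "{Q}" A] by (simp add: cost_def nn_integral_count_space_indicator[symmetric])

end

section \<open>Analytic sets, as projections of closed sets along the Baire space, and
  capacitability\<close>

definition analytic :: "'a::topological_space set \<Rightarrow> bool" where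
  "analytic A \<longleftrightarrow> (\<exists>C :: ('a \<times> (nat \<Rightarrow> nat)) set. closed C \<and> A = fst ` C)"

lemma continuous_on_snd_coordinate: "continuous_on UNIV (\<lambda>p. (snd p :: nat \<Rightarrow> 'b::topological_space) i)"
  by (rule continuous_on_product_then_coordinatewise[OF continuous_on_snd[OF continuous_on_id]])

lemma analytic_closed: "closed A \<Longrightarrow> analytic A"
  unfolding analytic_def by (intro exI[of _ "A \<times> UNIV"]) (auto intro: closed_Times simp: image_iff)

text \<open>Entry 0 of a code selects one of the sets, and the shifted sequence is a code for that
  set.\<close>

lemma analytic_UN:
  fixes A :: "nat \<Rightarrow> 'a::topological_space set"
  assumes "\<And>n. analytic (A n)" shows "analytic (\<Union>n. A n)"
proof -
  obtain C :: "nat \<Rightarrow> ('a \<times> (nat \<Rightarrow> nat)) set" where C: "\<And>n. closed (C n)" "\<And>n. A n = fst ` C n"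
    using assms unfolding analytic_def by metis
  define g :: "'a \<times> (nat \<Rightarrow> nat) \<Rightarrow> 'a \<times> (nat \<Rightarrow> nat)" where "g = (\<lambda>p. (fst p, \<lambda>k. snd p (Suc k)))"
  have g: "continuous_on UNIV g" unfolding g_def
    by (intro continuous_on_Pair continuous_on_fst continuous_on_id continuous_on_coordinatewise_then_product continuous_on_snd_coordinate)
  define D where "D = {p. \<forall>n. snd p 0 = n \<longrightarrow> g p \<in> C n}"
  have "open {p :: 'a \<times> (nat \<Rightarrow> nat). snd p 0 = n}" for n
    using open_vimage[OF discrete_topology_class.open_discrete[of "{n}"] continuous_on_snd_coordinate[of 0]] by (simp add: vimage_def)
  moreover have "closed {p. g p \<in> C n}" for n
    using closed_vimage[OF C(1) g] by (simp add: vimage_def)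
  ultimately have "closed D" unfolding D_def by (intro closed_Collect_all closed_Collect_imp)
  moreover have "(\<Union>n. A n) = fst ` D"
  proof (intro equalityI subsetI)
    fix x assume "x \<in> (\<Union>n. A n)"
    then obtain n \<sigma> where "(x, \<sigma>) \<in> C n" using C(2) by auto
    then have "(x, case_nat n \<sigma>) \<in> D" by (simp add: D_def g_def)
    then show "x \<in> fst ` D" by force
  next
    fix x assume "x \<in> fst ` D"
    then obtain \<sigma> where "(x, \<sigma>) \<in> D" by auto
    then have "g (x, \<sigma>) \<in> C (\<sigma> 0)" by (simp add: D_def)
    then have "fst (g (x,\<sigma>)) \<in> A (\<sigma> 0)" unfolding C(2) by blast
    then show "x \<in> (\<Union>n. A n)" by (auto simp: g_def)
  qed
  ultimately show ?thesis unfolding analytic_def by blast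
qed

text \<open>One sequence encodes countably many codes through \<open>prod_encode\<close>; each of
  the conditions is closed, hence so is their conjunction.\<close>

lemma analytic_INT:
  fixes A :: "nat \<Rightarrow> 'a::topological_space set"
  assumes "\<And>n. analytic (A n)" shows "analytic (\<Inter>n. A n)"
proof -
  obtain C :: "nat \<Rightarrow> ('a \<times> (nat \<Rightarrow> nat)) set" where C: "\<And>n. closed (C n)" "\<And>n. A n = fst ` C n"
    using assms unfolding analytic_def by metis
  define g :: "nat \<Rightarrow> 'a \<times> (nat \<Rightarrow> nat) \<Rightarrow> 'a \<times> (nat \<Rightarrow> nat)"
    where "g n = (\<lambda>p. (fst p, \<lambda>k. snd p (prod_encode (n, k))))" for n
  have g: "continuous_on UNIV (g n)" for n unfolding g_def
    by (intro continuous_on_Pair continuous_on_fst continuous_on_id continuous_on_coordinatewise_then_product continuous_on_snd_coordinate)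
  define D where "D = {p. \<forall>n. g n p \<in> C n}"
  have "closed {p. g n p \<in> C n}" for n
    using closed_vimage[OF C(1) g] by (simp add: vimage_def)
  then have "closed D" unfolding D_def by (intro closed_Collect_all)
  moreover have "(\<Inter>n. A n) = fst ` D"
  proof (intro equalityI subsetI)
    fix x assume "x \<in> (\<Inter>n. A n)"
    then have "\<forall>n. \<exists>\<sigma>. (x, \<sigma>) \<in> C n" using C(2) by force
    then obtain \<sigma> where "\<And>n. (x, \<sigma> n) \<in> C n" by metis
    then have "(x, \<lambda>k. case prod_decode k of (n, j) \<Rightarrow> \<sigma> n j) \<in> D" by (simp add: D_def g_def)
    then show "x \<in> fst ` D" by force
  next
    fix x assume "x \<in> fst ` D"
    then obtain \<sigma> where "(x, \<sigma>) \<in> D" by auto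
    then have "g n (x, \<sigma>) \<in> C n" for n by (simp add: D_def)
    then have "fst (g n (x,\<sigma>)) \<in> A n" for n unfolding C(2) by blast
    then show "x \<in> (\<Inter>n. A n)" by (auto simp: g_def)
  qed
  ultimately show ?thesis unfolding analytic_def by blast
qed

lemma analytic_borel:
  fixes A :: "'a::metric_space set"
  assumes "A \<in> sets borel" shows "analytic A"
proof -
  have op: "analytic U" if "open U" for U :: "'a set"
  \<comment> \<open>\<open>infdist\<close> to the empty set is 0 by convention, so the whole space
    is treated apart.\<close>
  proof (cases "U = UNIV")
    case False
    define F where "F n = {x. 1 / real (Suc n) \<le> infdist x (- U)}" for n
    have "closed (F n)" for n
      unfolding F_def by (intro closed_Collect_le continuous_intros)
    moreover have "U = (\<Union>n. F n)"
    proof (intro equalityI subsetI)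
      fix x assume "x \<in> U"
      then have "infdist x (- U) \<noteq> 0"
        using in_closed_iff_infdist_zero[of "- U" x] that False by (auto simp: closed_Compl)
      then have "0 < infdist x (- U)" using infdist_nonneg[of x "- U"] by linarith
      then show "x \<in> (\<Union>n. F n)" using nat_approx_posE[of "infdist x (- U)"] unfolding F_def
        by (metis (mono_tags, lifting) UN_I UNIV_I less_imp_le mem_Collect_eq)
    next
      fix x assume "x \<in> (\<Union>n. F n)"
      then obtain n where n: "1 / real (Suc n) \<le> infdist x (- U)" by (auto simp: F_def)
      moreover have "0 < 1 / real (Suc n)" by simp
      ultimately have "0 < infdist x (- U)" by linarith
      then show "x \<in> U" using infdist_zero[of x "- U"] by (metis ComplI less_irrefl)
    qed
    ultimately show ?thesis using analytic_UN[of F] analytic_closed by auto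
  qed (simp add: analytic_closed)
  have "A \<in> sigma_sets UNIV {S. open S}" using assms by (simp add: borel_def)
  \<comment> \<open>Complements of analytic sets need not be analytic, so the induction carries the
    complement along.\<close>
  then have "analytic A \<and> analytic (- A)"
  proof induction
    case (Basic a) then show ?case using op analytic_closed[of "-a"] by (auto simp: closed_Compl)
  next
    case Empty show ?case using analytic_closed by auto
  next
    case (Compl a) then show ?case by (simp add: Compl_eq_Diff_UNIV[symmetric])
  next
    case (Union a)
    then show ?case using analytic_UN[of a] analytic_INT[of "\<lambda>n. - a n"] by (simp add: Compl_UN)
  qed
  then show ?thesis by simp
qed

lemma compact_bounded_sequences: "compact {\<sigma> :: nat \<Rightarrow> nat. \<forall>i. \<sigma> i \<le> n i}"
proof -
  have "compactin (product_topology (\<lambda>_. euclidean) UNIV) (PiE UNIV (\<lambda>i. {..n i}))"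
    unfolding compactin_PiE by (auto intro!: finite_imp_compact)
  then show ?thesis
    by (simp add: euclidean_product_topology PiE_UNIV_domain Pi_def)
qed

text \<open>Bounds for the entries of the codes are chosen one after the other so that \<phi> of the
  remaining part stays above \<open>a\<close>; the codes below all these bounds form a compact set.
  The conclusion speaks of open supersets because continuity of \<phi> is assumed along increasing
  unions and not along decreasing compact sets.\<close>

lemma choquet_capacitability:
  fixes \<phi> :: "'a::metric_space set \<Rightarrow> 'b::linorder"
  assumes mono: "\<And>A B. A \<subseteq> B \<Longrightarrow> \<phi> A \<le> \<phi> B"
    and cont: "\<And>A a. incseq A \<Longrightarrow> a < \<phi> (\<Union>n::nat. A n) \<Longrightarrow> \<exists>n. a < \<phi> (A n)"
    and A: "analytic A" "A \<subseteq> L" "compact L" "a < \<phi> A"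
  obtains K where "compact K" "K \<subseteq> A" "\<And>U. open U \<Longrightarrow> K \<subseteq> U \<Longrightarrow> a < \<phi> U"
proof -
  obtain C :: "('a \<times> (nat \<Rightarrow> nat)) set" where C: "closed C" "A = fst ` C" using A(1) unfolding analytic_def by auto
  \<comment> \<open>The points of \<open>A\<close> with a code whose first entries are bounded by
    the list \<open>p\<close>; the later entries are still free.\<close>
  define E where "E p = fst ` {q\<in>C. \<forall>i<length p. snd q i \<le> p ! i}" for p
  have E_step: "\<exists>m. a < \<phi> (E (p @ [m]))" if "a < \<phi> (E p)" for p
  proof (rule cont)
    show "incseq (\<lambda>m. E (p @ [m]))"
      unfolding incseq_def E_def
      by (intro allI impI image_mono) (auto simp: nth_append less_Suc_eq split: if_splits)
    have "E p = (\<Union>m. E (p @ [m]))"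
    proof (intro equalityI subsetI)
      fix x assume "x \<in> E p"
      then obtain q where q: "q \<in> C" "\<forall>i<length p. snd q i \<le> p ! i" "x = fst q" by (auto simp: E_def)
      then have "x \<in> E (p @ [snd q (length p)])"
        unfolding E_def by (intro image_eqI[of _ _ q]) (auto simp: nth_append less_Suc_eq)
      then show "x \<in> (\<Union>m. E (p @ [m]))" by blast
    next
      fix x assume "x \<in> (\<Union>m. E (p @ [m]))"
      then obtain q m where q: "q \<in> C" "\<forall>i<length (p@[m]). snd q i \<le> (p @[m]) ! i" "x = fst q" by (auto simp: E_def)
      have "\<forall>i<length p. snd q i \<le> p ! i"
      proof (intro allI impI)
        fix i assume "i < length p" then show "snd q i \<le> p ! i" using q(2)[rule_format, of i] by (simp add: nth_append)
      qed
      then show "x \<in> E p" using q unfolding E_def by blast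
    qed
    then show "a < \<phi> (\<Union>m. E (p @ [m]))" using that by simp
  qed
  have "\<exists>f. \<forall>k. (length (f k) = k \<and> a < \<phi> (E (f k))) \<and> (\<exists>m. f (Suc k) = f k @ [m])"
  proof (rule dependent_nat_choice)
    show "\<exists>x. length x = 0 \<and> a < \<phi> (E x)" using A(4) C(2) by (simp add: E_def)
      fix p k assume p: "length p = k \<and> a < \<phi> (E p)"
    then obtain m where "a < \<phi> (E (p @ [m]))" using E_step by blast
    then show "\<exists>p'. (length p' = Suc k \<and> a < \<phi> (E p')) \<and> (\<exists>m. p' = p @ [m])"
      using p by (intro exI[of _ "p @ [m]"]) auto
  qed
  then obtain f where f: "\<And>k. length (f k) = k" "\<And>k. a < \<phi> (E (f k))" "\<And>k. \<exists>m. f (Suc k) = f k @ [m]" by blast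
  define n where "n i = f (Suc i) ! i" for i
  have fn: "f k = map n [0..<k]" for k
  proof (induction k)
    case (Suc k)
    obtain m where m: "f (Suc k) = f k @ [m]" using f(3) by blast
    have "n k = m" unfolding n_def m using f(1)[of k] by (simp add: nth_append)
    then show ?case using Suc m by simp
  qed (use f(1)[of 0] in simp)
  define K where "K = fst ` (C \<inter> (L \<times> {\<sigma>. \<forall>i. \<sigma> i \<le> n i}))"
  have cl: "closed {p :: 'a \<times> (nat \<Rightarrow> nat). snd p i \<le> m}" for i m
    using closed_vimage[OF finite_imp_closed[of "{..m}", OF finite_atMost] continuous_on_snd_coordinate[of i]] by (simp add: vimage_def)
  show thesis
  proof
    show "compact K" unfolding K_def using C(1) A(3) compact_bounded_sequences
      by (intro compact_continuous_image continuous_on_fst continuous_on_id closed_Int_compact compact_Times)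
    show "K \<subseteq> A" unfolding K_def C(2) by blast
    fix U assume U: "open U" "K \<subseteq> U"
    have "\<exists>k. E (f k) \<subseteq> U"
    proof (rule ccontr)
      assume "\<not> ?thesis"
      then have "\<forall>k. \<exists>q. q \<in> C \<and> (\<forall>i<k. snd q i \<le> n i) \<and> fst q \<notin> U"
        by (simp add: E_def fn image_subset_iff) blast
      then obtain q where q: "\<And>k. q k \<in> C" "\<And>k i. i < k \<Longrightarrow> snd (q k) i \<le> n i" "\<And>k. fst (q k) \<notin> U" by metis
      \<comment> \<open>The bound \<open>n i\<close> can fail only for the finitely many
        \<open>q k\<close> with \<open>k <= i\<close>, so enlarging it to \<open>N i\<close> puts
        all \<open>q k\<close> into one compact set.\<close>
      define N where "N i = Max (insert (n i) ((\<lambda>k. snd (q k) i) ` {..i}))" for i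
      have qN: "snd (q k) i \<le> N i" for k i
      proof (cases "i < k")
        case True
        then show ?thesis using q(2)[of i k] by (auto simp: N_def intro: order_trans[OF _ Max_ge])
      next
        case False then show ?thesis unfolding N_def by (intro Max_ge) auto
      qed
      define S where "S = L \<times> {\<sigma>. \<forall>i. \<sigma> i \<le> N i}"
      define D where "D k = C \<inter> {p. \<forall>i. i < k \<longrightarrow> snd p i \<le> n i} \<inter> (- U) \<times> UNIV" for k
      have "S \<inter> (\<Inter>k\<in>UNIV. D k) \<noteq> {}"
      proof (rule compact_imp_fip_image)
        show "compact S" unfolding S_def using A(3) compact_bounded_sequences by (rule compact_Times)
        show "closed (D k)" for k unfolding D_def
          using C(1) cl U(1) by (intro closed_Int closed_Times closed_Collect_all closed_Collect_imp) (auto simp: closed_Compl)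
        fix I :: "nat set" assume I: "finite I"
        define k where "k = Max (insert 0 I)"
        have "q k \<in> D j" if "j \<in> I" for j
        proof -
          have "j \<le> k" using that I by (simp add: k_def)
          then show ?thesis using q(1)[of k] q(3)[of k] q(2)[of _ k] by (auto simp: D_def mem_Times_iff)
        qed
        moreover have "q k \<in> S" using qN[of k] q(1)[of k] C(2) A(2) by (auto simp: S_def mem_Times_iff)
        ultimately show "S \<inter> (\<Inter>i\<in>I. D i) \<noteq> {}" by blast
      qed
      then obtain p where p: "p \<in> S" "\<And>k. p \<in> D k" by blast
      have "snd p i \<le> n i" for i using p(2)[of "Suc i"] by (auto simp: D_def)
      then have "p \<in> C \<inter> (L \<times> {\<sigma>. \<forall>i. \<sigma> i \<le> n i})" using p(1) p(2)[of 0] by (auto simp: S_def D_def mem_Times_iff)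
      then have "fst p \<in> K" unfolding K_def by (rule imageI)
      then show False using p(2)[of 0] U(2) by (auto simp: D_def)
    qed
    then obtain k where "E (f k) \<subseteq> U" by blast
    then show "a < \<phi> U" using f(2)[of k] mono by (metis less_le_trans)
  qed
qed

section \<open>Frostman measures on the line\<close>

text \<open>The floor form reduces nesting to integer division, see
  \<open>floor_mult_power2\<close>.\<close>

definition dyadic :: "nat \<Rightarrow> int \<Rightarrow> real set" where
  "dyadic n k = {x. \<lfloor>x * 2^n\<rfloor> = k}"

lemma dyadic_eq: "dyadic n k = {real_of_int k / 2^n ..< (real_of_int k + 1) / 2^n}"
  by (auto simp: dyadic_def floor_eq_iff field_simps)

lemma diameter_dyadic [simp]: "diameter (dyadic n k) = 1 / 2^n"
proof -
  define a b where "a = real_of_int k / 2^n" and "b = (real_of_int k + 1) / 2^n"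
  have "a < b" "b - a = 1 / 2^n" by (auto simp: a_def b_def divide_strict_right_mono diff_divide_distrib[symmetric])
  moreover have "diameter {a<..<b} \<le> diameter {a..<b}" "diameter {a..<b} \<le> diameter {a..b}"
    by (intro diameter_subset; auto)+
  ultimately have "diameter {a..<b} = 1 / 2^n" by simp
  then show ?thesis unfolding dyadic_eq a_def b_def .
qed

lemma dyadic_nonempty [simp]: "dyadic n k \<noteq> {}"
  by (auto simp: dyadic_eq divide_strict_right_mono)

lemma floor_mult_power2:
  fixes x :: real assumes "n \<le> m" shows "\<lfloor>x * 2^n\<rfloor> = \<lfloor>x * 2^m\<rfloor> div 2^(m - n)"
proof -
  have "x * 2^n = x * 2^m / real_of_int (2^(m-n))"
    using assms power_add[of "2::real" "m - n" n] by simp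
  then show ?thesis by (metis floor_divide_real_eq_div zero_le_numeral zero_le_power)
qed

lemma dyadic_subset_or_disjoint:
  assumes "n \<le> m" shows "dyadic m j \<subseteq> dyadic n k \<or> dyadic m j \<inter> dyadic n k = {}"
  using floor_mult_power2[OF assms] by (auto simp: dyadic_def)

lemma dyadic_split: "dyadic n k = dyadic (Suc n) (2 * k) \<union> dyadic (Suc n) (2 * k + 1)"
proof -
  have "\<lfloor>x * 2^n\<rfloor> = \<lfloor>x * 2^Suc n\<rfloor> div 2" for x :: real using floor_mult_power2[of n "Suc n" x] by simp
  then show ?thesis unfolding dyadic_def by auto
qed

lemma dyadic_subset_le: "dyadic m j \<subseteq> dyadic n k \<Longrightarrow> n \<le> m"
proof -
  assume "dyadic m j \<subseteq> dyadic n k"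
  then have "diameter (dyadic m j) \<le> diameter (dyadic n k)"
    by (rule diameter_subset) (simp add: dyadic_eq)
  then show "n \<le> m" by (simp add: field_simps)
qed

section \<open>The net of dyadic intervals and its comparison with the Hausdorff content\<close>

definition dyadics :: "real set set" where "dyadics = range (\<lambda>(n, k). dyadic n k)"

lemma dyadic_mem [simp, intro]: "dyadic n k \<in> dyadics"
  by (auto simp: dyadics_def)

lemma dyadicsE: "Q \<in> dyadics \<Longrightarrow> (\<And>n k. Q = dyadic n k \<Longrightarrow> thesis) \<Longrightarrow> thesis"
  by (auto simp: dyadics_def)

lemma countable_dyadics: "countable dyadics"
  unfolding dyadics_def by (rule countable_image) simp

interpretation net: set_net dyadics "\<lambda>Q. diameter_pow Q s" for s
proof
  fix P Q assume "P \<in> dyadics" "Q \<in> dyadics"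
  then obtain n k m j where eq: "P = dyadic n k" "Q = dyadic m j" by (auto elim!: dyadicsE)
  show "P \<subseteq> Q \<or> Q \<subseteq> P \<or> P \<inter> Q = {}"
    using dyadic_subset_or_disjoint[of n m j k] dyadic_subset_or_disjoint[of m n k j] unfolding eq
    by (cases "n \<le> m") auto
next
  fix P assume "P \<in> dyadics"
  then obtain m j where P: "P = dyadic m j" by (auto elim!: dyadicsE)
  \<comment> \<open>A point of \<open>P\<close> determines the one interval of each level that can
    contain \<open>P\<close>, and that level cannot exceed the level of \<open>P\<close>.\<close>
  obtain x where x: "x \<in> P" unfolding P using dyadic_nonempty by blast
  have "{Q \<in> dyadics. P \<subseteq> Q} \<subseteq> (\<lambda>n. dyadic n \<lfloor>x * 2^n\<rfloor>) ` {..m}"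
  proof
    fix Q assume "Q \<in> {Q \<in> dyadics. P \<subseteq> Q}"
    then obtain n k where Q: "Q = dyadic n k" "P \<subseteq> Q" by (auto elim!: dyadicsE)
    then have "n \<le> m" using dyadic_subset_le P by blast
    moreover have "k = \<lfloor>x * 2^n\<rfloor>" using x Q by (auto simp: dyadic_def)
    ultimately show "Q \<in> (\<lambda>n. dyadic n \<lfloor>x * 2^n\<rfloor>) ` {..m}" using Q by auto
  qed
  then show "finite {Q \<in> dyadics. P \<subseteq> Q}" by (rule finite_subset) simp
qed

lemma hausdorff_content_le_net_content: "hausdorff_content s A \<le> net.net_content s A"
  unfolding net.net_content_def
proof (rule INF_greatest)
  fix S assume "S \<in> {S. S \<subseteq> dyadics \<and> A \<subseteq> \<Union>S}"
  then have S: "S \<subseteq> dyadics" "A \<subseteq> \<Union>S" by auto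
  have cS: "countable S" using S countable_dyadics countable_subset by blast
  define J where "J = to_nat_on S ` S"
  define g where "g = the_inv_into S (to_nat_on S)"
  have bij: "bij_betw g J S" unfolding g_def J_def
    by (intro bij_betw_the_inv_into inj_on_imp_bij_betw inj_on_to_nat_on cS)
  \<comment> \<open>The family may be finite; indices outside \<open>J\<close> get the empty set, of
    cost 0.\<close>
  define C where "C i = (if i \<in> J then g i else {})" for i
  have gS: "g i \<in> S" if "i \<in> J" for i using bij that by (auto simp: bij_betw_def)
  have "hausdorff_content s A \<le> (\<Sum>i. diameter_pow (C i) s)"
  proof (rule hausdorff_content_le)
    show "bounded (C i)" for i using gS[of i] S(1) by (auto simp: C_def dyadic_eq elim!: dyadicsE[OF subsetD])
    show "A \<subseteq> (\<Union>i. C i)"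
    proof
      fix x assume "x \<in> A"
      then obtain Q where "x \<in> Q" "Q \<in> S" using S by blast
      moreover from this obtain i where "i \<in> J" "g i = Q" using bij by (auto simp: bij_betw_def)
      ultimately have "x \<in> C i" by (simp add: C_def)
      then show "x \<in> (\<Union>i. C i)" by blast
    qed
  qed
  also have "\<dots> = (\<integral>\<^sup>+i. diameter_pow (C i) s \<partial>count_space UNIV)"
    by (rule nn_integral_count_space_nat[symmetric])
  also have "\<dots> = (\<integral>\<^sup>+i. diameter_pow (g i) s * indicator J i \<partial>count_space UNIV)"
    by (intro nn_integral_cong) (auto simp: C_def indicator_def diameter_pow_def)
  also have "\<dots> = (\<integral>\<^sup>+i. diameter_pow (g i) s \<partial>count_space J)"
    by (simp add: nn_integral_count_space_indicator)
  also have "\<dots> = (\<integral>\<^sup>+Q. diameter_pow Q s \<partial>count_space S)"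
    by (rule nn_integral_bij_count_space[OF bij])
  also have "\<dots> = net.cost s S" unfolding net.cost_def by (simp add: nn_integral_count_space_indicator)
  finally show "hausdorff_content s A \<le> net.cost s S" .
qed

lemma diameter_pow_dyadic: "s > 0 \<Longrightarrow> diameter_pow (dyadic n k) s = ennreal ((1 / 2^n) powr s)"
  by (simp add: diameter_pow_def)

text \<open>A half-open dyadic interval together with its left neighbour is a neighbourhood of itself.\<close>

lemma net_content_open_superset:
  assumes s: "s > 0" and S: "S \<subseteq> dyadics" "K \<subseteq> \<Union>S"
  shows "\<exists>U. open U \<and> K \<subseteq> U \<and> net.net_content s U \<le> 2 * net.cost s S"
proof -
  define l where "l Q = (\<lambda>x. x - diameter Q) ` Q" for Q :: "real set"
  have l: "l (dyadic n k) = dyadic n (k - 1)" for n k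
  proof -
    have "x \<in> dyadic n (k - 1) \<longleftrightarrow> x + 1 / 2^n \<in> dyadic n k" for x
      by (simp add: dyadic_def distrib_right)  linarith
    moreover have "x \<in> l (dyadic n k) \<longleftrightarrow> x + 1 / 2^n \<in> dyadic n k" for x
      by (auto simp: l_def image_iff intro!: bexI[of _ "x + 1/2^n"])
    ultimately show ?thesis by blast
  qed
  have inj: "inj_on l S"
  proof (rule inj_onI)
    fix P Q assume PQ: "P \<in> S" "Q \<in> S" "l P = l Q"
    obtain n k m j where eq: "P = dyadic n k" "Q = dyadic m j" using PQ S by (meson dyadicsE subsetD)
    have "dyadic n (k-1) = dyadic m (j-1)" using PQ(3) unfolding eq l .
    moreover from this have "n = m" by (metis dyadic_subset_le order_antisym order_refl)
    ultimately have "k - 1 = j - 1" using dyadic_nonempty[of n "k-1"] by (auto simp: dyadic_def)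
    then show "P = Q" using eq \<open>n = m\<close> by simp
  qed
  define U where "U = (\<Union>Q\<in>S. interior (Q \<union> l Q))"
  have "Q \<subseteq> interior (Q \<union> l Q)" if QS: "Q \<in> S" for Q
  proof -
    obtain n k where Q: "Q = dyadic n k" using QS S by (meson dyadicsE subsetD)
    define I where "I = {real_of_int (k - 1) / 2^n <..< (real_of_int k + 1) / 2^n}"
    have "I \<subseteq> Q \<union> l Q" unfolding Q l by (auto simp: I_def dyadic_eq)
    then have "I \<subseteq> interior (Q \<union> l Q)" by (intro interior_maximal) (auto simp: I_def)
    moreover have "real_of_int (k - 1) / 2^n < real_of_int k / 2^n" by (simp add: divide_strict_right_mono)
    then have "Q \<subseteq> I" unfolding Q by (auto simp: I_def dyadic_eq)
    ultimately show ?thesis by blast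
  qed
  then have "\<Union>S \<subseteq> U" unfolding U_def by (intro Union_least) (rule subset_trans[OF _ UN_upper])
  then have KU: "K \<subseteq> U" using S by blast
  have "net.net_content s U \<le> net.cost s (S \<union> l ` S)"
  proof (rule net.net_content_le)
    show "S \<union> l ` S \<subseteq> dyadics" using S l by (auto elim!: dyadicsE[OF subsetD])
    show "U \<subseteq> \<Union> (S \<union> l ` S)" unfolding U_def using interior_subset by blast
  qed
  also have "\<dots> \<le> net.cost s S + net.cost s (l ` S)" unfolding net.cost_def
    by (subst nn_integral_add[symmetric]) (auto intro!: nn_integral_mono simp: indicator_def)
  also have "net.cost s (l ` S) = (\<integral>\<^sup>+Q. diameter_pow Q s \<partial>count_space (l ` S))"
    by (simp add: net.cost_def nn_integral_count_space_indicator)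
  also have "\<dots> = (\<integral>\<^sup>+Q. diameter_pow (l Q) s \<partial>count_space S)"
    using inj by (intro nn_integral_bij_count_space[symmetric] inj_on_imp_bij_betw)
  also have "\<dots> = (\<integral>\<^sup>+Q. diameter_pow Q s \<partial>count_space S)"
  proof (rule nn_integral_cong)
    fix Q assume "Q \<in> space (count_space S)"
    then obtain n k where Q: "Q = dyadic n k" using S by (metis dyadicsE space_count_space subsetD)
    show "diameter_pow (l Q) s = diameter_pow Q s" unfolding Q l using s by (simp add: diameter_pow_dyadic)
  qed
  also have "\<dots> = net.cost s S" by (simp add: net.cost_def nn_integral_count_space_indicator)
  finally show ?thesis using KU by (intro exI[of _ U]) (auto simp: U_def mult_2)
qed

text \<open>Capacitability gives the lower bound \<open>a\<close> for open supersets of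
  \<open>K\<close>. Enlarging a dyadic cover of \<open>K\<close> to an open set at most doubles the
  cost, so a cover of \<open>K\<close> cheaper than \<open>a / 2\<close> would contradict that
  bound.\<close>

lemma compact_subset_positive_net_content:
  assumes B: "B \<in> sets borel" and s: "s > 0" and pos: "hausdorff_measure s (B :: real set) \<noteq> 0"
  obtains K k where "compact K" "K \<subseteq> B" "K \<subseteq> dyadic 0 k" "net.net_content s K > 0"
proof -
  have "\<exists>k. hausdorff_content s (B \<inter> dyadic 0 k) > 0"
  proof (rule ccontr)
    assume "\<not> ?thesis"
    then have 0: "hausdorff_content s (B \<inter> dyadic 0 k) = 0" for k by (simp add: zero_less_iff_neq_zero)
    have "B = (\<Union>i. B \<inter> dyadic 0 (int_decode i))"
    proof -
      have "x \<in> dyadic 0 (int_decode (int_encode \<lfloor>x\<rfloor>))" for x by (simp add: dyadic_def)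
      then show ?thesis by blast
    qed
    then have "hausdorff_content s B \<le> (\<Sum>i. hausdorff_content s (B \<inter> dyadic 0 (int_decode i)))"
      using hausdorff_content_UN by metis
    then have "hausdorff_content s B = 0" by (simp add: 0)
    then show False using pos s hausdorff_measure_eq_0I by blast
  qed
  then obtain k where k: "hausdorff_content s (B \<inter> dyadic 0 k) > 0" by blast
  define A where "A = B \<inter> dyadic 0 k"
  have "net.net_content s A > 0" using k hausdorff_content_le_net_content[of s A] unfolding A_def by (rule less_le_trans)
  then obtain a where a: "0 < a" "a < net.net_content s A" using dense by blast
  obtain K where K: "compact K" "K \<subseteq> A" "\<And>U. open U \<Longrightarrow> K \<subseteq> U \<Longrightarrow> a < net.net_content s U"
  proof (rule choquet_capacitability[of "net.net_content s" A "{real_of_int k..real_of_int k + 1}" a])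
    show "analytic A" using B unfolding A_def by (intro analytic_borel) (auto simp: dyadic_eq)
    show "A \<subseteq> {real_of_int k..real_of_int k + 1}" by (auto simp: A_def dyadic_eq)
    show "net.net_content s A \<le> net.net_content s B" if "A \<subseteq> B" for A B by (rule net.net_content_mono[OF that])
    show "\<exists>n. a < net.net_content s (A n)" if "incseq A" "a < net.net_content s (\<Union>n::nat. A n)" for A a
      using less_le_trans[OF that(2) net.net_content_incseq[OF that(1)]] by (simp add: less_SUP_iff)
  qed (use a in auto)
  have "net.net_content s K > 0"
  proof (rule ccontr)
    assume "\<not> ?thesis"
    moreover have "0 < a / 2" using a by (simp add: ennreal_zero_less_divide)
    ultimately have "net.net_content s K < a / 2" by simp
    then obtain S where S: "S \<subseteq> dyadics" "K \<subseteq> \<Union>S" "net.cost s S < a / 2"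
      unfolding net.net_content_less_iff by blast
    obtain U where U: "open U" "K \<subseteq> U" "net.net_content s U \<le> 2 * net.cost s S"
      using net_content_open_superset[OF s S(1,2)] by blast
    have "2 * net.cost s S \<le> 2 * (a / 2)" using S(3) by (intro mult_left_mono) auto
    also have "\<dots> = a" by (simp add: ennreal_times_divide mult.commute mult_divide_eq_ennreal)
    finally show False using U K(3)[of U] by (meson leD order_trans)
  qed
  then show thesis using K by (intro that[of K k]) (auto simp: A_def)
qed

lemma div_bounds_int:
  fixes a q :: int assumes "0 < q"
  shows "a div q * q \<le> a" "a < (a div q + 1) * q"
proof -
  have "a div q * q + a mod q = a" "0 \<le> a mod q" "a mod q < q" using assms by auto
  then show "a div q * q \<le> a" "a < (a div q + 1) * q" unfolding distrib_right by linarith+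
qed

section \<open>The mass distribution on a compact set\<close>

locale dyadic_flow =
  fixes K :: "real set" and s :: real and k\<^sub>0 :: int
  assumes K: "compact K" "K \<subseteq> dyadic 0 k\<^sub>0" and s: "s > 0" and pos: "net.net_content s K > 0"
begin

definition m :: "nat \<Rightarrow> int \<Rightarrow> real" where
  "m n k = enn2real (net.net_content s (K \<inter> dyadic n k))"

text \<open>The mass of a dyadic interval is split among its two halves in proportion to
  the contents of the corresponding parts of \<open>K\<close>; the quotient is \<open>0/0\<close> only where there is
  no mass left to distribute.\<close>

fun flow :: "nat \<Rightarrow> int \<Rightarrow> real" where
  "flow 0 k = m 0 k"
| "flow (Suc n) k = flow n (k div 2) * m (Suc n) k / (m (Suc n) (2 * (k div 2)) + m (Suc n) (2 * (k div 2) + 1))"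

lemma content_le: "net.net_content s (K \<inter> dyadic n k) \<le> ennreal ((1 / 2^n) powr s)"
  using net.net_content_le_weight[of "dyadic n k" "K \<inter> dyadic n k" s] diameter_pow_dyadic[OF s, of n k] by simp

lemma ennreal_m: "ennreal (m n k) = net.net_content s (K \<inter> dyadic n k)"
  unfolding m_def using content_le[of n k] by (intro ennreal_enn2real) (auto simp: less_top intro: le_less_trans)

lemma m_nonneg [simp]: "0 \<le> m n k"
  by (simp add: m_def)

lemma m_le: "m n k \<le> (1 / 2^n) powr s"
  using content_le[of n k] unfolding ennreal_m[symmetric] by simp

lemma m_subadd: "m n k \<le> m (Suc n) (2 * k) + m (Suc n) (2 * k + 1)"
proof -
  have "K \<inter> dyadic n k = (K \<inter> dyadic (Suc n) (2 * k)) \<union> (K \<inter> dyadic (Suc n) (2 * k + 1))"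
    using dyadic_split[of n k] by blast
  then have "ennreal (m n k) \<le> ennreal (m (Suc n) (2 * k)) + ennreal (m (Suc n) (2 * k + 1))"
    unfolding ennreal_m by (simp add: net.net_content_Un)
  then show ?thesis by (simp add: ennreal_plus[symmetric] del: ennreal_plus)
qed

lemma m_eq_0: "K \<inter> dyadic n k = {} \<Longrightarrow> m n k = 0"
  by (simp add: m_def)

text \<open>By subadditivity the content of an interval is at most the sum \<open>d\<close> over its
  halves, so the proportionality factor is at most 1 and the mass never exceeds the content.\<close>

lemma flow_bounds: "0 \<le> flow n k \<and> flow n k \<le> m n k"
proof (induction n arbitrary: k)
  case (Suc n)
  define j where "j = k div 2"
  define d where "d = m (Suc n) (2 * j) + m (Suc n) (2 * j + 1)"
  have "flow n j \<le> d" using Suc[of j] m_subadd[of n j] by (simp add: d_def)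
  moreover have "0 \<le> d" by (simp add: d_def)
  moreover define q where "q = flow n j / d"
  ultimately have "q \<le> 1" "0 \<le> q" using Suc[of j] by (auto simp: divide_le_eq_1)
  moreover have "flow (Suc n) k = q * m (Suc n) k" by (simp add: q_def j_def d_def)
  ultimately show ?case using m_nonneg[of "Suc n" k] by (auto intro: mult_left_le_one_le)
qed simp

lemma flow_nonneg [simp]: "0 \<le> flow n k" using flow_bounds by blast

lemma flow_le: "flow n k \<le> (1 / 2^n) powr s" using flow_bounds[of n k] m_le[of n k] by linarith

lemma flow_eq_0: "K \<inter> dyadic n k = {} \<Longrightarrow> flow n k = 0"
  using flow_bounds[of n k] m_eq_0[of n k] by linarith

lemma flow_split: "flow (Suc n) (2 * k) + flow (Suc n) (2 * k + 1) = flow n k"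
proof -
  define d where "d = m (Suc n) (2 * k) + m (Suc n) (2 * k + 1)"
  have 1: "(2 * k) div 2 = k" "(2 * k + 1) div 2 = k" by auto
  have "flow (Suc n) (2 * k) + flow (Suc n) (2 * k + 1) = flow n k * d / d"
    unfolding flow.simps 1 d_def by (simp add: distrib_left add_divide_distrib)
  also have "\<dots> = flow n k"
  proof (cases "d = 0")
    case True
    then have "flow n k = 0" using flow_bounds[of n k] m_subadd[of n k] unfolding d_def by linarith
    then show ?thesis by simp
  qed simp
  finally show ?thesis .
qed

lemma flow_eq_0_outside: "k < k\<^sub>0 * 2^n \<or> (k\<^sub>0 + 1) * 2^n \<le> k \<Longrightarrow> flow n k = 0"
proof (rule flow_eq_0, rule ccontr)
  assume k: "k < k\<^sub>0 * 2^n \<or> (k\<^sub>0 + 1) * 2^n \<le> k" and "K \<inter> dyadic n k \<noteq> {}"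
  then obtain x where x: "x \<in> K" "\<lfloor>x * 2^n\<rfloor> = k" by (auto simp: dyadic_def)
  then have "\<lfloor>x\<rfloor> = k\<^sub>0" using K by (auto simp: dyadic_def)
  then have "k div 2^n = k\<^sub>0" using floor_mult_power2[of 0 n x] x by simp
  moreover have "k div 2^n * 2^n \<le> k" "k < (k div 2^n + 1) * 2^n" by (rule div_bounds_int, simp)+
  ultimately show False using k by auto
qed

text \<open>No mass of level \<open>n\<close> lies at an index below \<open>k\<^sub>0 * 2^n\<close>,
  so this is the distribution function of the level at the point j/2^n.\<close>

definition cumulative :: "nat \<Rightarrow> int \<Rightarrow> real" where
  "cumulative n j = (\<Sum>k\<in>{k\<^sub>0 * 2^n..<j}. flow n k)"

lemma cumulative_Suc: "cumulative n (j + 1) = cumulative n j + flow n j"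
proof (cases "k\<^sub>0 * 2^n \<le> j")
  case True
  then have "{k\<^sub>0 * 2^n..<j + 1} = insert j {k\<^sub>0 * 2^n..<j}" by auto
  then show ?thesis by (simp add: cumulative_def)
next
  case False
  then show ?thesis by (simp add: cumulative_def flow_eq_0_outside)
qed

lemma cumulative_mono: "i \<le> j \<Longrightarrow> cumulative n i \<le> cumulative n j"
  unfolding cumulative_def by (intro sum_mono2) auto

lemma cumulative_double: "cumulative (Suc n) (2 * j) = cumulative n j"
proof (cases "k\<^sub>0 * 2^n \<le> j")
  case True
  then show ?thesis
  proof (induction j rule: int_ge_induct)
    case base show ?case by (simp add: cumulative_def)
  next
    case (step j)
    have "cumulative (Suc n) (2 * (j + 1)) = cumulative (Suc n) (2 * j + 1 + 1)" by (simp add: algebra_simps)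
    also have "\<dots> = cumulative (Suc n) (2 * j) + flow (Suc n) (2 * j) + flow (Suc n) (2 * j + 1)"
      by (simp only: cumulative_Suc)
    also have "\<dots> = cumulative n j + flow n j" using step flow_split[of n j] by (simp del: flow.simps)
    finally show ?case by (simp add: cumulative_Suc)
  qed
next
  case False
  then show ?thesis by (simp add: cumulative_def)
qed

lemma cumulative_scale: "cumulative (n + d) (j * 2^d) = cumulative n j"
proof (induction d)
  case (Suc d)
  have "cumulative (n + Suc d) (j * 2^Suc d) = cumulative (Suc (n + d)) (2 * (j * 2^d))" by (simp add: ac_simps)
  then show ?case using Suc cumulative_double by simp
qed simp

text \<open>The distribution function of the limit measure; \<open>interval_measure\<close> then
  turns it into a Borel measure.\<close>

definition G :: "real \<Rightarrow> real" where "G x = (SUP n. cumulative n \<lfloor>x * 2^n\<rfloor>)"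

text \<open>At any two levels, the value at the left end of the interval through \<open>x\<close> is
  at most the value at the right end, since both can be read off at the finer level. This bounds the
  supremum in \<open>G\<close>.\<close>

lemma cumulative_le:
  fixes x :: real shows "cumulative r \<lfloor>x * 2^r\<rfloor> \<le> cumulative n (\<lfloor>x * 2^n\<rfloor> + 1)"
proof (cases "n \<le> r")
  case True
  have "\<lfloor>x * 2^r\<rfloor> \<le> (\<lfloor>x * 2^n\<rfloor> + 1) * 2^(r - n)"
    unfolding floor_mult_power2[OF True, of x] by (intro less_imp_le div_bounds_int(2)) simp
  then have "cumulative r \<lfloor>x * 2^r\<rfloor> \<le> cumulative r ((\<lfloor>x * 2^n\<rfloor> + 1) * 2^(r - n))" by (rule cumulative_mono)
  also have "\<dots> = cumulative n (\<lfloor>x * 2^n\<rfloor> + 1)" using cumulative_scale[of n "r - n"] True by simp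
  finally show ?thesis .
next
  case False
  have "\<lfloor>x * 2^r\<rfloor> * 2^(n - r) \<le> \<lfloor>x * 2^n\<rfloor>"
    using floor_mult_power2[of r n x] div_bounds_int(1)[of "2^(n-r)" "\<lfloor>x * 2^n\<rfloor>"] False by simp
  then have "\<lfloor>x * 2^r\<rfloor> * 2^(n - r) \<le> \<lfloor>x * 2^n\<rfloor> + 1" by simp
  then have "cumulative n (\<lfloor>x * 2^r\<rfloor> * 2^(n - r)) \<le> cumulative n (\<lfloor>x * 2^n\<rfloor> + 1)" by (rule cumulative_mono)
  then show ?thesis using cumulative_scale[of r "n - r"] False by simp
qed

lemma G_bounds: "cumulative n \<lfloor>x * 2^n\<rfloor> \<le> G x" "G x \<le> cumulative n (\<lfloor>x * 2^n\<rfloor> + 1)"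
  unfolding G_def using cumulative_le
  by (auto intro!: cSUP_upper cSUP_least bdd_aboveI2[where M = "cumulative n (\<lfloor>x * 2^n\<rfloor> + 1)"])

lemma G_mono:
  assumes "x \<le> y" shows "G x \<le> G y"
  unfolding G_def
proof (rule cSUP_mono)
  show "bdd_above (range (\<lambda>n. cumulative n \<lfloor>y * 2^n\<rfloor>))"
    using cumulative_le[of _ y 0] by (rule bdd_aboveI2)
  fix n :: nat
  show "\<exists>r\<in>UNIV. cumulative n \<lfloor>x * 2^n\<rfloor> \<le> cumulative r \<lfloor>y * 2^r\<rfloor>"
    using assms by (intro bexI[of _ n]) (auto intro!: cumulative_mono floor_mono)
qed simp

lemma power2_powr_tendsto_0: "(\<lambda>n. (1 / 2^n) powr s) \<longlonglongrightarrow> 0"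
proof -
  have "(\<lambda>n. ((1/2) powr s) ^ n) \<longlonglongrightarrow> 0"
    by (rule LIMSEQ_power_zero) (use s powr_less_mono2[of s "1/2" 1] in simp)
  moreover have "((1/2) powr s) ^ n = (1 / 2^n) powr s" for n
    by (simp add: powr_power[symmetric] powr_powr powr_realpow[symmetric] powr_minus powr_divide ac_simps)
  ultimately show ?thesis by simp
qed

text \<open>At level \<open>n + d\<close> the two bounds for \<open>G\<close> differ by the mass of
  one interval, which tends to 0 as \<open>d\<close> grows.\<close>

lemma G_dyadic: "G (real_of_int j / 2^n) = cumulative n j"
proof (rule antisym)
  show "cumulative n j \<le> G (real_of_int j / 2^n)" using G_bounds(1)[of n "real_of_int j / 2^n"] by simp
  have "G (real_of_int j / 2^n) - cumulative n j \<le> (1 / 2^d) powr s" for d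
  proof -
    have e: "real_of_int j / 2^n * 2^(n + d) = real_of_int (j * 2^d)" by (simp add: power_add)
    have "G (real_of_int j / 2^n) \<le> cumulative (n + d) (j * 2^d + 1)"
      using G_bounds(2)[of "real_of_int j / 2^n" "n + d"] unfolding e floor_of_int .
    also have "\<dots> = cumulative n j + flow (n + d) (j * 2^d)" by (simp only: cumulative_Suc cumulative_scale)
    also have "flow (n + d) (j * 2^d) \<le> (1 / 2^(n+d)) powr s" by (rule flow_le)
    also have "(1 / 2^(n+d)) powr s \<le> (1 / 2^d :: real) powr s"
      using s by (intro powr_mono2) (auto simp: field_simps power_add)
    finally show ?thesis by simp
  qed
  then have "G (real_of_int j / 2^n) - cumulative n j \<le> 0"
    by (intro tendsto_lowerbound[OF power2_powr_tendsto_0]) auto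
  then show "G (real_of_int j / 2^n) \<le> cumulative n j" by simp
qed

text \<open>An interval of length at most 2^-n meets at most two intervals of level
  \<open>n\<close>, each of mass at most 2^(-n s); hence the factor 2.\<close>

lemma G_increment:
  assumes "x \<le> y" "y \<le> x + 1 / 2^n" shows "G y - G x \<le> 2 * (1 / 2^n) powr s"
proof -
  define j where "j = \<lfloor>x * 2^n\<rfloor>"
  have "y * 2^n \<le> x * 2^n + 1" using mult_right_mono[OF assms(2), of "2^n"] by (simp add: distrib_right)
  then have "\<lfloor>y * 2^n\<rfloor> \<le> j + 1" unfolding j_def using floor_mono by fastforce
  then have "G y \<le> cumulative n (j + 1 + 1)" using G_bounds(2)[of y n] cumulative_mono[of "\<lfloor>y * 2^n\<rfloor> + 1" "j+1+1" n] by simp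
  also have "\<dots> = cumulative n j + flow n j + flow n (j + 1)" by (simp only: cumulative_Suc)
  also have "\<dots> \<le> G x + 2 * (1 / 2^n) powr s" using G_bounds(1)[of n x] flow_le[of n j] flow_le[of n "j+1"] by (simp add: j_def)
  finally show ?thesis by simp
qed

lemma G_right_continuous: "continuous (at_right x) G"
  unfolding continuous_within
proof (rule tendstoI)
  fix e :: real assume "e > 0"
  then have "\<forall>\<^sub>F n in sequentially. (1 / 2^n) powr s < e / 2"
    using order_tendstoD(2)[OF power2_powr_tendsto_0, of "e/2"] by simp
  then obtain n where n: "(1 / 2^n) powr s < e / 2" by (auto simp: eventually_sequentially)
  have "\<forall>\<^sub>F y in at_right x. x < y \<and> y < x + 1 / 2^n"
    by (rule eventually_at_rightI[of x "x + 1 / 2^n"]) auto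
  then show "\<forall>\<^sub>F y in at_right x. dist (G y) (G x) < e"
  proof eventually_elim
    case (elim y)
    then have "G y - G x \<le> 2 * (1 / 2^n) powr s" "G x \<le> G y" using G_increment G_mono by auto
    then show ?case using n by (simp add: dist_real_def)
  qed
qed

definition \<mu> :: "real measure" where "\<mu> = interval_measure G"

lemma sets_\<mu> [simp, measurable_cong]: "sets \<mu> = sets borel"
  by (simp add: \<mu>_def)

lemma space_\<mu> [simp]: "space \<mu> = UNIV"
  by (simp add: \<mu>_def)

lemma emeasure_Ioc: "a \<le> b \<Longrightarrow> emeasure \<mu> {a<..b} = ennreal (G b - G a)"
  unfolding \<mu>_def by (rule emeasure_interval_measure_Ioc) (auto intro: G_mono G_right_continuous)

lemma emeasure_Compl_K: "emeasure \<mu> (- K) = 0"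
proof -
  \<comment> \<open>\<open>interval_measure\<close> is evaluated on intervals open at the left,
    while \<open>dyadic\<close> intervals are open at the right. Requiring in \<open>P\<close> that
    the closed interval misses \<open>K\<close> serves both.\<close>
  define I where "I = (\<lambda>(n::nat, j::int). {real_of_int j / 2^n <.. (real_of_int j + 1) / 2^n})"
  define P where "P = {(n, j). {real_of_int j / 2^n .. (real_of_int j + 1) / 2^n} \<inter> K = {}}"
  have "- K \<subseteq> (\<Union>p\<in>P. I p)"
  proof
    fix x assume "x \<in> - K"
    moreover have "open (- K)" using K compact_imp_closed by (auto simp: open_Compl)
    ultimately obtain e where e: "e > 0" "ball x e \<subseteq> - K" by (auto simp: open_contains_ball)
    obtain n where n: "(1/2)^n < e" using real_arch_pow_inv[of e "1/2"] e by auto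
    define j where "j = \<lceil>x * 2^n\<rceil> - 1"
    have j: "real_of_int j < x * 2^n" "x * 2^n \<le> real_of_int j + 1" unfolding j_def by linarith+
    then have *: "real_of_int j / 2^n < x" "x \<le> (real_of_int j + 1) / 2^n" by (auto simp: field_simps)
    have w: "(real_of_int j + 1) / 2^n = real_of_int j / 2^n + (1/2)^n" by (simp add: add_divide_distrib power_divide)
    have "{real_of_int j / 2^n .. (real_of_int j + 1) / 2^n} \<subseteq> ball x e"
      using * n unfolding w by (auto simp: dist_real_def)
    then have "(n, j) \<in> P" using e by (auto simp: P_def)
    moreover have "x \<in> I (n, j)" using * by (auto simp: I_def)
    ultimately show "x \<in> (\<Union>p\<in>P. I p)" by blast
  qed
  moreover have "(\<Union>p\<in>P. I p) \<in> null_sets \<mu>"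
  proof (rule null_sets_UN')
    show "countable P" by simp
    fix p assume p: "p \<in> P"
    obtain n j where nj: "p = (n, j)" by (cases p)
    have "{real_of_int j / 2^n .. (real_of_int j + 1) / 2^n} \<inter> K = {}" using p nj by (simp add: P_def)
    moreover have "dyadic n j \<subseteq> {real_of_int j / 2^n .. (real_of_int j + 1) / 2^n}" by (auto simp: dyadic_eq)
    ultimately have "K \<inter> dyadic n j = {}" by blast
    then have "flow n j = 0" by (rule flow_eq_0)
    moreover have "G ((real_of_int j + 1) / 2^n) = cumulative n (j + 1)" using G_dyadic[of "j + 1" n] by simp
    ultimately have "G ((real_of_int j + 1) / 2^n) = G (real_of_int j / 2^n)" by (simp add: G_dyadic cumulative_Suc)
    then have "emeasure \<mu> (I p) = 0" unfolding nj I_def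
      by (simp add: emeasure_Ioc divide_right_mono)
    moreover have "I p \<in> sets \<mu>" by (simp add: I_def nj)
    ultimately show "I p \<in> null_sets \<mu>" by auto
  qed
  ultimately show ?thesis using emeasure_eq_0[of "\<Union>p\<in>P. I p" \<mu> "- K"] by (auto simp: null_sets_def)
qed

lemma emeasure_ball: "emeasure \<mu> {x - 1 / 2^n .. x + 1 / 2^n} \<le> ennreal (6 * (1 / 2^n) powr s)"
proof -
  define h :: real where "h = 1 / 2^n"
  have h: "h > 0" by (simp add: h_def)
  have "emeasure \<mu> {x - h .. x + h} \<le> emeasure \<mu> {x - 2 * h <.. x + h}" using h by (intro emeasure_mono) auto
  also have "\<dots> = ennreal (G (x + h) - G (x - 2 * h))" using h by (intro emeasure_Ioc) auto
  \<comment> \<open>Three steps of length \<open>h\<close>, each contributing at most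
    \<open>2 * h powr s\<close>; the leftmost one makes room for the half-open interval.\<close>
  also have "\<dots> \<le> ennreal (6 * h powr s)"
    using G_increment[of "x - 2*h" "x - h" n] G_increment[of "x - h" x n] G_increment[of x "x + h" n] h
    by (intro ennreal_leI) (simp add: h_def[symmetric])
  finally show ?thesis unfolding h_def .
qed

lemma emeasure_UNIV_pos: "0 < emeasure \<mu> UNIV"
proof -
  have "G (real_of_int (k\<^sub>0 + 1) / 2^0) = cumulative 0 (k\<^sub>0 + 1)" "G (real_of_int k\<^sub>0 / 2^0) = cumulative 0 k\<^sub>0"
    by (rule G_dyadic)+
  then have "G (real_of_int k\<^sub>0 + 1) - G (real_of_int k\<^sub>0) = m 0 k\<^sub>0" by (simp add: cumulative_Suc)
  moreover have "K \<inter> dyadic 0 k\<^sub>0 = K" using K by blast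
  then have "ennreal (m 0 k\<^sub>0) > 0" using pos by (simp add: ennreal_m)
  ultimately have "0 < emeasure \<mu> {real_of_int k\<^sub>0 <.. real_of_int k\<^sub>0 + 1}" by (simp add: emeasure_Ioc)
  also have "\<dots> \<le> emeasure \<mu> UNIV" by (intro emeasure_mono) auto
  finally show ?thesis .
qed

lemma finite_\<mu>: "finite_measure \<mu>"
proof
  have "emeasure \<mu> UNIV \<le> emeasure \<mu> ({real_of_int k\<^sub>0 - 1 <.. real_of_int k\<^sub>0 + 1} \<union> - K)"
    using K borel_compact[OF K(1)] by (intro emeasure_mono) (auto simp: dyadic_eq)
  also have "\<dots> \<le> emeasure \<mu> {real_of_int k\<^sub>0 - 1 <.. real_of_int k\<^sub>0 + 1} + emeasure \<mu> (- K)"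
    using borel_compact[OF K(1)] by (intro emeasure_subadditive) auto
  also have "\<dots> < top" by (simp add: emeasure_Compl_K emeasure_Ioc)
  finally show "emeasure \<mu> (space \<mu>) \<noteq> \<infinity>" by simp
qed

end

text \<open>The diameter bound on \<open>K\<close> is included because increments of the process are
  later controlled over times at most 1 apart.\<close>

theorem frostman:
  assumes B: "B \<in> sets borel" and s: "s > 0" and pos: "hausdorff_measure s (B :: real set) \<noteq> 0"
  obtains K \<mu> where "compact K" "K \<subseteq> B" "\<And>x y. x \<in> K \<Longrightarrow> y \<in> K \<Longrightarrow> \<bar>x - y\<bar> \<le> 1"
    "finite_measure \<mu>" "sets \<mu> = sets borel" "emeasure \<mu> (- K) = 0" "0 < emeasure \<mu> UNIV"
    "\<And>x n. emeasure \<mu> {x - 1 / 2^n .. x + 1 / 2^n} \<le> ennreal (6 * (1 / 2^n) powr s)"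
proof -
  obtain K k where K: "compact K" "K \<subseteq> B" "K \<subseteq> dyadic 0 k" "net.net_content s K > 0"
    using compact_subset_positive_net_content[OF assms] by blast
  interpret dyadic_flow K s k by unfold_locales (use K s in auto)
  show thesis
  proof
    show "compact K" "K \<subseteq> B" by fact+
    show "\<bar>x - y\<bar> \<le> 1" if "x \<in> K" "y \<in> K" for x y
      using subsetD[OF \<open>K \<subseteq> dyadic 0 k\<close> that(1)] subsetD[OF \<open>K \<subseteq> dyadic 0 k\<close> that(2)] by (auto simp: dyadic_eq)
  qed (use finite_\<mu> emeasure_Compl_K emeasure_UNIV_pos emeasure_ball in auto)
qed

section \<open>Oscillation of paths\<close>

text \<open>A move need not start where the previous one ended; this makes the notion insensitive to passing
  from an interval to a dense set of times.\<close>

fun moves :: "real \<Rightarrow> ('t::linorder \<Rightarrow> real) \<Rightarrow> nat \<Rightarrow> 't set \<Rightarrow> bool" where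
  "moves r f 0 T \<longleftrightarrow> True"
| "moves r f (Suc n) T \<longleftrightarrow> (\<exists>t\<in>T. \<exists>u\<in>T. t < u \<and> r < \<bar>f u - f t\<bar> \<and> moves r f n (T \<inter> {u..}))"

lemma moves_SucI:
  "t \<in> T \<Longrightarrow> u \<in> T \<Longrightarrow> t < u \<Longrightarrow> r < \<bar>f u - f t\<bar> \<Longrightarrow> moves r f n T' \<Longrightarrow> T \<inter> {u..} = T' \<Longrightarrow> moves r f (Suc n) T"
  by auto

lemma moves_mono: "moves r f n T \<Longrightarrow> T \<subseteq> T' \<Longrightarrow> moves r f n T'"
proof (induction n arbitrary: T T')
  case (Suc n)
  from Suc.prems(1) obtain t u where t: "t \<in> T" "u \<in> T" "t < u" "r < \<bar>f u - f t\<bar>" "moves r f n (T \<inter> {u..})"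
    by auto
  have "moves r f n (T' \<inter> {u..})" using Suc.prems(2) by (intro Suc.IH[OF t(5)]) auto
  then show ?case using Suc.prems(2) t by (intro moves_SucI[of t _ u]) auto
qed simp

lemma moves_Suc_imp: "moves r f (Suc n) T \<Longrightarrow> moves r f n T"
  by (auto intro: moves_mono)

lemma moves_cong:
  assumes "\<And>t u. t \<in> T \<Longrightarrow> u \<in> T \<Longrightarrow> t < u \<Longrightarrow> (r < \<bar>f u - f t\<bar>) = (r' < \<bar>g u - g t\<bar>)"
  shows "moves r f n T \<longleftrightarrow> moves r' g n T"
  using assms
proof (induction n arbitrary: T)
  case (Suc n)
  have "moves r f n (T \<inter> {u..}) \<longleftrightarrow> moves r' g n (T \<inter> {u..})" for u
    using Suc.prems by (intro Suc.IH) auto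
  then show ?case using Suc.prems by (simp cong: conj_cong bex_cong)
qed simp

lemma moves_image:
  assumes "strict_mono h"
  shows "moves r f n (h ` T) \<longleftrightarrow> moves r (\<lambda>t. f (h t)) n T"
proof (induction n arbitrary: T)
  case (Suc n)
  have "h ` T \<inter> {h u..} = h ` (T \<inter> {u..})" for u
    using strict_mono_less_eq[OF assms] by auto
  then show ?case using Suc strict_mono_less[OF assms] by auto
qed simp

lemma moves_UN:
  assumes "incseq G" "moves r f n (\<Union>i. G i)" shows "\<exists>i::nat. moves r f n (G i)"
  using assms
proof (induction n arbitrary: G)
  case (Suc n)
  then obtain t u i j where tu: "t \<in> G i" "u \<in> G j" "t < u" "r < \<bar>f u - f t\<bar>" "moves r f n ((\<Union>i. G i) \<inter> {u..})" by auto
  have "(\<Union>i. G i) \<inter> {u..} = (\<Union>i. G i \<inter> {u..})" by blast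
  moreover have "incseq (\<lambda>i. G i \<inter> {u..})" using Suc.prems(1) by (auto simp: incseq_def)
  ultimately obtain k where k: "moves r f n (G k \<inter> {u..})" using Suc.IH[of "\<lambda>i. G i \<inter> {u..}"] tu(5) by auto
  define l where "l = max k (max i j)"
  have sub: "G i \<subseteq> G l" "G j \<subseteq> G l" "G k \<subseteq> G l" using Suc.prems(1) by (auto simp: l_def incseq_def)
  have "moves r f n (G l \<inter> {u..})" by (rule moves_mono[OF k]) (use sub in auto)
  then have "moves r f (Suc n) (G l)" using tu sub by auto
  then show ?case by blast
qed simp

text \<open>Raising the left end slightly affects only a first move that starts exactly at \<tau>,
  and right continuity lets it start a little later.\<close>

lemma moves_shift:
  fixes f :: "real \<Rightarrow> real"
  assumes "moves r f n {\<tau>..b}" "\<tau> < b" "(f \<longlongrightarrow> f \<tau>) (at_right \<tau>)"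
  shows "\<forall>\<^sub>F u in at_right \<tau>. moves r f n {u..b}"
proof (cases n)
  case (Suc k)
  then obtain t u1 where t: "t \<in> {\<tau>..b}" "u1 \<in> {\<tau>..b}" "t < u1" "r < \<bar>f u1 - f t\<bar>" "moves r f k ({\<tau>..b} \<inter> {u1..})"
    using assms(1) by auto
  have eq: "{u..b} \<inter> {u1..} = {\<tau>..b} \<inter> {u1..}" if "u < u1" for u using that t by auto
  show ?thesis
  proof (cases "\<tau> < t")
    case True
    have "\<forall>\<^sub>F u in at_right \<tau>. u < t" using True by (auto simp: eventually_at_right_field)
    then show ?thesis
    proof eventually_elim
      case (elim u)
      then show ?case unfolding Suc using t eq[of u] by (intro moves_SucI[of t _ u1]) auto
    qed
  next
    case False
    then have [simp]: "t = \<tau>" using t by auto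
    have "((\<lambda>u. \<bar>f u1 - f u\<bar>) \<longlongrightarrow> \<bar>f u1 - f \<tau>\<bar>) (at_right \<tau>)" using assms(3) by (intro tendsto_intros)
    then have "\<forall>\<^sub>F u in at_right \<tau>. r < \<bar>f u1 - f u\<bar>" using t by (intro order_tendstoD) auto
    moreover have "\<forall>\<^sub>F u in at_right \<tau>. u < u1" using t by (auto simp: eventually_at_right_field)
    ultimately show ?thesis
    proof eventually_elim
      case (elim u)
      then show ?case unfolding Suc using t eq[of u] by (intro moves_SucI[of u _ u1]) auto
    qed
  qed
qed simp

text \<open>Both ends of a move are pushed slightly to the right into \<open>D\<close>, the later
  end first so that the earlier one can stay below it; the remaining moves survive by
  \<open>moves_shift\<close>. The endpoint \<open>b\<close> cannot be pushed and must lie in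
  \<open>D\<close>.\<close>

lemma moves_dense:
  fixes f :: "real \<Rightarrow> real"
  assumes cont: "\<And>t. a \<le> t \<Longrightarrow> t < b \<Longrightarrow> (f \<longlongrightarrow> f t) (at_right t)"
    and dense: "\<And>t P. a \<le> t \<Longrightarrow> t < b \<Longrightarrow> eventually P (at_right t) \<Longrightarrow> \<exists>d\<in>D. t < d \<and> d \<le> b \<and> P d"
    and b: "b \<in> D"
  shows "a \<le> u0 \<Longrightarrow> moves r f n {u0..b} \<Longrightarrow> moves r f n (D \<inter> {u0..b})"
proof (induction n arbitrary: u0)
  case (Suc n)
  then obtain t u where t: "t \<in> {u0..b}" "u \<in> {u0..b}" "t < u" "r < \<bar>f u - f t\<bar>" "moves r f n ({u0..b} \<inter> {u..})"
    by auto
  have "{u0..b} \<inter> {u..} = {u..b}" using t by auto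
  then have ch: "moves r f n {u..b}" using t(5) by (simp only:)
  have "\<exists>u'\<in>D. u \<le> u' \<and> u' \<le> b \<and> r < \<bar>f u' - f t\<bar> \<and> moves r f n {u'..b}"
  proof (cases "u = b")
    case True then show ?thesis using b t ch by auto
  next
    case False
    then have u: "a \<le> u" "u < b" using t Suc.prems by auto
    have "((\<lambda>x. \<bar>f x - f t\<bar>) \<longlongrightarrow> \<bar>f u - f t\<bar>) (at_right u)" using cont[OF u] by (intro tendsto_intros)
    then have "\<forall>\<^sub>F x in at_right u. r < \<bar>f x - f t\<bar>" using t by (intro order_tendstoD) auto
    moreover have "\<forall>\<^sub>F x in at_right u. moves r f n {x..b}" by (rule moves_shift[OF ch u(2) cont[OF u]])
    ultimately have "\<forall>\<^sub>F x in at_right u. r < \<bar>f x - f t\<bar> \<and> moves r f n {x..b}" by (rule eventually_conj)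
    from dense[OF u this] show ?thesis by (auto intro: less_imp_le)
  qed
  then obtain u' where u': "u' \<in> D" "u \<le> u'" "u' \<le> b" "r < \<bar>f u' - f t\<bar>" "moves r f n {u'..b}" by blast
  have ta: "a \<le> t" "t < b" using t Suc.prems by auto
  have "((\<lambda>x. \<bar>f u' - f x\<bar>) \<longlongrightarrow> \<bar>f u' - f t\<bar>) (at_right t)" using cont[OF ta] by (intro tendsto_intros)
  then have "\<forall>\<^sub>F x in at_right t. r < \<bar>f u' - f x\<bar>" using u' by (intro order_tendstoD) auto
  moreover have "\<forall>\<^sub>F x in at_right t. x < u'" using t u' by (auto simp: eventually_at_right_field)
  ultimately have "\<forall>\<^sub>F x in at_right t. r < \<bar>f u' - f x\<bar> \<and> x < u'" by (rule eventually_conj)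
  from dense[OF ta this] obtain t' where t': "t' \<in> D" "t < t'" "t' \<le> b" "r < \<bar>f u' - f t'\<bar>" "t' < u'" by blast
  have "moves r f n (D \<inter> {u'..b})" using u' t Suc.prems by (intro Suc.IH) auto
  moreover have "D \<inter> {u'..b} = D \<inter> {u0..b} \<inter> {u'..}" using u' t by auto
  ultimately have "moves r f n (D \<inter> {u0..b} \<inter> {u'..})" by simp
  then show ?case using t t' u' by (intro moves_SucI[of t' _ u']) auto
qed simp

text \<open>Greedy cutting: \<tau> is the infimum of the times at which some move is completed. Left
  of \<tau> the oscillation is at most \<open>r\<close>, and from \<tau> on one move fewer is
  possible; \<open>moves_shift\<close> covers the case in which the infimum is not attained.\<close>

lemma not_moves_cover:
  fixes f :: "real \<Rightarrow> real"
  assumes cont: "\<And>t. a \<le> t \<Longrightarrow> t < b \<Longrightarrow> (f \<longlongrightarrow> f t) (at_right t)"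
  shows "a \<le> a' \<Longrightarrow> a' \<le> b \<Longrightarrow> \<not> moves r f n {a'..b} \<Longrightarrow> 
    \<exists>P. {a'..b} = (\<Union>i<n. P i) \<and> (\<forall>i<n. \<forall>t\<in>P i. \<forall>u\<in>P i. t < u \<longrightarrow> \<bar>f u - f t\<bar> \<le> r)"
proof (induction n arbitrary: a')
  case (Suc n)
  define S where "S = {u\<in>{a'..b}. \<exists>t\<in>{a'..b}. t < u \<and> r < \<bar>f u - f t\<bar>}"
  have S_moves: "\<not> moves r f n {u..b}" if uS: "u \<in> S" for u
  proof
    assume "moves r f n {u..b}"
    moreover have "{a'..b} \<inter> {u..} = {u..b}" using that by (auto simp: S_def)
    moreover obtain t where "t \<in> {a'..b}" "t < u" "r < \<bar>f u - f t\<bar>" "u \<in> {a'..b}" using uS by (auto simp: S_def)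
    ultimately have "moves r f (Suc n) {a'..b}" by (intro moves_SucI[of t _ u])
    then show False using Suc.prems by blast
  qed
  show ?case
  proof (cases "S = {}")
    case True
    define P where "P i = (if i = 0 then {a'..b} else {})" for i :: nat
    have "{a'..b} = (\<Union>i<Suc n. P i)" by (auto simp: P_def split: if_splits)
    moreover have "\<forall>i<Suc n. \<forall>t\<in>P i. \<forall>u\<in>P i. t < u \<longrightarrow> \<bar>f u - f t\<bar> \<le> r"
    proof (intro allI impI ballI)
      fix i t u assume i: "i < Suc n" "t \<in> P i" "u \<in> P i" "t < u"
      then have "t \<in> {a'..b}" "u \<in> {a'..b}" by (auto simp: P_def split: if_splits)
      moreover have "u \<notin> S" using True by simp
      ultimately show "\<bar>f u - f t\<bar> \<le> r" using i(4) unfolding S_def mem_Collect_eq by (meson not_less)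
    qed
    ultimately show ?thesis by blast
  next
    case False
    define \<tau> where "\<tau> = Inf S"
    have bdd: "bdd_below S" by (auto simp: S_def intro: bdd_belowI[of _ a'])
    have \<tau>: "a' \<le> \<tau>" "\<tau> \<le> b"
    proof -
      show "a' \<le> \<tau>" unfolding \<tau>_def using False by (intro cInf_greatest) (auto simp: S_def)
      obtain x where "x \<in> S" using False by blast
      then have "\<tau> \<le> x" "x \<le> b" unfolding \<tau>_def using bdd by (auto intro: cInf_lower simp: S_def)
      then show "\<tau> \<le> b" by linarith
    qed
    have "\<not> moves r f n {\<tau>..b}"
    proof (cases "\<tau> \<in> S")
      case True then show ?thesis by (rule S_moves)
    next
      case False': False
      show ?thesis
      proof
        assume ch: "moves r f n {\<tau>..b}"
        obtain x where x: "x \<in> S" using False by blast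
        then have "\<tau> \<le> x" "x \<noteq> \<tau>" "x \<le> b" using bdd False' unfolding \<tau>_def by (auto intro: cInf_lower simp: S_def)
        then have "\<tau> < b" by linarith
        from moves_shift[OF ch this cont] \<tau> this Suc.prems
        have "\<forall>\<^sub>F u in at_right \<tau>. moves r f n {u..b}" by auto
        then obtain e where e: "e > \<tau>" "\<And>u. \<tau> < u \<Longrightarrow> u < e \<Longrightarrow> moves r f n {u..b}"
          by (auto simp: eventually_at_right_field)
        obtain u where u: "u \<in> S" "u < e" using cInf_lessD[OF False, of e] e unfolding \<tau>_def by blast
        have "\<tau> \<le> u" using bdd u unfolding \<tau>_def by (auto intro: cInf_lower)
        moreover have "u \<noteq> \<tau>" using u False' by auto
        ultimately show False using e(2)[of u] u S_moves[of u] by auto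
      qed
    qed
    from Suc.IH[OF _ \<tau>(2) this] Suc.prems \<tau> obtain P where P: "{\<tau>..b} = (\<Union>i<n. P i)"
      "\<forall>i<n. \<forall>t\<in>P i. \<forall>u\<in>P i. t < u \<longrightarrow> \<bar>f u - f t\<bar> \<le> r" by auto
    define Q where "Q = case_nat {a'..<\<tau>} P"
    have "{a'..b} = {a'..<\<tau>} \<union> {\<tau>..b}" using \<tau> by auto
    also have "\<dots> = (\<Union>i<Suc n. Q i)" unfolding P(1) lessThan_Suc_eq_insert_0 by (simp add: Q_def)
    finally have 1: "{a'..b} = (\<Union>i<Suc n. Q i)" .
    have "\<bar>f u - f t\<bar> \<le> r" if "t \<in> {a'..<\<tau>}" "u \<in> {a'..<\<tau>}" "t < u" for t u
    proof (rule ccontr)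
      assume "\<not> ?thesis"
      then have "u \<in> S" using that \<tau> by (auto simp: S_def intro!: bexI[of _ t])
      then have "\<tau> \<le> u" unfolding \<tau>_def using bdd by (rule cInf_lower)
      then show False using that by auto
    qed
    then have 2: "\<forall>i<Suc n. \<forall>t\<in>Q i. \<forall>u\<in>Q i. t < u \<longrightarrow> \<bar>f u - f t\<bar> \<le> r"
      using P(2) by (auto simp: Q_def split: nat.splits)
    show ?thesis using 1 2 by blast
  qed
qed simp

text \<open>The number of pieces is the least \<open>n\<close> for which \<open>n\<close> moves are
  impossible. It is written as a sum of indicators so that, for a random path, it is measurable and
  can be integrated term by term.\<close>

lemma hausdorff_content_graph_le_moves:
  fixes f :: "real \<Rightarrow> real"
  assumes cont: "\<And>t. a \<le> t \<Longrightarrow> t < b \<Longrightarrow> (f \<longlongrightarrow> f t) (at_right t)" and ab: "a \<le> b" and r: "0 \<le> r"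
    and W: "W > 0" "\<And>P. P \<subseteq> {a..b} \<Longrightarrow> (\<And>t u. t \<in> P \<Longrightarrow> u \<in> P \<Longrightarrow> \<bar>f u - f t\<bar> \<le> r) \<Longrightarrow>
       hausdorff_content \<gamma> ((\<lambda>t. (t, f t)) ` P) \<le> W"
  shows "hausdorff_content \<gamma> ((\<lambda>t. (t, f t)) ` {a..b}) \<le> W * (\<Sum>n. indicator {n. moves r f n {a..b}} n)"
proof (cases "\<forall>n. moves r f n {a..b}")
  case True
  have "(\<Sum>n::nat. 1 :: ennreal) = top"
    unfolding suminf_eq_SUP by (simp add: ennreal_SUP_of_nat_eq_top)
  then show ?thesis using True W by (simp add: ennreal_mult_top)
next
  case False
  define n where "n = (LEAST n. \<not> moves r f n {a..b})"
  have n: "\<not> moves r f n {a..b}" unfolding n_def using False by (metis LeastI)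
  have less: "moves r f k {a..b}" if "k < n" for k using that not_less_Least unfolding n_def by blast
  obtain P where P: "{a..b} = (\<Union>i<n. P i)" "\<forall>i<n. \<forall>t\<in>P i. \<forall>u\<in>P i. t < u \<longrightarrow> \<bar>f u - f t\<bar> \<le> r"
    using not_moves_cover[OF cont order_refl ab n] by blast
  have "(\<lambda>t. (t, f t)) ` {a..b} = (\<Union>i\<in>{..<n}. (\<lambda>t. (t, f t)) ` P i)" unfolding P(1) by blast
  then have "hausdorff_content \<gamma> ((\<lambda>t. (t, f t)) ` {a..b}) \<le> (\<Sum>i<n. hausdorff_content \<gamma> ((\<lambda>t. (t, f t)) ` P i))"
    using hausdorff_content_UN_finite[of "{..<n}" \<gamma> "\<lambda>i. (\<lambda>t. (t, f t)) ` P i"] by simp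
  also have "\<dots> \<le> (\<Sum>i<n. W)"
  proof (rule sum_mono)
    fix i assume i: "i \<in> {..<n}"
    show "hausdorff_content \<gamma> ((\<lambda>t. (t, f t)) ` P i) \<le> W"
    proof (rule W(2))
      show "P i \<subseteq> {a..b}" using P(1) i by blast
      fix t u assume "t \<in> P i" "u \<in> P i"
      then have "t < u \<Longrightarrow> \<bar>f u - f t\<bar> \<le> r" "u < t \<Longrightarrow> \<bar>f t - f u\<bar> \<le> r" using P(2) i by blast+
      then show "\<bar>f u - f t\<bar> \<le> r" using r by (cases t u rule: linorder_cases) (auto simp: abs_minus_commute)
    qed
  qed
  also have "\<dots> = W * (\<Sum>i<n. indicator {n. moves r f n {a..b}} i)"
    using less by (simp add: indicator_def mult.commute)
  also have "\<dots> \<le> W * (\<Sum>i. indicator {n. moves r f n {a..b}} i)"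
    by (intro mult_left_mono sum_le_suminf) (auto simp: summableI)
  finally show ?thesis .
qed

lemma bounded_graph_piece:
  fixes f :: "real \<Rightarrow> real"
  assumes P: "P \<subseteq> {a..b}" "\<And>t u. t \<in> P \<Longrightarrow> u \<in> P \<Longrightarrow> \<bar>f u - f t\<bar> \<le> r" and ab: "a \<le> b" "0 \<le> r"
  shows "bounded ((\<lambda>t. (t, f t)) ` P)" "diameter ((\<lambda>t. (t, f t)) ` P) \<le> (b - a) + r"
proof -
  have d: "dist (t, f t) (u, f u) \<le> (b - a) + r" if "t \<in> P" "u \<in> P" for t u
  proof -
    have "dist (t, f t) (u, f u) \<le> \<bar>t - u\<bar> + \<bar>f t - f u\<bar>"
      unfolding dist_prod_def dist_real_def fst_conv snd_conv by (rule sqrt_sum_squares_le_sum) auto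
    moreover have "\<bar>t - u\<bar> \<le> b - a" using subsetD[OF P(1) that(1)] subsetD[OF P(1) that(2)] by auto
    ultimately show ?thesis using P(2)[of u t] that by linarith
  qed
  then show "bounded ((\<lambda>t. (t, f t)) ` P)" unfolding bounded_two_points by auto
  show "diameter ((\<lambda>t. (t, f t)) ` P) \<le> (b - a) + r"
    by (rule diameter_le) (use d ab in \<open>auto simp: dist_norm[symmetric]\<close>)
qed

lemma hausdorff_content_graph_piece:
  fixes f :: "real \<Rightarrow> real"
  assumes P: "P \<subseteq> {a..b}" "\<And>t u. t \<in> P \<Longrightarrow> u \<in> P \<Longrightarrow> \<bar>f u - f t\<bar> \<le> r" and ab: "a \<le> b" "0 \<le> r" and \<gamma>: "\<gamma> > 0"
  shows "hausdorff_content \<gamma> ((\<lambda>t. (t, f t)) ` P) \<le> ennreal (((b - a) + r) powr \<gamma>)"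
proof -
  have "hausdorff_content \<gamma> ((\<lambda>t. (t, f t)) ` P) \<le> diameter_pow ((\<lambda>t. (t, f t)) ` P) \<gamma>"
    by (rule hausdorff_content_le_diameter_pow[OF bounded_graph_piece(1)[OF assms(1-4)]])
  also have "\<dots> \<le> ennreal (((b - a) + r) powr \<gamma>)"
    using bounded_graph_piece[OF assms(1-4)] \<gamma>
    by (auto simp: diameter_pow_def diameter_ge_0 intro!: ennreal_leI powr_mono2)
  finally show ?thesis .
qed

text \<open>The values on \<open>P\<close> stay within \<open>r\<close> of \<open>f t0\<close>, so
  at most \<open>2 * r / h + 1\<close> strips of height \<open>h\<close> contain them; the part in
  one strip has diameter at most \<open>2 * h\<close>.\<close>

lemma hausdorff_content_graph_piece_squares:
  fixes f :: "real \<Rightarrow> real"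
  assumes P: "P \<subseteq> {a..a + h}" "\<And>t u. t \<in> P \<Longrightarrow> u \<in> P \<Longrightarrow> \<bar>f u - f t\<bar> \<le> r" and h: "0 < h" "0 \<le> r" and \<gamma>: "\<gamma> > 0"
  shows "hausdorff_content \<gamma> ((\<lambda>t. (t, f t)) ` P) \<le> ennreal ((2 * r / h + 1) * (2 * h) powr \<gamma>)"
proof (cases "P = {}")
  case False
  then obtain t0 where t0: "t0 \<in> P" by blast
  define k where "k t = nat \<lfloor>(f t - (f t0 - r)) / h\<rfloor>" for t
  define N where "N = nat \<lfloor>2 * r / h\<rfloor>"
  have kN: "k t \<le> N" "real (k t) * h \<le> f t - (f t0 - r)" "f t - (f t0 - r) \<le> (real (k t) + 1) * h" if "t \<in> P" for t
  proof -
    have 1: "0 \<le> f t - (f t0 - r)" "f t - (f t0 - r) \<le> 2 * r" using P(2)[OF t0 that] by auto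
    have "(f t - (f t0 - r)) / h \<le> 2 * r / h" using 1 h by (intro divide_right_mono) auto
    then show "k t \<le> N" unfolding k_def N_def by (intro nat_mono floor_mono)
    have "0 \<le> (f t - (f t0 - r)) / h" using 1 h by simp
    then have "real (k t) \<le> (f t - (f t0 - r)) / h" "(f t - (f t0 - r)) / h \<le> real (k t) + 1"
      unfolding k_def by linarith+
    then show "real (k t) * h \<le> f t - (f t0 - r)" "f t - (f t0 - r) \<le> (real (k t) + 1) * h"
      using h by (auto simp: field_simps)
  qed
  have "(\<lambda>t. (t, f t)) ` P = (\<Union>i\<in>{..N}. (\<lambda>t. (t, f t)) ` {t\<in>P. k t = i})" using kN by auto
  then have "hausdorff_content \<gamma> ((\<lambda>t. (t, f t)) ` P) \<le> (\<Sum>i\<in>{..N}. hausdorff_content \<gamma> ((\<lambda>t. (t, f t)) ` {t\<in>P. k t = i}))"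
    using hausdorff_content_UN_finite[of "{..N}" \<gamma> "\<lambda>i. (\<lambda>t. (t, f t)) ` {t\<in>P. k t = i}"] by simp
  also have "\<dots> \<le> (\<Sum>i\<in>{..N}. ennreal ((2 * h) powr \<gamma>))"
  proof (rule sum_mono)
    fix i
    have "hausdorff_content \<gamma> ((\<lambda>t. (t, f t)) ` {t\<in>P. k t = i}) \<le> ennreal (((a + h - a) + h) powr \<gamma>)"
    proof (rule hausdorff_content_graph_piece)
      fix t u assume "t \<in> {t\<in>P. k t = i}" "u \<in> {t\<in>P. k t = i}"
      then show "\<bar>f u - f t\<bar> \<le> h" using kN(2,3)[of t] kN(2,3)[of u] by (auto simp: distrib_right)
    qed (use P h \<gamma> in auto)
    also have "a + h - a + h = 2 * h" by simp
    finally show "hausdorff_content \<gamma> ((\<lambda>t. (t, f t)) ` {t\<in>P. k t = i}) \<le> ennreal ((2 * h) powr \<gamma>)" .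
  qed
  also have "\<dots> = ennreal ((real N + 1) * (2 * h) powr \<gamma>)"
    by (subst sum_ennreal, simp, simp add: add.commute)
  also have "\<dots> \<le> ennreal ((2 * r / h + 1) * (2 * h) powr \<gamma>)"
  proof (intro ennreal_leI mult_right_mono)
    have "0 \<le> 2 * r / h" using h by simp
    then show "real N + 1 \<le> 2 * r / h + 1" unfolding N_def by linarith
  qed simp
  finally show ?thesis .
qed simp

section \<open>Oscillation of random walks and of the process\<close>

declare moves.simps(2) [simp del]

lemma sets_moves:
  fixes g :: "'t::linorder \<Rightarrow> 'b \<Rightarrow> real"
  assumes "finite T" "\<And>l. l \<in> T \<Longrightarrow> g l \<in> borel_measurable N"
  shows "{d\<in>space N. moves r (\<lambda>l. g l d) n T} \<in> sets N"
  using assms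
proof (induction n arbitrary: T)
  case (Suc n)
  have "{d\<in>space N. moves r (\<lambda>l. g l d) (Suc n) T} =
     (\<Union>t\<in>T. \<Union>u\<in>{u\<in>T. t < u}. {d\<in>space N. r < \<bar>g u d - g t d\<bar>} \<inter> {d\<in>space N. moves r (\<lambda>l. g l d) n (T \<inter> {u..})})"
    by (auto simp: moves.simps(2))
  also have "\<dots> \<in> sets N"
  proof (intro sets.finite_UN sets.Int)
    fix t u assume tu: "t \<in> T" "u \<in> {u\<in>T. t < u}"
    then have [measurable]: "g t \<in> borel_measurable N" "g u \<in> borel_measurable N" using Suc.prems by auto
    show "{d\<in>space N. r < \<bar>g u d - g t d\<bar>} \<in> sets N" by measurable
    show "{d\<in>space N. moves r (\<lambda>l. g l d) n (T \<inter> {u..})} \<in> sets N" using Suc.prems by (intro Suc.IH) auto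
  qed (use Suc.prems in auto)
  finally show ?case .
qed simp

definition partial_sum :: "(nat \<Rightarrow> 'b \<Rightarrow> real) \<Rightarrow> 'b \<Rightarrow> nat \<Rightarrow> real" where
  "partial_sum D \<omega> l = (\<Sum>i<l. D i \<omega>)"

text \<open>Only differences of partial sums matter, so the event is a function of the increments
  with index in \<open>{i..<j}\<close>. Events over disjoint blocks thereby become
  independent.\<close>

lemma moves_partial_sum_restrict:
  "moves r (partial_sum D \<omega>) n {i..j} \<longleftrightarrow> moves r (\<lambda>l. \<Sum>k\<in>{i..<l}. restrict (\<lambda>k. D k \<omega>) {i..<j} k) n {i..j}"
proof (rule moves_cong)
  fix t u assume tu: "t \<in> {i..j}" "u \<in> {i..j}" "t < u"
  have "{..<u} = {..<t} \<union> {t..<u}" "{..<t} \<inter> {t..<u} = {}" using tu by auto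
  then have 1: "partial_sum D \<omega> u - partial_sum D \<omega> t = (\<Sum>k\<in>{t..<u}. D k \<omega>)"
    unfolding partial_sum_def by (simp add: sum.union_disjoint)
  have "{i..<u} = {i..<t} \<union> {t..<u}" "{i..<t} \<inter> {t..<u} = {}" using tu by auto
  then have "(\<Sum>k\<in>{i..<u}. restrict (\<lambda>k. D k \<omega>) {i..<j} k) - (\<Sum>k\<in>{i..<t}. restrict (\<lambda>k. D k \<omega>) {i..<j} k)
     = (\<Sum>k\<in>{t..<u}. restrict (\<lambda>k. D k \<omega>) {i..<j} k)"
    by (simp add: sum.union_disjoint)
  also have "\<dots> = (\<Sum>k\<in>{t..<u}. D k \<omega>)" using tu by (intro sum.cong) auto
  finally show "(r < \<bar>partial_sum D \<omega> u - partial_sum D \<omega> t\<bar>) = (r < \<bar>(\<Sum>k\<in>{i..<u}. restrict (\<lambda>k. D k \<omega>) {i..<j} k) - (\<Sum>k\<in>{i..<t}. restrict (\<lambda>k. D k \<omega>) {i..<j} k)\<bar>)"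
    using 1 by simp
qed

lemma sets_moves_restrict:
  fixes i j :: nat assumes "j' \<le> j"
  shows "{d\<in>space (PiM {i..<j} (\<lambda>_. borel)). moves r (\<lambda>l. \<Sum>k\<in>{i..<l}. d k :: real) n {i..j'}} \<in> sets (PiM {i..<j} (\<lambda>_. borel))"
proof (rule sets_moves)
  fix l assume l: "l \<in> {i..j'}"
  show "(\<lambda>d. \<Sum>k\<in>{i..<l}. d k :: real) \<in> borel_measurable (PiM {i..<j} (\<lambda>_. borel))"
    using l assms by (intro borel_measurable_sum measurable_component_singleton) auto
qed simp

section \<open>Geometric tails for the moves of a random walk\<close>

context prob_space
begin

text \<open>A discrete strong Markov property: decompose according to the first time at which a move is complete.\<close>

lemma prob_moves_le_power:
  assumes D: "indep_vars (\<lambda>_. borel) D {..<m}"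
    and q: "prob {\<omega>\<in>space M. moves r (partial_sum D \<omega>) 1 {0..m}} \<le> q"
  shows "i \<le> m \<Longrightarrow> prob {\<omega>\<in>space M. moves r (partial_sum D \<omega>) n {i..m}} \<le> q ^ n"
proof (induction n arbitrary: i)
  case (Suc n)
  have Dm: "D k \<in> borel_measurable M" if "k < m" for k using D that by (auto simp: indep_vars_def)
  have Sm: "(\<lambda>\<omega>. partial_sum D \<omega> l) \<in> borel_measurable M" if "l \<le> m" for l
    unfolding partial_sum_def using Dm that by (intro borel_measurable_sum) auto
  have ev: "{\<omega>\<in>space M. moves r (partial_sum D \<omega>) n' {i'..j'}} \<in> events" if "j' \<le> m" for n' i' j'
    by (rule sets_moves[of "{i'..j'}" "\<lambda>l \<omega>. partial_sum D \<omega> l" M r n'])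
       (use that in \<open>auto intro!: Sm\<close>)
  define first where "first j = {\<omega>\<in>space M. moves r (partial_sum D \<omega>) 1 {i..j} \<and> \<not> moves r (partial_sum D \<omega>) 1 {i..j-1}}" for j
  define E where "E j = {\<omega>\<in>space M. moves r (partial_sum D \<omega>) n {j..m}}" for j
  have first_ev: "first j \<in> events" if "j \<le> m" for j
  proof -
    have "first j = {\<omega>\<in>space M. moves r (partial_sum D \<omega>) 1 {i..j}} - {\<omega>\<in>space M. moves r (partial_sum D \<omega>) 1 {i..j-1}}"
      by (auto simp: first_def)
    also have "\<dots> \<in> events" by (intro sets.Diff ev) (use that in linarith)+
    finally show ?thesis .
  qed
  \<comment> \<open>\<open>first j\<close> is determined by the increments before \<open>j\<close>,
    and \<open>E j\<close> by those from \<open>j\<close> on.\<close>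
  have indep: "prob (first j \<inter> E j) = prob (first j) * prob (E j)" if j: "i < j" "j \<le> m" for j
  proof -
    have iv: "indep_var (PiM {i..<j} (\<lambda>_. borel)) (\<lambda>\<omega>. restrict (\<lambda>k. D k \<omega>) {i..<j})
        (PiM {j..<m} (\<lambda>_. borel)) (\<lambda>\<omega>. restrict (\<lambda>k. D k \<omega>) {j..<m})"
      using j by (intro indep_var_restrict[OF D]) auto
    define A where "A = {d\<in>space (PiM {i..<j} (\<lambda>_. borel)). moves r (\<lambda>l. \<Sum>k\<in>{i..<l}. d k :: real) 1 {i..j}}
       - {d\<in>space (PiM {i..<j} (\<lambda>_. borel)). moves r (\<lambda>l. \<Sum>k\<in>{i..<l}. d k :: real) 1 {i..j-1}}"
    define B where "B = {d\<in>space (PiM {j..<m} (\<lambda>_. borel)). moves r (\<lambda>l. \<Sum>k\<in>{j..<l}. d k :: real) n {j..m}}"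
    have AB: "A \<in> sets (PiM {i..<j} (\<lambda>_. borel))" "B \<in> sets (PiM {j..<m} (\<lambda>_. borel))"
      unfolding A_def B_def by (intro sets.Diff sets_moves_restrict; linarith)+
    have restr: "restrict (\<lambda>k. D k \<omega>) I \<in> space (PiM I (\<lambda>_. borel))" for \<omega> I by (auto simp: space_PiM)
    have "moves r (partial_sum D \<omega>) 1 {i..j-1} \<longleftrightarrow>
       moves r (\<lambda>l. \<Sum>k\<in>{i..<l}. restrict (\<lambda>k. D k \<omega>) {i..<j} k) 1 {i..j-1}" for \<omega>
    proof -
      have "(\<Sum>k\<in>{i..<l}. restrict (\<lambda>k. D k \<omega>) {i..<j-1} k) = (\<Sum>k\<in>{i..<l}. restrict (\<lambda>k. D k \<omega>) {i..<j} k)"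
        if "l \<le> j-1" for l using that by (intro sum.cong) auto
      then show ?thesis
        unfolding moves_partial_sum_restrict[of r D \<omega> 1 i "j-1"]
        by (intro moves_cong) (simp only: atLeastAtMost_iff)
    qed
    then have first_eq: "first j = (\<lambda>\<omega>. restrict (\<lambda>k. D k \<omega>) {i..<j}) -` A \<inter> space M"
      unfolding first_def A_def moves_partial_sum_restrict[of r D _ 1 i j] using restr by auto
    have E_eq: "E j = (\<lambda>\<omega>. restrict (\<lambda>k. D k \<omega>) {j..<m}) -` B \<inter> space M"
      unfolding E_def B_def moves_partial_sum_restrict[of r D _ n j m] using restr by auto
    have "first j \<inter> E j = (\<lambda>\<omega>. (restrict (\<lambda>k. D k \<omega>) {i..<j}, restrict (\<lambda>k. D k \<omega>) {j..<m})) -` (A \<times> B) \<inter> space M"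
      unfolding first_eq E_eq by auto
    then show ?thesis using indep_varD[OF iv AB] first_eq E_eq by simp
  qed
  have sub: "{\<omega>\<in>space M. moves r (partial_sum D \<omega>) (Suc n) {i..m}} \<subseteq> (\<Union>j\<in>{i<..m}. first j \<inter> E j)"
  proof
    fix \<omega> assume "\<omega> \<in> {\<omega>\<in>space M. moves r (partial_sum D \<omega>) (Suc n) {i..m}}"
    then obtain t u where tu: "\<omega> \<in> space M" "t \<in> {i..m}" "u \<in> {i..m}" "t < u" "r < \<bar>partial_sum D \<omega> u - partial_sum D \<omega> t\<bar>"
       "moves r (partial_sum D \<omega>) n ({i..m} \<inter> {u..})" by (auto simp: moves.simps(2))
    have "moves r (partial_sum D \<omega>) (Suc 0) {i..u}" using tu by (intro moves_SucI[of t _ u]) auto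
    then have ex: "moves r (partial_sum D \<omega>) 1 {i..u}" by simp
    define j where "j = (LEAST j. moves r (partial_sum D \<omega>) 1 {i..j})"
    have j: "moves r (partial_sum D \<omega>) 1 {i..j}" "j \<le> u"
      unfolding j_def using ex by (rule LeastI, rule Least_le)
    have ij: "i < j"
    proof (rule ccontr)
      assume "\<not> i < j" then show False using j(1) by (auto simp: moves.simps(2))
    qed
    then have "\<not> moves r (partial_sum D \<omega>) 1 {i..j-1}"
      using not_less_Least[of "j - 1" "\<lambda>j. moves r (partial_sum D \<omega>) 1 {i..j}"] unfolding j_def[symmetric] by auto
    moreover have "moves r (partial_sum D \<omega>) n {j..m}"
      by (rule moves_mono[OF tu(6)]) (use j in auto)
    ultimately have "\<omega> \<in> first j \<inter> E j" using j tu by (auto simp: first_def E_def)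
    then show "\<omega> \<in> (\<Union>j\<in>{i<..m}. first j \<inter> E j)" using ij j tu by auto
  qed
  have E_ev: "E j \<in> events" for j unfolding E_def by (rule ev) simp
  have "prob {\<omega>\<in>space M. moves r (partial_sum D \<omega>) (Suc n) {i..m}} \<le> prob (\<Union>j\<in>{i<..m}. first j \<inter> E j)"
    using sub first_ev E_ev by (intro finite_measure_mono) auto
  also have "\<dots> \<le> (\<Sum>j\<in>{i<..m}. prob (first j \<inter> E j))"
    using first_ev E_ev by (intro finite_measure_subadditive_finite) auto
  also have "\<dots> = (\<Sum>j\<in>{i<..m}. prob (first j) * prob (E j))" by (intro sum.cong indep) auto
  also have "\<dots> \<le> (\<Sum>j\<in>{i<..m}. prob (first j) * q^n)"
    unfolding E_def by (intro sum_mono mult_left_mono Suc.IH) auto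
  also have "\<dots> = (\<Sum>j\<in>{i<..m}. prob (first j)) * q^n" by (simp add: sum_distrib_right)
  \<comment> \<open>The events \<open>first j\<close> are disjoint, and each implies a move within
    \<open>{0..m}\<close>; hence their probabilities sum to at most \<open>q\<close>.\<close>
  also have "(\<Sum>j\<in>{i<..m}. prob (first j)) = prob (\<Union>j\<in>{i<..m}. first j)"
  proof (rule finite_measure_finite_Union[symmetric])
    show "disjoint_family_on first {i<..m}"
      unfolding disjoint_family_on_def
    proof (intro ballI impI)
      have *: "first j \<inter> first k = {}" if "j < k" for j k
      proof -
        have "j \<le> k - 1" using that by simp
        then have "{i..j} \<subseteq> {i..k-1}" by auto
        then show ?thesis unfolding first_def using moves_mono[of r _ 1 "{i..j}" "{i..k-1}"] by blast
      qed
      then show "first j \<inter> first k = {}" if "j \<noteq> k" for j k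
        using that *[of j k] *[of k j] by (metis Int_commute linorder_neqE_nat)
    qed
  qed (use first_ev in auto)
  also have "prob (\<Union>j\<in>{i<..m}. first j) \<le> prob {\<omega>\<in>space M. moves r (partial_sum D \<omega>) 1 {0..m}}"
    unfolding first_def using ev by (intro finite_measure_mono) (auto intro: moves_mono)
  finally have "prob {\<omega>\<in>space M. moves r (partial_sum D \<omega>) (Suc n) {i..m}} \<le>
     prob {\<omega>\<in>space M. moves r (partial_sum D \<omega>) 1 {0..m}} * q^n"
    using zero_le_power[OF order_trans[OF measure_nonneg q], of n] by (auto intro: mult_right_mono)
  also have "\<dots> \<le> q * q^n" using q order_trans[OF measure_nonneg q] by (intro mult_right_mono) auto
  finally show ?case by simp
qed simp

text \<open>By independence the joint law of the increments is the product of their laws, and the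
  event is a function of the increments.\<close>

lemma prob_moves_eq:
  assumes D: "indep_vars (\<lambda>_. borel) D {..<m}" and D': "indep_vars (\<lambda>_. borel) D' {..<m}"
    and eq: "\<And>i. i < m \<Longrightarrow> distr M borel (D i) = distr M borel (D' i)"
  shows "prob {\<omega>\<in>space M. moves r (partial_sum D \<omega>) n {0..m}} = prob {\<omega>\<in>space M. moves r (partial_sum D' \<omega>) n {0..m}}"
proof (cases "m = 0")
  case True
  have "partial_sum D \<omega> l = 0" "partial_sum D' \<omega> l = 0" if "l \<in> {0..m}" for \<omega> l using that True by (auto simp: partial_sum_def)
  then have "moves r (partial_sum D \<omega>) n {0..m} = moves r (partial_sum D' \<omega>) n {0..m}" for \<omega>
    by (intro moves_cong) auto
  then show ?thesis by simp
next
  case False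
  define A where "A = {d\<in>space (PiM {0..<m} (\<lambda>_. borel)). moves r (\<lambda>l. \<Sum>k\<in>{0..<l}. d k :: real) n {0..m}}"
  have A: "A \<in> sets (PiM {0..<m} (\<lambda>_. borel))" unfolding A_def by (rule sets_moves_restrict) simp
  have *: "prob {\<omega>\<in>space M. moves r (partial_sum D \<omega>) n {0..m}} = measure (PiM {0..<m} (\<lambda>i. distr M borel (D i))) A"
    if D: "indep_vars (\<lambda>_. borel) D {..<m}" for D
  proof -
    have D0: "indep_vars (\<lambda>_. borel) D {0..<m}" using D by (simp add: atLeast0LessThan)
    have rv: "random_variable borel (D i)" if "i \<in> {0..<m}" for i using D0 that by (auto simp: indep_vars_def)
    have "PiM {0..<m} (\<lambda>i. distr M borel (D i)) = distr M (PiM {0..<m} (\<lambda>_. borel)) (\<lambda>\<omega>. \<lambda>i\<in>{0..<m}. D i \<omega>)"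
      using indep_vars_iff_distr_eq_PiM'[where I = "{0..<m}" and M' = "\<lambda>_. borel" and X = D] rv D0 False by auto
    then have "measure (PiM {0..<m} (\<lambda>i. distr M borel (D i))) A = prob ((\<lambda>\<omega>. \<lambda>i\<in>{0..<m}. D i \<omega>) -` A \<inter> space M)"
      using A rv by (simp add: measure_distr measurable_restrict)
    also have "(\<lambda>\<omega>. \<lambda>i\<in>{0..<m}. D i \<omega>) -` A \<inter> space M = {\<omega>\<in>space M. moves r (partial_sum D \<omega>) n {0..m}}"
      unfolding A_def moves_partial_sum_restrict[of r D _ n 0 m] by (auto simp: space_PiM)
    finally show ?thesis by simp
  qed
  have "PiM {0..<m} (\<lambda>i. distr M borel (D i)) = PiM {0..<m} (\<lambda>i. distr M borel (D' i))"
    using eq by (intro PiM_cong) auto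
  then show ?thesis unfolding *[OF D] *[OF D'] by simp
qed

end

section \<open>Cadlag paths and dyadic grids of times\<close>

lemma cadlag_tendsto_right: "cadlag f \<Longrightarrow> 0 \<le> t \<Longrightarrow> (f \<longlongrightarrow> f t) (at_right t)"
  by (simp add: cadlag_def continuous_within)

text \<open>Bisection: near each point the one-sided limits bound the path, and bounds on adjacent
  intervals combine.\<close>

lemma cadlag_bounded:
  assumes f: "cadlag f" shows "\<exists>B. \<forall>t\<in>{0..1}. \<bar>f t\<bar> \<le> B"
proof -
  have "\<exists>B. \<forall>t\<in>{0..1} \<inter> {0..1}. \<bar>f t\<bar> \<le> B"
  proof (rule Bolzano[of 0 1 "\<lambda>a b. \<exists>B. \<forall>t\<in>{a..b} \<inter> {0..1}. \<bar>f t\<bar> \<le> B"])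
    fix a b d :: real
    assume "\<exists>B. \<forall>t\<in>{a..b} \<inter> {0..1}. \<bar>f t\<bar> \<le> B" "\<exists>B. \<forall>t\<in>{b..d} \<inter> {0..1}. \<bar>f t\<bar> \<le> B"
    then obtain B B' where B: "\<forall>t\<in>{a..b} \<inter> {0..1}. \<bar>f t\<bar> \<le> B" "\<forall>t\<in>{b..d} \<inter> {0..1}. \<bar>f t\<bar> \<le> B'" by blast
    have "\<bar>f t\<bar> \<le> max B B'" if "t \<in> {a..d} \<inter> {0..1}" for t
      using B that by (cases "t \<le> b") (auto simp: le_max_iff_disj)
    then show "\<exists>B. \<forall>t\<in>{a..d} \<inter> {0..1}. \<bar>f t\<bar> \<le> B" by blast
  next
    fix x :: real assume x: "0 \<le> x" "x \<le> 1"
    have "((\<lambda>t. \<bar>f t\<bar>) \<longlongrightarrow> \<bar>f x\<bar>) (at_right x)" using cadlag_tendsto_right[OF f x(1)] by (intro tendsto_intros)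
    then have "\<forall>\<^sub>F t in at_right x. \<bar>f t\<bar> < \<bar>f x\<bar> + 1" by (intro order_tendstoD) auto
    then obtain e where e: "e > x" "\<And>t. x < t \<Longrightarrow> t < e \<Longrightarrow> \<bar>f t\<bar> < \<bar>f x\<bar> + 1"
      by (auto simp: eventually_at_right_field)
    have "\<exists>e' B'. e' < x \<and> (\<forall>t. e' < t \<longrightarrow> t < x \<longrightarrow> 0 \<le> t \<longrightarrow> \<bar>f t\<bar> < B')"
    proof (cases "x = 0")
      case True then show ?thesis by (intro exI[of _ "-1"] exI[of _ 0]) auto
    next
      case False
      then have "0 < x" using x by simp
      then obtain l where "(f \<longlongrightarrow> l) (at_left x)" using f unfolding cadlag_def by blast
      then have "((\<lambda>t. \<bar>f t\<bar>) \<longlongrightarrow> \<bar>l\<bar>) (at_left x)" by (intro tendsto_intros)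
      then have "\<forall>\<^sub>F t in at_left x. \<bar>f t\<bar> < \<bar>l\<bar> + 1" by (intro order_tendstoD) auto
      then show ?thesis by (auto simp: eventually_at_left_field)
    qed
    then obtain e' B' where e': "e' < x" "\<And>t. e' < t \<Longrightarrow> t < x \<Longrightarrow> 0 \<le> t \<Longrightarrow> \<bar>f t\<bar> < B'" by blast
    define d where "d = min (e - x) (x - e')"
    have "\<bar>f t\<bar> \<le> max (\<bar>f x\<bar> + 1) B'" if "a \<le> x" "x \<le> b" "b - a < d" "t \<in> {a..b} \<inter> {0..1}" for a b t
    proof (cases t x rule: linorder_cases)
      case less
      then have "\<bar>f t\<bar> < B'" using that by (intro e') (auto simp: d_def)
      then show ?thesis by simp
    next
      case greater
      then have "\<bar>f t\<bar> < \<bar>f x\<bar> + 1" using that by (intro e) (auto simp: d_def)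
      then show ?thesis by simp
    qed auto
    moreover have "d > 0" using e e' by (simp add: d_def)
    ultimately show "\<exists>d>0. \<forall>a b. a \<le> x \<and> x \<le> b \<and> b - a < d \<longrightarrow> (\<exists>B. \<forall>t\<in>{a..b} \<inter> {0..1}. \<bar>f t\<bar> \<le> B)"
      by blast
  qed simp
  then show ?thesis by simp
qed

definition grid :: "real \<Rightarrow> real \<Rightarrow> nat \<Rightarrow> real set" where
  "grid a h j = (\<lambda>i. a + real i * h / 2^j) ` {0..2^j}"

lemma grid_subset:
  assumes "0 \<le> h" shows "grid a h j \<subseteq> {a..a+h}"
proof -
  have "real i * h / 2^j \<le> h" if "i \<le> 2^j" for i
  proof -
    have "real i \<le> 2^j" using that by (metis of_nat_le_iff of_nat_numeral of_nat_power)
    then have "real i * h \<le> 2^j * h" using assms by (intro mult_right_mono)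
    then show ?thesis by (simp add: divide_le_eq mult.commute)
  qed
  then show ?thesis using assms by (auto simp: grid_def)
qed

lemma incseq_grid: "incseq (grid a h)"
proof (rule incseq_SucI)
  fix j
  have "a + real i * h / 2^j = a + real (2 * i) * h / 2^Suc j" for i by simp
  then show "grid a h j \<subseteq> grid a h (Suc j)"
    unfolding grid_def by (intro image_subsetI image_eqI[where x = "2 * _"]) auto
qed

lemma grid_dense:
  assumes t: "a \<le> t" "t < a + h" and P: "eventually P (at_right t)"
  shows "\<exists>d\<in>\<Union>j. grid a h j. t < d \<and> d \<le> a + h \<and> P d"
proof -
  have h: "h > 0" using t by linarith
  obtain e where e: "e > t" "\<And>y. t < y \<Longrightarrow> y < e \<Longrightarrow> P y" using P by (auto simp: eventually_at_right_field)
  define e' where "e' = min (e - t) (a + h - t)"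
  have "e' > 0" using e t by (simp add: e'_def)
  then obtain j where j: "(1/2)^j < e' / h" using h real_arch_pow_inv[of "e'/h" "1/2"] by auto
  then have j: "h / 2^j < e'" using h by (simp add: power_divide field_simps)
  \<comment> \<open>The first grid index strictly beyond \<open>t\<close>; strictness matters
    because \<open>P\<close> is known only to the right of \<open>t\<close>.\<close>
  define i where "i = nat \<lfloor>(t - a) * 2^j / h\<rfloor> + 1"
  have 0: "0 \<le> (t - a) * 2^j / h" using t h by simp
  have "real i - 1 \<le> (t - a) * 2^j / h" "(t - a) * 2^j / h < real i" unfolding i_def using 0 by linarith+
  then have "(real i - 1) * h \<le> (t - a) * 2^j" "(t - a) * 2^j < real i * h" using h by (auto simp: field_simps)
  then have "(real i - 1) * h / 2^j \<le> t - a" "t - a < real i * h / 2^j" by (simp_all add: divide_le_eq less_divide_eq)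
  then have 1: "t < a + real i * h / 2^j" "a + real i * h / 2^j \<le> t + h / 2^j"
    by (simp_all add: left_diff_distrib diff_divide_distrib)
  then have 2: "a + real i * h / 2^j < e" "a + real i * h / 2^j < a + h" using j by (auto simp: e'_def)
  then have "real i * h < 2^j * h" by (simp add: field_simps)
  then have "real i < 2^j" using h by simp
  then have "i \<le> 2^j" by (metis less_imp_le of_nat_less_iff of_nat_numeral of_nat_power)
  then have "a + real i * h / 2^j \<in> grid a h j" by (auto simp: grid_def)
  then show ?thesis using 1 2 e by (intro bexI[of _ "a + real i * h / 2^j"]) auto
qed

section \<open>The process along grids of times\<close>

context levy_process
begin

lemma tendsto_right: "\<omega> \<in> space M \<Longrightarrow> 0 \<le> t \<Longrightarrow> ((\<lambda>s. X s \<omega>) \<longlongrightarrow> X t \<omega>) (at_right t)"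
  using cadlag_paths cadlag_tendsto_right by blast

definition increment :: "real \<Rightarrow> real \<Rightarrow> nat \<Rightarrow> nat \<Rightarrow> 'a \<Rightarrow> real" where
  "increment a h j i \<omega> = X (a + real (Suc i) * h / 2^j) \<omega> - X (a + real i * h / 2^j) \<omega>"

lemma indep_increments:
  assumes "0 \<le> a" "0 < h" shows "indep_vars (\<lambda>_. borel) (increment a h j) {..<2^j}"
proof -
  have "a + real i * h / 2^j < a + real (Suc i) * h / 2^j" for i
    using assms by (simp add: divide_strict_right_mono)
  then show ?thesis
    using independent_increments[of "\<lambda>i. a + real i * h / 2^j" "2^j"] assms unfolding increment_def by simp
qed

lemma distr_increment:
  assumes "0 \<le> a" "0 < h"
  shows "distr M borel (increment a h j i) = distr M borel (\<lambda>\<omega>. X (h / 2^j) \<omega> - X 0 \<omega>)"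
proof -
  have "a + real (Suc i) * h / 2^j = (a + real i * h / 2^j) + h / 2^j" by (simp add: add_divide_distrib distrib_right)
  then show ?thesis
    unfolding increment_def using assms stationary_increments[of "a + real i * h / 2^j" "h / 2^j"]
    by (simp only:) simp
qed

lemma partial_sum_increment: "partial_sum (increment a h j) \<omega> l = X (a + real l * h / 2^j) \<omega> - X a \<omega>"
  unfolding partial_sum_def increment_def
  by (induction l) (simp_all del: of_nat_Suc)

lemma moves_grid_eq:
  assumes "0 < h"
  shows "moves r (\<lambda>t. X t \<omega>) n (grid a h j) \<longleftrightarrow> moves r (partial_sum (increment a h j) \<omega>) n {0..2^j}"
proof -
  have "strict_mono (\<lambda>i. a + real i * h / 2^j)"
    using assms by (auto simp: strict_mono_def divide_strict_right_mono)
  then have "moves r (\<lambda>t. X t \<omega>) n (grid a h j) \<longleftrightarrow> moves r (\<lambda>i. X (a + real i * h / 2^j) \<omega>) n {0..2^j}"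
    unfolding grid_def by (rule moves_image)
  also have "\<dots> \<longleftrightarrow> moves r (partial_sum (increment a h j) \<omega>) n {0..2^j}"
    by (rule moves_cong) (simp add: partial_sum_increment)
  finally show ?thesis .
qed

lemma moves_grid_events:
  assumes "0 \<le> a" "0 < h"
  shows "{\<omega>\<in>space M. moves r (\<lambda>t. X t \<omega>) n (grid a h j)} \<in> events"
proof (rule sets_moves)
  show "X l \<in> borel_measurable M" if "l \<in> grid a h j" for l
    using that grid_subset[of h a j] assms by (intro measurable_X) auto
qed (simp add: grid_def)

text \<open>Right continuity turns an event about uncountably many times into an increasing union of
  events about finite grids. This gives measurability and lets probability bounds pass to the
  limit.\<close>

lemma moves_interval_iff:
  assumes "0 \<le> a" "0 < h" "\<omega> \<in> space M"
  shows "moves r (\<lambda>t. X t \<omega>) n {a..a+h} \<longleftrightarrow> (\<exists>j. moves r (\<lambda>t. X t \<omega>) n (grid a h j))"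
proof
  define D where "D = (\<Union>j. grid a h j)"
  have D: "D \<inter> {a..a+h} = D" using grid_subset[of h a] assms unfolding D_def by fastforce
  assume "moves r (\<lambda>t. X t \<omega>) n {a..a+h}"
  then have "moves r (\<lambda>t. X t \<omega>) n (D \<inter> {a..a+h})"
  proof (rule moves_dense[where a = a and b = "a + h", rotated 4])
    show "a + h \<in> D" unfolding D_def grid_def by (intro UN_I[of 0] image_eqI[of _ _ 1]) auto
    show "\<exists>d\<in>D. t < d \<and> d \<le> a + h \<and> P d" if "a \<le> t" "t < a + h" "eventually P (at_right t)" for t P
      unfolding D_def by (rule grid_dense[OF that])
  qed (use assms in \<open>auto intro: tendsto_right\<close>)
  then show "\<exists>j. moves r (\<lambda>t. X t \<omega>) n (grid a h j)"
    unfolding D unfolding D_def by (rule moves_UN[OF incseq_grid])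
next
  assume "\<exists>j. moves r (\<lambda>t. X t \<omega>) n (grid a h j)"
  then show "moves r (\<lambda>t. X t \<omega>) n {a..a+h}" using grid_subset[of h a] assms moves_mono by (metis less_imp_le)
qed

lemma moves_interval_eq_UN:
  assumes "0 \<le> a" "0 < h"
  shows "{\<omega>\<in>space M. moves r (\<lambda>t. X t \<omega>) n {a..a+h}} = (\<Union>j. {\<omega>\<in>space M. moves r (\<lambda>t. X t \<omega>) n (grid a h j)})"
  using moves_interval_iff[OF assms] by auto

lemma moves_interval_events:
  assumes "0 \<le> a" "0 < h"
  shows "{\<omega>\<in>space M. moves r (\<lambda>t. X t \<omega>) n {a..a+h}} \<in> events"
  unfolding moves_interval_eq_UN[OF assms] using moves_grid_events[OF assms] by auto

text \<open>Paths are bounded on \<open>{0..1}\<close>, so the events of a move larger than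
  \<open>k\<close> decrease to the empty set.\<close>

lemma ex_moves_unit_interval_le_half:
  "\<exists>y>0. prob {\<omega>\<in>space M. moves y (\<lambda>t. X t \<omega>) 1 {0..1}} \<le> 1 / 2"
proof -
  define B where "B k = {\<omega>\<in>space M. moves (real k) (\<lambda>t. X t \<omega>) 1 {0..1}}" for k
  have B_ev: "B k \<in> events" for k unfolding B_def using moves_interval_events[of 0 1 "real k" 1] by simp
  have "(\<lambda>k. prob (B k)) \<longlonglongrightarrow> prob (\<Inter>k. B k)"
  proof (rule finite_Lim_measure_decseq)
    show "decseq B" unfolding decseq_def B_def by (auto simp: moves.simps(2)) force
  qed (use B_ev in auto)
  moreover have "(\<Inter>k. B k) = {}"
  proof (rule ccontr)
    assume "(\<Inter>k. B k) \<noteq> {}"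
    then obtain \<omega> where \<omega>: "\<And>k. \<omega> \<in> B k" by blast
    then have "\<omega> \<in> space M" by (auto simp: B_def)
    then obtain C where C: "\<forall>t\<in>{0..1}. \<bar>X t \<omega>\<bar> \<le> C" using cadlag_bounded[OF cadlag_paths] by blast
    obtain k :: nat where "2 * C \<le> real k" using real_arch_simple by blast
    moreover have "moves (real k) (\<lambda>t. X t \<omega>) (Suc 0) {0..1}" using \<omega>[of k] by (simp add: B_def)
    then obtain t u where "t \<in> {0..1}" "u \<in> {0..1}" "real k < \<bar>X u \<omega> - X t \<omega>\<bar>" unfolding moves.simps by blast
    moreover from this have "\<bar>X t \<omega>\<bar> \<le> C" "\<bar>X u \<omega>\<bar> \<le> C" using C by auto
    ultimately show False by linarith
  qed
  ultimately have "(\<lambda>k. prob (B k)) \<longlonglongrightarrow> 0" by simp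
  then have "\<forall>\<^sub>F k in sequentially. prob (B k) < 1 / 2" by (intro order_tendstoD) auto
  then obtain k0 where "\<And>k. k \<ge> k0 \<Longrightarrow> prob (B k) < 1 / 2" by (auto simp: eventually_sequentially)
  then have "prob (B (Suc k0)) \<le> 1 / 2" by (meson le_SucI less_imp_le order_refl)
  then show ?thesis unfolding B_def by (intro exI[of _ "real (Suc k0)"]) simp
qed

end

section \<open>Scaling of the oscillation\<close>

context semistable_levy_process
begin

text \<open>Semi-selfsimilarity is evaluated at a one-point set of times. Subtracting
  \<open>X 0\<close>, which is 0 almost surely, gives the form that fits increments.\<close>

lemma distr_scaled:
  assumes "0 \<le> t"
  shows "distr M borel (\<lambda>\<omega>. X (c * t) \<omega> - X 0 \<omega>) = distr M borel (\<lambda>\<omega>. c powr (1 / \<alpha>) * (X t \<omega> - X 0 \<omega>))"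
proof -
  have ct: "0 \<le> c * t" using assms c_gt_1 by simp
  have [measurable]: "X 0 \<in> borel_measurable M" "X t \<in> borel_measurable M" "X (c * t) \<in> borel_measurable M"
    using assms ct by (auto intro: measurable_X)
  have fin: "finite_dim_distr M (\<lambda>t. X (c * t)) {t} = finite_dim_distr M (\<lambda>t \<omega>. c powr (1 / \<alpha>) * X t \<omega>) {t}"
    using assms by (intro semi_selfsimilar) auto
  have proj: "distr (finite_dim_distr M Y {t}) borel (\<lambda>x. x t) = distr M borel (Y t)"
    if [measurable]: "Y t \<in> borel_measurable M" for Y :: "real \<Rightarrow> 'a \<Rightarrow> real"
  proof -
    have "(\<lambda>\<omega>. \<lambda>t\<in>{t}. Y t \<omega>) \<in> measurable M (\<Pi>\<^sub>M t\<in>{t}. borel)" by (rule measurable_restrict) auto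
    then show ?thesis unfolding finite_dim_distr_def
      by (subst distr_distr) (auto simp: comp_def intro: measurable_component_singleton)
  qed
  have "distr M borel (\<lambda>\<omega>. X (c * t) \<omega> - X 0 \<omega>) = distr M borel (X (c * t))"
    using X_0 by (intro distr_cong_AE) auto
  also have "\<dots> = distr M borel (\<lambda>\<omega>. c powr (1 / \<alpha>) * X t \<omega>)"
    using fin proj[of "\<lambda>t. X (c * t)"] proj[of "\<lambda>t \<omega>. c powr (1 / \<alpha>) * X t \<omega>"] by simp
  also have "\<dots> = distr M borel (\<lambda>\<omega>. c powr (1 / \<alpha>) * (X t \<omega> - X 0 \<omega>))"
    using X_0 by (intro distr_cong_AE) auto
  finally show ?thesis .
qed

lemma distr_scaled_down:
  assumes "0 \<le> t"
  shows "distr M borel (\<lambda>\<omega>. X (c powr (- real k) * t) \<omega> - X 0 \<omega>) =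
         distr M borel (\<lambda>\<omega>. c powr (- real k / \<alpha>) * (X t \<omega> - X 0 \<omega>))"
proof (induction k)
  case 0
  then show ?case using c_gt_1 by simp
next
  case (Suc k)
  define s where "s = c powr (- real (Suc k)) * t"
  have s: "0 \<le> s" using assms by (simp add: s_def)
  have [measurable]: "X 0 \<in> borel_measurable M" "X t \<in> borel_measurable M" "X s \<in> borel_measurable M" "X (c * s) \<in> borel_measurable M"
    using assms s c_gt_1 by (auto intro: measurable_X)
  have cs: "c * s = c powr (- real k) * t"
  proof -
    have "c powr 1 * c powr (- real (Suc k)) = c powr (- real k)" by (subst powr_add[symmetric]) simp
    then show ?thesis using c_gt_1 by (simp add: s_def)
  qed
  have "distr M borel (\<lambda>\<omega>. X s \<omega> - X 0 \<omega>) = distr (distr M borel (\<lambda>\<omega>. c powr (1 / \<alpha>) * (X s \<omega> - X 0 \<omega>))) borel (\<lambda>x. c powr (- 1 / \<alpha>) * x)"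
    using c_gt_1 by (subst distr_distr) (auto simp: comp_def mult.assoc[symmetric] powr_add[symmetric])
  also have "\<dots> = distr (distr M borel (\<lambda>\<omega>. X (c powr (- real k) * t) \<omega> - X 0 \<omega>)) borel (\<lambda>x. c powr (- 1 / \<alpha>) * x)"
    using distr_scaled[OF s] cs by simp
  also have "\<dots> = distr (distr M borel (\<lambda>\<omega>. c powr (- real k / \<alpha>) * (X t \<omega> - X 0 \<omega>))) borel (\<lambda>x. c powr (- 1 / \<alpha>) * x)"
    using Suc by simp
  also have "\<dots> = distr M borel (\<lambda>\<omega>. c powr (- 1 / \<alpha>) * (c powr (- real k / \<alpha>) * (X t \<omega> - X 0 \<omega>)))"
    by (subst distr_distr) (auto simp: comp_def)
  also have "(\<lambda>\<omega>. c powr (- 1 / \<alpha>) * (c powr (- real k / \<alpha>) * (X t \<omega> - X 0 \<omega>))) = (\<lambda>\<omega>. c powr (- real (Suc k) / \<alpha>) * (X t \<omega> - X 0 \<omega>))"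
  proof -
    have "c powr (- 1 / \<alpha>) * c powr (- real k / \<alpha>) = c powr (- real (Suc k) / \<alpha>)"
      by (subst powr_add[symmetric], rule arg_cong[where f = "(powr) c"]) (simp add: diff_divide_distrib)
    then show ?thesis by (simp add: mult.assoc[symmetric])
  qed
  finally show ?case unfolding s_def .
qed

text \<open>On each grid the increments over the short interval are independent and distributed like
  \<open>l\<close> times those over \<open>{0..1}\<close>, so a move of size \<open>y * l\<close> is
  as likely as one of size \<open>y\<close> there. The geometric bound holds on every grid and
  passes to the union.\<close>

lemma prob_moves_interval_le:
  assumes y: "0 < y" "prob {\<omega>\<in>space M. moves y (\<lambda>t. X t \<omega>) 1 {0..1}} \<le> 1 / 2" and a: "0 \<le> a"
  shows "prob {\<omega>\<in>space M. moves (y * c powr (- real k / \<alpha>)) (\<lambda>t. X t \<omega>) n {a..a + c powr (- real k)}} \<le> (1 / 2) ^ n"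
proof -
  define h where "h = c powr (- real k)"
  define l where "l = c powr (- real k / \<alpha>)"
  have h: "0 < h" and l: "0 < l" using c_gt_1 by (auto simp: h_def l_def)
  have grid_le: "prob {\<omega>\<in>space M. moves (y * l) (\<lambda>t. X t \<omega>) n (grid a h j)} \<le> (1 / 2) ^ n" for j
  proof -
    define D' where "D' i \<omega> = l * increment 0 1 j i \<omega>" for i \<omega>
    have inc: "increment 0 1 j i \<in> borel_measurable M" for i unfolding increment_def
      by (intro borel_measurable_diff measurable_X) auto
    have D': "indep_vars (\<lambda>_. borel) D' {..<2^j}"
      unfolding D'_def using indep_increments[of 0 1 j]
      by (intro indep_vars_compose2[where Y = "\<lambda>_ x. l * x" and M' = "\<lambda>_. borel"]) auto
    have deq: "distr M borel (increment a h j i) = distr M borel (D' i)" for i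
    proof -
      have *: "(\<lambda>\<omega>. X (1/2^j) \<omega> - X 0 \<omega>) \<in> borel_measurable M" by (intro borel_measurable_diff measurable_X) auto
      have "distr M borel (D' i) = distr (distr M borel (increment 0 1 j i)) borel (\<lambda>x. l * x)"
        using inc by (subst distr_distr) (auto simp: comp_def D'_def[abs_def])
      also have "\<dots> = distr (distr M borel (\<lambda>\<omega>. X (1 / 2^j) \<omega> - X 0 \<omega>)) borel (\<lambda>x. l * x)"
        using distr_increment[of 0 1 j i] by simp
      also have "\<dots> = distr M borel (\<lambda>\<omega>. l * (X (1 / 2^j) \<omega> - X 0 \<omega>))"
        using * by (subst distr_distr) (auto simp: comp_def)
      also have "\<dots> = distr M borel (\<lambda>\<omega>. X (h / 2^j) \<omega> - X 0 \<omega>)"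
        using distr_scaled_down[of "1 / 2^j" k] by (simp add: l_def h_def)
      also have "\<dots> = distr M borel (increment a h j i)" using distr_increment[OF a h, of j i] by simp
      finally show ?thesis by simp
    qed
    have scale: "moves (y * l) (partial_sum D' \<omega>) 1 {0..2^j} \<longleftrightarrow> moves y (partial_sum (increment 0 1 j) \<omega>) 1 {0..2^j}" for \<omega>
    proof (rule moves_cong)
      fix t u :: nat
      have "\<bar>partial_sum D' \<omega> u - partial_sum D' \<omega> t\<bar> = \<bar>partial_sum (increment 0 1 j) \<omega> u - partial_sum (increment 0 1 j) \<omega> t\<bar> * l"
        using l by (simp add: partial_sum_def D'_def sum_distrib_left[symmetric] right_diff_distrib[symmetric] abs_mult)
      then show "(y * l < \<bar>partial_sum D' \<omega> u - partial_sum D' \<omega> t\<bar>) = (y < \<bar>partial_sum (increment 0 1 j) \<omega> u - partial_sum (increment 0 1 j) \<omega> t\<bar>)"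
        using l by simp
    qed
    have "prob {\<omega>\<in>space M. moves (y * l) (partial_sum (increment a h j) \<omega>) 1 {0..2^j}}
       = prob {\<omega>\<in>space M. moves (y * l) (partial_sum D' \<omega>) 1 {0..2^j}}"
      by (rule prob_moves_eq[OF indep_increments[OF a h] D' deq])
    also have "\<dots> = prob {\<omega>\<in>space M. moves y (partial_sum (increment 0 1 j) \<omega>) 1 {0..2^j}}" by (simp only: scale)
    also have "prob {\<omega>\<in>space M. moves y (partial_sum (increment 0 1 j) \<omega>) 1 {0..2^j}} \<le> prob {\<omega>\<in>space M. moves y (\<lambda>t. X t \<omega>) 1 {0..1}}"
    proof (rule finite_measure_mono)
      show "{\<omega>\<in>space M. moves y (\<lambda>t. X t \<omega>) 1 {0..1}} \<in> events" using moves_interval_events[of 0 1 y 1] by simp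
      show "{\<omega>\<in>space M. moves y (partial_sum (increment 0 1 j) \<omega>) 1 {0..2^j}} \<subseteq> {\<omega>\<in>space M. moves y (\<lambda>t. X t \<omega>) 1 {0..1}}"
        using moves_grid_eq[of 1 y _ 1 0 j, symmetric] moves_mono[OF _ grid_subset[of 1 0 j]] by fastforce
    qed
    also have "\<dots> \<le> 1 / 2" by fact
    finally have "prob {\<omega>\<in>space M. moves (y * l) (partial_sum (increment a h j) \<omega>) n {0..2^j}} \<le> (1 / 2)^n"
      by (intro prob_moves_le_power[OF indep_increments[OF a h]]) auto
    then show ?thesis unfolding moves_grid_eq[OF h] .
  qed
  have "(\<lambda>j. prob {\<omega>\<in>space M. moves (y * l) (\<lambda>t. X t \<omega>) n (grid a h j)}) \<longlonglongrightarrow>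
    prob (\<Union>j. {\<omega>\<in>space M. moves (y * l) (\<lambda>t. X t \<omega>) n (grid a h j)})"
  proof (rule finite_Lim_measure_incseq)
    show "incseq (\<lambda>j. {\<omega>\<in>space M. moves (y * l) (\<lambda>t. X t \<omega>) n (grid a h j)})"
      using incseq_grid[of a h] moves_mono unfolding incseq_def by blast
  qed (use moves_grid_events[OF a h] in auto)
  then have "prob (\<Union>j. {\<omega>\<in>space M. moves (y * l) (\<lambda>t. X t \<omega>) n (grid a h j)}) \<le> (1 / 2)^n"
    by (rule LIMSEQ_le_const2) (use grid_le in auto)
  then show ?thesis unfolding moves_interval_eq_UN[OF a h, symmetric] unfolding h_def l_def .
qed

end

section \<open>Upper bounds\<close>

text \<open>Centring an interval at a point of a covering set, padding it and rounding its length up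
  to a power of \<open>c\<close> enlarges diameters by at most a constant factor, which disappears
  when the content is 0.\<close>

lemma ex_cover_geometric_lengths:
  fixes B :: "real set"
  assumes B: "B \<subseteq> {0..}" and s: "0 < s" and c: "1 < c" and 0: "hausdorff_content s B = 0" and \<epsilon>: "0 < \<epsilon>"
  shows "\<exists>a k. (\<forall>i::nat. 0 \<le> a i) \<and> B \<subseteq> (\<Union>i. {a i..a i + c powr (- real (k i))}) \<and>
     (\<Sum>i. ennreal ((c powr (- real (k i))) powr s)) \<le> ennreal \<epsilon>"
proof -
  \<comment> \<open>The first bound forces \<open>d i\<close> and \<open>\<eta> i\<close> to be at
    most 1/3, so that \<open>h i <= 1\<close> and no negative exponent is needed. The second absorbs
    the constant in \<open>len\<close>; the 2 is for the two equal contributions to the sum.\<close>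
  define e where "e = min ((1/3) powr s) (\<epsilon> / (2 * (3 * c) powr s))"
  have e: "0 < e" "e \<le> (1/3) powr s" "2 * (3 * c) powr s * e \<le> \<epsilon>"
  proof -
    show "0 < e" using \<epsilon> c by (simp add: e_def)
    have "e \<le> \<epsilon> / (2 * (3 * c) powr s)" by (simp add: e_def)
    then show "2 * (3 * c) powr s * e \<le> \<epsilon>" using c by (simp add: field_simps)
  qed (simp add: e_def)
  obtain C where C: "\<And>i. bounded (C i)" "B \<subseteq> (\<Union>i. C i)" "(\<Sum>i. diameter_pow (C i) s) < ennreal e"
    using 0 e hausdorff_content_less_iff[of s B "ennreal e"] by auto
  define d where "d i = (if C i = {} then 0 else diameter (C i))" for i
  \<comment> \<open>Positive padding with summable powers, since a set of diameter 0 still needs an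
    interval of positive length.\<close>
  define \<eta> where "\<eta> i = (e * (1/2)^Suc i) powr (1/s)" for i :: nat
  define h where "h i = 2 * d i + \<eta> i" for i
  have d0: "0 \<le> d i" for i using diameter_ge_0[OF C(1)] by (simp add: d_def)
  have dpow: "diameter_pow (C i) s = ennreal (d i powr s)" for i using s by (simp add: d_def diameter_pow_def)
  have \<eta>0: "0 < \<eta> i" and \<eta>pow: "\<eta> i powr s = e * (1/2)^Suc i" for i
    using e s by (auto simp: \<eta>_def powr_powr)
  have small: "u \<le> 1/3" if "0 \<le> u" "u powr s \<le> e" for u :: real
  proof (rule ccontr)
    assume "\<not> u \<le> 1/3"
    then have "(1/3) powr s < u powr s" using s by (intro powr_less_mono2) auto
    then show False using that e by linarith
  qed
  have "d i powr s \<le> e" for i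
  proof -
    have "ennreal (d i powr s) \<le> (\<Sum>i. diameter_pow (C i) s)"
      unfolding dpow[symmetric] by (rule ennreal_le_suminf)
    then have "ennreal (d i powr s) \<le> ennreal e" using C(3) by (meson less_imp_le order_trans)
    then show ?thesis using e by (simp add: ennreal_le_iff)
  qed
  then have d3: "d i \<le> 1/3" for i using small d0 by blast
  have "e * (1/2)^Suc i \<le> e * 1" for i using e by (intro mult_left_mono power_le_one) auto
  then have \<eta>3: "\<eta> i \<le> 1/3" for i using small[of "\<eta> i"] \<eta>0[of i] \<eta>pow[of i] by auto
  have h: "0 < h i" "h i \<le> 1" for i using d0[of i] d3[of i] \<eta>0[of i] \<eta>3[of i] by (auto simp: h_def)
  define k where "k i = nat \<lfloor>- log c (h i)\<rfloor>" for i
  have k: "h i \<le> c powr (- real (k i))" "c powr (- real (k i)) \<le> c * h i" for i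
  proof -
    have l: "0 \<le> - log c (h i)" using h[of i] c by simp
    then have "real (k i) \<le> - log c (h i)" "- log c (h i) \<le> real (k i) + 1" unfolding k_def by linarith+
    then have "log c (h i) \<le> - real (k i)" "- real (k i) \<le> 1 + log c (h i)" by auto
    then have "c powr (log c (h i)) \<le> c powr (- real (k i))" "c powr (- real (k i)) \<le> c powr (1 + log c (h i))"
      using c by (auto intro!: powr_mono)
    then show "h i \<le> c powr (- real (k i))" "c powr (- real (k i)) \<le> c * h i"
      using c h[of i] by (auto simp: powr_add)
  qed
  have len: "(c powr (- real (k i))) powr s \<le> (3 * c) powr s * (d i powr s + e * (1/2)^Suc i)" for i
  proof -
    have "h i \<le> 3 * max (d i) (\<eta> i)" by (auto simp: h_def max_def)
    then have "c * h i \<le> 3 * c * max (d i) (\<eta> i)" using c mult_left_mono[of "h i" _ c] by auto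
    then have "c powr (- real (k i)) \<le> 3 * c * max (d i) (\<eta> i)" using k(2)[of i] by linarith
    then have "(c powr (- real (k i))) powr s \<le> (3 * c * max (d i) (\<eta> i)) powr s" using s by (intro powr_mono2) auto
    also have "\<dots> = (3 * c) powr s * (max (d i) (\<eta> i)) powr s" using c d0[of i] by (simp add: powr_mult)
    also have "\<dots> \<le> (3 * c) powr s * (d i powr s + \<eta> i powr s)" by (intro mult_left_mono) (auto simp: max_def)
    finally show ?thesis unfolding \<eta>pow .
  qed
  have sum: "(\<Sum>i. ennreal ((c powr (- real (k i))) powr s)) \<le> ennreal \<epsilon>"
  proof -
    have "(\<Sum>i. ennreal ((c powr (- real (k i))) powr s)) \<le> (\<Sum>i. ennreal ((3 * c) powr s) * (diameter_pow (C i) s + ennreal (e * (1/2)^Suc i)))"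
    proof (intro suminf_le summableI)
      fix i
      have "ennreal ((c powr (- real (k i))) powr s) \<le> ennreal ((3 * c) powr s * (d i powr s + e * (1/2)^Suc i))"
        by (rule ennreal_leI[OF len])
      also have "\<dots> = ennreal ((3 * c) powr s) * (diameter_pow (C i) s + ennreal (e * (1/2)^Suc i))"
        unfolding dpow using e by (subst ennreal_mult) (auto simp del: power_Suc)
      finally show "ennreal ((c powr (- real (k i))) powr s) \<le> ennreal ((3 * c) powr s) * (diameter_pow (C i) s + ennreal (e * (1/2)^Suc i))" .
    qed
    also have "\<dots> = ennreal ((3 * c) powr s) * ((\<Sum>i. diameter_pow (C i) s) + (\<Sum>i. ennreal (e * (1/2)^Suc i)))"
      by (subst suminf_add) (auto simp: summableI)
    also have "(\<Sum>i. ennreal (e * (1/2)^Suc i)) = ennreal e"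
      using sums_mult[OF power_half_series, of e] e by (intro suminf_ennreal_eq) auto
    also have "ennreal ((3 * c) powr s) * ((\<Sum>i. diameter_pow (C i) s) + ennreal e) \<le> ennreal ((3 * c) powr s) * (ennreal e + ennreal e)"
      using C(3) by (intro mult_left_mono add_right_mono) auto
    also have "\<dots> = ennreal (2 * (3 * c) powr s * e)"
      using e by (simp add: ennreal_mult[symmetric] ennreal_plus[symmetric] mult.commute mult.left_commute del: ennreal_plus)
    also have "\<dots> \<le> ennreal \<epsilon>" using e by (intro ennreal_leI)
    finally show ?thesis .
  qed
  have "\<exists>x. C i \<inter> B \<noteq> {} \<longrightarrow> x \<in> C i \<inter> B" for i by blast
  then obtain x where x: "\<And>i. C i \<inter> B \<noteq> {} \<Longrightarrow> x i \<in> C i \<inter> B" by metis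
  \<comment> \<open>The interval starts \<open>d i\<close> to the left of a point of
    \<open>C i\<close>, cut off at 0 because only times in \<open>{0..}\<close> are allowed.\<close>
  define a where "a i = max 0 (x i - d i)" for i
  have "B \<subseteq> (\<Union>i. {a i..a i + c powr (- real (k i))})"
  proof
    fix z assume z: "z \<in> B"
    then obtain i where i: "z \<in> C i" using C by blast
    then have xi: "x i \<in> C i" "x i \<in> B" using x[of i] z by auto
    have "dist z (x i) \<le> d i" using diameter_bounded_bound[OF C(1) i xi(1)] i by (auto simp: d_def)
    then have "a i \<le> z" "z \<le> a i + h i" using z B \<eta>0[of i] by (auto simp: a_def h_def dist_real_def)
    then have "z \<in> {a i..a i + c powr (- real (k i))}" using k(1)[of i] by auto
    then show "z \<in> (\<Union>i. {a i..a i + c powr (- real (k i))})" by blast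
  qed
  then show ?thesis using sum by (intro exI[of _ a] exI[of _ k]) (auto simp: a_def)
qed

lemma suminf_const_finite_imp_eq_0:
  assumes "(\<Sum>n::nat. x) \<noteq> (top :: ennreal)" shows "x = 0"
proof (rule ccontr)
  assume x: "x \<noteq> 0"
  have "(\<Sum>n::nat. 1 :: ennreal) = top"
    unfolding suminf_eq_SUP by (simp add: ennreal_SUP_of_nat_eq_top)
  moreover have "(\<Sum>n::nat. x) = x * (\<Sum>n::nat. 1)" by (subst ennreal_suminf_cmult[symmetric]) simp
  ultimately show False using assms x by (simp add: ennreal_mult_top)
qed

lemma process_graph_eq: "process_graph X B \<omega> = (\<lambda>t. (t, X t \<omega>)) ` B"
  by (auto simp: process_graph_def)

section \<open>Covering the random graph at small expected cost\<close>

context semistable_levy_process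
begin

text \<open>\<open>W k\<close> is the cost of one piece over an interval of length c^-k. Covers of
  \<open>B\<close> of cost at most 2^-n give random costs \<open>Z n\<close> with summable
  expectations, and a content lying below every term of a convergent series is 0.\<close>

lemma hausdorff_measure_graph_eq_0_generic:
  assumes y: "0 < y" "prob {\<omega>\<in>space M. moves y (\<lambda>t. X t \<omega>) 1 {0..1}} \<le> 1 / 2"
    and B: "B \<subseteq> {0..}" and s: "0 < s" and 0: "hausdorff_measure s B = 0" and \<gamma>: "0 < \<gamma>"
    and W: "\<And>k. 0 < W k" "\<And>k. W k \<le> A * (c powr (- real k)) powr s"
    and piece: "\<And>k a f P. P \<subseteq> {a..a + c powr (- real k)} \<Longrightarrow>
       (\<And>t u. t \<in> P \<Longrightarrow> u \<in> P \<Longrightarrow> \<bar>f u - f t :: real\<bar> \<le> y * c powr (- real k / \<alpha>)) \<Longrightarrow>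
       hausdorff_content \<gamma> ((\<lambda>t. (t, f t)) ` P) \<le> ennreal (W k)"
  shows "AE \<omega> in M. hausdorff_measure \<gamma> (process_graph X B \<omega>) = 0"
proof -
  have A: "0 < A" using W(1)[of 0] W(2)[of 0] c_gt_1 by simp
  have "\<forall>n. \<exists>a k. (\<forall>i::nat. 0 \<le> a i) \<and> B \<subseteq> (\<Union>i. {a i..a i + c powr (- real (k i))}) \<and>
     (\<Sum>i. ennreal ((c powr (- real (k i))) powr s)) \<le> ennreal ((1/2)^n)"
    using hausdorff_measure_eq_0_iff[OF s, of B] 0 by (intro allI ex_cover_geometric_lengths B s c_gt_1) auto
  from choice[OF this] obtain a where "\<forall>n. \<exists>k. (\<forall>i::nat. 0 \<le> a n i) \<and> B \<subseteq> (\<Union>i. {a n i..a n i + c powr (- real (k i))}) \<and>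
     (\<Sum>i. ennreal ((c powr (- real (k i))) powr s)) \<le> ennreal ((1/2)^n)" by blast
  from choice[OF this] obtain k where ak: "\<And>n i::nat. 0 \<le> a n i" "\<And>n. B \<subseteq> (\<Union>i. {a n i..a n i + c powr (- real (k n i))})"
     "\<And>n. (\<Sum>i. ennreal ((c powr (- real (k n i))) powr s)) \<le> ennreal ((1/2)^n)" by blast
  define E where "E n i j = {\<omega>\<in>space M. moves (y * c powr (- real (k n i) / \<alpha>)) (\<lambda>t. X t \<omega>) j {a n i..a n i + c powr (- real (k n i))}}" for n i j
  have E[measurable]: "E n i j \<in> events" for n i j
    unfolding E_def using ak(1) c_gt_1 by (intro moves_interval_events) auto
  \<comment> \<open>The measurable \<open>Z n\<close> stands in for the content of the graph, which
    is not known to depend measurably on \<omega>.\<close>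
  define Z where "Z n \<omega> = (\<Sum>i. ennreal (W (k n i)) * (\<Sum>j. indicator (E n i j) \<omega>))" for n \<omega>
  have Zm[measurable]: "Z n \<in> borel_measurable M" for n unfolding Z_def by measurable
  have EE: "emeasure M (E n i j) \<le> ennreal ((1/2)^j)" for n i j
    unfolding E_def emeasure_eq_measure by (intro ennreal_leI prob_moves_interval_le y ak)
  have Zint: "(\<integral>\<^sup>+\<omega>. Z n \<omega> \<partial>M) \<le> ennreal (2 * A * (1/2)^n)" for n
  proof -
    have "(\<integral>\<^sup>+\<omega>. Z n \<omega> \<partial>M) = (\<Sum>i. ennreal (W (k n i)) * (\<Sum>j. emeasure M (E n i j)))"
      unfolding Z_def by (simp add: nn_integral_suminf nn_integral_cmult)
    also have "\<dots> \<le> (\<Sum>i. ennreal (W (k n i)) * (\<Sum>j. ennreal ((1/2)^j)))"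
      by (intro suminf_le mult_left_mono EE summableI) auto
    also have "(\<Sum>j. ennreal ((1/2)^j)) = ennreal 2"
      using geometric_sums[of "1/2::real"] by (intro suminf_ennreal_eq) auto
    also have "(\<Sum>i. ennreal (W (k n i)) * ennreal 2) \<le> (\<Sum>i. ennreal (2 * A) * ennreal ((c powr (- real (k n i))) powr s))"
    proof (intro suminf_le summableI)
      fix i
      have "ennreal (W (k n i)) * ennreal 2 = ennreal (W (k n i) * 2)" using W(1) by (intro ennreal_mult[symmetric]) (auto intro: less_imp_le)
      also have "\<dots> \<le> ennreal (2 * A * (c powr (- real (k n i))) powr s)"
        using W(2)[of "k n i"] by (intro ennreal_leI) simp
      also have "\<dots> = ennreal (2 * A) * ennreal ((c powr (- real (k n i))) powr s)" using A by (intro ennreal_mult) auto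
      finally show "ennreal (W (k n i)) * ennreal 2 \<le> ennreal (2 * A) * ennreal ((c powr (- real (k n i))) powr s)" .
    qed
    also have "\<dots> = ennreal (2 * A) * (\<Sum>i. ennreal ((c powr (- real (k n i))) powr s))" by simp
    also have "\<dots> \<le> ennreal (2 * A) * ennreal ((1/2)^n)" by (intro mult_left_mono ak) auto
    also have "\<dots> = ennreal (2 * A * (1/2)^n)" using A by (intro ennreal_mult[symmetric]) auto
    finally show ?thesis .
  qed
  have "(\<integral>\<^sup>+\<omega>. (\<Sum>n. Z n \<omega>) \<partial>M) = (\<Sum>n. \<integral>\<^sup>+\<omega>. Z n \<omega> \<partial>M)" by (rule nn_integral_suminf) simp
  also have "\<dots> \<le> (\<Sum>n. ennreal (2 * A * (1/2)^n))" by (intro suminf_le Zint summableI)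
  also have "\<dots> = ennreal (2 * A * 2)"
    using sums_mult[OF geometric_sums[of "1/2::real"], of "2*A"] A by (intro suminf_ennreal_eq) auto
  finally have "(\<integral>\<^sup>+\<omega>. (\<Sum>n. Z n \<omega>) \<partial>M) \<noteq> \<infinity>" by (auto simp: top_unique)
  then have "AE \<omega> in M. (\<Sum>n. Z n \<omega>) \<noteq> \<infinity>" by (intro nn_integral_PInf_AE) auto
  then show ?thesis
  proof (rule AE_mp, intro AE_I2 impI hausdorff_measure_eq_0I[OF \<gamma>])
    fix \<omega> assume \<omega>: "\<omega> \<in> space M" and fin: "(\<Sum>n. Z n \<omega>) \<noteq> \<infinity>"
    have "hausdorff_content \<gamma> (process_graph X B \<omega>) \<le> Z n \<omega>" for n
    proof -
      define I where "I i = {a n i..a n i + c powr (- real (k n i))}" for i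
      have "process_graph X B \<omega> \<subseteq> (\<Union>i. (\<lambda>t. (t, X t \<omega>)) ` I i)"
        unfolding process_graph_eq I_def using ak(2)[of n] by blast
      then have "hausdorff_content \<gamma> (process_graph X B \<omega>) \<le> (\<Sum>i. hausdorff_content \<gamma> ((\<lambda>t. (t, X t \<omega>)) ` I i))"
        using hausdorff_content_mono hausdorff_content_UN order_trans by blast
      also have "\<dots> \<le> Z n \<omega>"
        unfolding Z_def
      proof (intro suminf_le summableI)
        fix i
        have "hausdorff_content \<gamma> ((\<lambda>t. (t, X t \<omega>)) ` I i) \<le> ennreal (W (k n i)) *
            (\<Sum>j. indicator {j. moves (y * c powr (- real (k n i) / \<alpha>)) (\<lambda>t. X t \<omega>) j (I i)} j)"
          unfolding I_def
        proof (rule hausdorff_content_graph_le_moves)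
          show "((\<lambda>t. X t \<omega>) \<longlongrightarrow> X t \<omega>) (at_right t)" if "a n i \<le> t" for t
            using that ak(1)[of n i] \<omega> by (intro tendsto_right) auto
        qed (use y(1) c_gt_1 W(1) piece in auto)
        also have "(\<Sum>j. indicator {j. moves (y * c powr (- real (k n i) / \<alpha>)) (\<lambda>t. X t \<omega>) j (I i)} j) = (\<Sum>j. indicator (E n i j) \<omega> :: ennreal)"
          using \<omega> by (intro suminf_cong) (simp add: E_def I_def indicator_def)
        finally show "hausdorff_content \<gamma> ((\<lambda>t. (t, X t \<omega>)) ` I i) \<le> ennreal (W (k n i)) * (\<Sum>j. indicator (E n i j) \<omega>)" .
      qed
      finally show ?thesis .
    qed
    then have "(\<Sum>n::nat. hausdorff_content \<gamma> (process_graph X B \<omega>)) \<le> (\<Sum>n. Z n \<omega>)"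
      by (intro suminf_le summableI)
    then have "(\<Sum>n::nat. hausdorff_content \<gamma> (process_graph X B \<omega>)) \<noteq> top"
      using fin by (auto simp: top_unique)
    then show "hausdorff_content \<gamma> (process_graph X B \<omega>) = 0" by (rule suminf_const_finite_imp_eq_0)
  qed
qed

lemma length_le_1: "c powr (- real k) \<le> 1"
  using powr_mono[of "- real k" 0 c] c_gt_1 by simp

lemma powr_length: "c powr (- real k / \<alpha>) = (c powr (- real k)) powr (1 / \<alpha>)"
  by (simp add: powr_powr)

theorem hausdorff_measure_graph_eq_0_max:
  assumes B: "B \<subseteq> {0..}" and s: "0 < s" and 0: "hausdorff_measure s B = 0"
  shows "AE \<omega> in M. hausdorff_measure (s * max \<alpha> 1) (process_graph X B \<omega>) = 0"
proof -
  obtain y where y: "0 < y" "prob {\<omega>\<in>space M. moves y (\<lambda>t. X t \<omega>) 1 {0..1}} \<le> 1 / 2"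
    using ex_moves_unit_interval_le_half by blast
  \<comment> \<open>The smaller of 1 and 1/\<alpha>: for \<open>h <= 1\<close> the power
    \<open>h powr q\<close> dominates both the width of a piece and the scale of its height.\<close>
  define q where "q = 1 / max \<alpha> 1"
  have q: "q * max \<alpha> 1 = 1" by (simp add: q_def)
  have size: "h + y * h powr (1 / \<alpha>) \<le> (1 + y) * h powr q" if "0 < h" "h \<le> 1" for h
  proof -
    have "h powr 1 \<le> h powr q" "h powr (1 / \<alpha>) \<le> h powr q"
      using that alpha_pos by (intro powr_mono'; simp add: q_def max_def field_simps)+
    then have "h \<le> h powr q" "y * h powr (1 / \<alpha>) \<le> y * h powr q" using that y by auto
    then show ?thesis by (simp add: distrib_right)
  qed
  show ?thesis
  proof (rule hausdorff_measure_graph_eq_0_generic[OF y B s 0,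
        where W = "\<lambda>k. (1 + y) powr (s * max \<alpha> 1) * (c powr (- real k)) powr s" and A = "(1 + y) powr (s * max \<alpha> 1)"])
    fix k a f P
    define h where "h = c powr (- real k)"
    have h: "0 < h" "h \<le> 1" using c_gt_1 length_le_1 by (auto simp: h_def)
    assume P: "P \<subseteq> {a..a + c powr (- real k)}" "\<And>t u. t \<in> P \<Longrightarrow> u \<in> P \<Longrightarrow> \<bar>f u - f t :: real\<bar> \<le> y * c powr (- real k / \<alpha>)"
    have "hausdorff_content (s * max \<alpha> 1) ((\<lambda>t. (t, f t)) ` P) \<le> ennreal ((a + h - a + y * h powr (1/\<alpha>)) powr (s * max \<alpha> 1))"
      using P s y h unfolding powr_length by (intro hausdorff_content_graph_piece) (auto simp: h_def[symmetric])
    also have "\<dots> \<le> ennreal (((1 + y) * h powr q) powr (s * max \<alpha> 1))"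
      using size[OF h] s h y by (intro ennreal_leI powr_mono2) auto
    also have "((1 + y) * h powr q) powr (s * max \<alpha> 1) = (1 + y) powr (s * max \<alpha> 1) * h powr (s * (q * max \<alpha> 1))"
      using y h by (simp add: powr_mult powr_powr ac_simps)
    finally show "hausdorff_content (s * max \<alpha> 1) ((\<lambda>t. (t, f t)) ` P) \<le> ennreal ((1 + y) powr (s * max \<alpha> 1) * (c powr (- real k)) powr s)"
      unfolding q h_def[symmetric] by simp
  qed (use s y c_gt_1 in auto)
qed

text \<open>A piece needs about \<open>h powr (1 / \<alpha> - 1)\<close> squares, each of cost of
  order \<open>h powr \<gamma>\<close>; \<gamma> is chosen so that the product has exponent
  \<open>s\<close>.\<close>

theorem hausdorff_measure_graph_eq_0_squares:
  assumes B: "B \<subseteq> {0..}" and s: "0 < s" and 0: "hausdorff_measure s B = 0" and \<alpha>: "1 < \<alpha>"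
  shows "AE \<omega> in M. hausdorff_measure (1 + s - 1 / \<alpha>) (process_graph X B \<omega>) = 0"
proof -
  obtain y where y: "0 < y" "prob {\<omega>\<in>space M. moves y (\<lambda>t. X t \<omega>) 1 {0..1}} \<le> 1 / 2"
    using ex_moves_unit_interval_le_half by blast
  define \<gamma> where "\<gamma> = 1 + s - 1 / \<alpha>"
  have "1 / \<alpha> < 1" using \<alpha> by simp
  then have \<gamma>: "0 < \<gamma>" using s unfolding \<gamma>_def by linarith
  show ?thesis unfolding \<gamma>_def[symmetric]
  proof (rule hausdorff_measure_graph_eq_0_generic[OF y B s 0 \<gamma>,
        where W = "\<lambda>k. (2 * y + 1) * 2 powr \<gamma> * (c powr (- real k)) powr s" and A = "(2 * y + 1) * 2 powr \<gamma>"])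
    fix k a f P
    define h where "h = c powr (- real k)"
    have h: "0 < h" "h \<le> 1" using c_gt_1 length_le_1 by (auto simp: h_def)
    assume P: "P \<subseteq> {a..a + c powr (- real k)}" "\<And>t u. t \<in> P \<Longrightarrow> u \<in> P \<Longrightarrow> \<bar>f u - f t :: real\<bar> \<le> y * c powr (- real k / \<alpha>)"
    have "hausdorff_content \<gamma> ((\<lambda>t. (t, f t)) ` P) \<le> ennreal ((2 * (y * h powr (1/\<alpha>)) / h + 1) * (2 * h) powr \<gamma>)"
      using P y h \<gamma> unfolding powr_length by (intro hausdorff_content_graph_piece_squares) (auto simp: h_def[symmetric])
    also have "\<dots> \<le> ennreal ((2 * y + 1) * h powr (1 / \<alpha> - 1) * (2 * h) powr \<gamma>)"
    proof (intro ennreal_leI mult_right_mono)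
      have "h powr 0 \<le> h powr (1 / \<alpha> - 1)" using h \<alpha> by (intro powr_mono') (auto simp: field_simps)
      then have "1 \<le> h powr (1 / \<alpha> - 1)" using h by simp
      moreover have "2 * (y * h powr (1/\<alpha>)) / h = 2 * y * h powr (1 / \<alpha> - 1)" using h by (simp add: powr_diff)
      ultimately show "2 * (y * h powr (1/\<alpha>)) / h + 1 \<le> (2 * y + 1) * h powr (1 / \<alpha> - 1)"
        by (simp add: distrib_right)
    qed simp
    also have "(2 * y + 1) * h powr (1 / \<alpha> - 1) * (2 * h) powr \<gamma> = (2 * y + 1) * 2 powr \<gamma> * h powr (1 / \<alpha> - 1 + \<gamma>)"
      using h by (simp add: powr_mult powr_add)
    also have "1 / \<alpha> - 1 + \<gamma> = s" by (simp add: \<gamma>_def)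
    finally show "hausdorff_content \<gamma> ((\<lambda>t. (t, f t)) ` P) \<le> ennreal ((2 * y + 1) * 2 powr \<gamma> * (c powr (- real k)) powr s)"
      unfolding h_def .
  qed (use s y c_gt_1 in auto)
qed

end

section \<open>Decay of characteristic functions and Riesz kernels\<close>

lemma nn_integral_exp_neg_abs:
  assumes a: "0 < a"
  shows "(\<integral>\<^sup>+z. ennreal (exp (- a * \<bar>z\<bar>)) \<partial>lborel) \<le> ennreal (2 / a)"
proof -
  have 1: "(\<integral>\<^sup>+z. ennreal (exp (- z)) * indicator {0..} z \<partial>lborel) = 1"
    using nn_intergal_power_times_exp_Ici[of 0] by simp
  have half: "(\<integral>\<^sup>+z. ennreal (exp (- a * z)) * indicator {0..} z \<partial>lborel) = ennreal (1 / a)"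
  proof -
    have "(\<integral>\<^sup>+z. ennreal (exp (- a * z)) * indicator {0..} z \<partial>lborel) =
       \<bar>1 / a\<bar> * (\<integral>\<^sup>+z. ennreal (exp (- a * (0 + 1 / a * z))) * indicator {0..} (0 + 1 / a * z) \<partial>lborel)"
      using a by (intro nn_integral_real_affine) auto
    also have "(\<integral>\<^sup>+z. ennreal (exp (- a * (0 + 1 / a * z))) * indicator {0..} (0 + 1 / a * z) \<partial>lborel) =
       (\<integral>\<^sup>+z. ennreal (exp (- z)) * indicator {0..} z \<partial>lborel)"
      using a by (intro nn_integral_cong) (auto simp: indicator_def zero_le_divide_iff)
    finally show ?thesis using a 1 by simp
  qed
  have neg: "(\<integral>\<^sup>+z. ennreal (exp (- a * - z)) * indicator {0..} (- z) \<partial>lborel) = ennreal (1 / a)"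
    using nn_integral_real_affine[of "\<lambda>z. ennreal (exp (- a * z)) * indicator {0..} z" "-1" 0] half by simp
  have "(\<integral>\<^sup>+z. ennreal (exp (- a * \<bar>z\<bar>)) \<partial>lborel) \<le>
    (\<integral>\<^sup>+z. ennreal (exp (- a * z)) * indicator {0..} z + ennreal (exp (- a * - z)) * indicator {0..} (- z) \<partial>lborel)"
    by (intro nn_integral_mono) (auto simp: indicator_def abs_if)
  also have "\<dots> = ennreal (1 / a) + ennreal (1 / a)"
    by (subst nn_integral_add) (auto simp only: half neg, measurable)
  also have "\<dots> = ennreal (2 / a)" using a by (subst ennreal_plus[symmetric]) auto
  finally show ?thesis .
qed

text \<open>A Gaussian is its own Fourier transform, which turns the decay of the characteristic
  function into a bound for \<open>E exp(-v x\<^sup>2)\<close>.\<close>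

lemma (in real_distribution) nn_integral_gaussian_le:
  assumes v: "0 < v" and C: "0 \<le> C" and b: "0 < b" and dec: "\<And>\<xi>. norm (char M \<xi>) \<le> C * exp (- b * \<bar>\<xi>\<bar>)"
  shows "(\<integral>\<^sup>+x. ennreal (exp (- v * x\<^sup>2)) \<partial>M) \<le> ennreal (C / (b * sqrt v))"
proof -
  interpret N: real_distribution std_normal_distribution by (rule real_dist_normal_dist)
  interpret P: pair_prob_space M std_normal_distribution ..
  \<comment> \<open>For a standard normal z the mean of exp(i r z x) is exp(-r^2 x^2 / 2), which
    equals exp(-v x^2) for this \<open>r\<close>.\<close>
  define r where "r = sqrt (2 * v)"
  have r: "r > 0" "r\<^sup>2 = 2 * v" using v by (auto simp: r_def)
  have int: "integrable (M \<Otimes>\<^sub>M std_normal_distribution) (\<lambda>(x, z). iexp (r * z * x))"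
    by (rule P.P.integrable_const_bound[of _ 1]) auto
  have inner: "(LINT z|std_normal_distribution. iexp (r * z * x)) = complex_of_real (exp (- v * x\<^sup>2))" for x
  proof -
    have "(LINT z|std_normal_distribution. iexp (r * z * x)) = char std_normal_distribution (r * x)"
      unfolding char_def by (simp add: ac_simps)
    also have "\<dots> = complex_of_real (exp (- v * x\<^sup>2))"
      unfolding char_std_normal_distribution using r by (simp add: power_mult_distrib)
    finally show ?thesis .
  qed
  have "(LINT x|M. LINT z|std_normal_distribution. iexp (r * z * x)) = (LINT z|std_normal_distribution. LINT x|M. iexp (r * z * x))"
    using P.Fubini_integral[OF int] by simp
  then have eq: "complex_of_real (LINT x|M. exp (- v * x\<^sup>2)) = (LINT z|std_normal_distribution. char M (r * z))"
    unfolding inner char_def by simp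
  have intM: "integrable M (\<lambda>x. exp (- v * x\<^sup>2))"
    using v by (intro integrable_const_bound[of _ 1]) auto
  have nonneg: "0 \<le> (LINT x|M. exp (- v * x\<^sup>2))" by simp
  have "ennreal (LINT x|M. exp (- v * x\<^sup>2)) = ennreal (norm (LINT z|std_normal_distribution. char M (r * z)))"
    using arg_cong[OF eq, of norm] nonneg by simp
  also have "\<dots> \<le> (\<integral>\<^sup>+z. norm (char M (r * z)) \<partial>std_normal_distribution)"
  proof (rule integral_norm_bound_ennreal)
    show "integrable std_normal_distribution (\<lambda>z. char M (r * z))"
      by (rule N.integrable_const_bound[of _ 1]) (auto intro: cmod_char_le_1)
  qed
  also have "\<dots> \<le> (\<integral>\<^sup>+z. ennreal (C * exp (- b * \<bar>r * z\<bar>)) \<partial>std_normal_distribution)"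
    by (intro nn_integral_mono ennreal_leI dec)
  also have "\<dots> = (\<integral>\<^sup>+z. ennreal (std_normal_density z) * ennreal (C * exp (- b * \<bar>r * z\<bar>)) \<partial>lborel)"
    by (subst nn_integral_density) auto
  \<comment> \<open>The normal density is replaced by its maximum, which leaves the integral of the
    decay of the characteristic function.\<close>
  also have "\<dots> \<le> (\<integral>\<^sup>+z. ennreal (C / sqrt (2 * pi)) * ennreal (exp (- (b * r) * \<bar>z\<bar>)) \<partial>lborel)"
  proof (rule nn_integral_mono)
    fix z :: real
    have "std_normal_density z \<le> 1 / sqrt (2 * pi)"
      unfolding std_normal_density_def using mult_left_le[of "exp (- z\<^sup>2 / 2)" "1 / sqrt (2 * pi)"] by simp
    then have "std_normal_density z * (C * exp (- b * \<bar>r * z\<bar>)) \<le> 1 / sqrt (2 * pi) * (C * exp (- b * \<bar>r * z\<bar>))"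
      using C by (intro mult_right_mono) auto
    also have "\<dots> = C / sqrt (2 * pi) * exp (- (b * r) * \<bar>z\<bar>)" using r by (simp add: abs_mult mult.assoc)
    finally have "ennreal (std_normal_density z * (C * exp (- b * \<bar>r * z\<bar>))) \<le> ennreal (C / sqrt (2 * pi) * exp (- (b * r) * \<bar>z\<bar>))"
      by (rule ennreal_leI)
    then show "ennreal (std_normal_density z) * ennreal (C * exp (- b * \<bar>r * z\<bar>)) \<le> ennreal (C / sqrt (2 * pi)) * ennreal (exp (- (b * r) * \<bar>z\<bar>))"
      using C by (subst (1 2) ennreal_mult[symmetric]) auto
  qed
  also have "\<dots> = ennreal (C / sqrt (2 * pi)) * (\<integral>\<^sup>+z. ennreal (exp (- (b * r) * \<bar>z\<bar>)) \<partial>lborel)"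
    by (rule nn_integral_cmult) simp
  also have "\<dots> \<le> ennreal (C / sqrt (2 * pi)) * ennreal (2 / (b * r))"
    using b r by (intro mult_left_mono nn_integral_exp_neg_abs) auto
  also have "\<dots> = ennreal (C / sqrt (2 * pi) * (2 / (b * r)))" using C b r by (intro ennreal_mult[symmetric]) auto
  also have "\<dots> \<le> ennreal (C / (b * sqrt v))"
  proof (rule ennreal_leI)
    have "1 * 1 \<le> sqrt pi" using pi_gt3 by (simp add: real_le_rsqrt)
    then have "C / (b * sqrt v) / sqrt pi \<le> C / (b * sqrt v) / 1" using C b v by (intro divide_left_mono) auto
    moreover have "C / sqrt (2 * pi) * (2 / (b * r)) = C / (b * sqrt v) / sqrt pi"
    proof -
      have "sqrt (2 * pi) * r = 2 * (sqrt pi * sqrt v)" by (simp add: r_def real_sqrt_mult)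
      then have "sqrt (2 * pi) * (b * r) = 2 * (sqrt pi * sqrt v * b)" by (simp add: mult.left_commute mult.commute)
      then have "C / sqrt (2 * pi) * (2 / (b * r)) = (C * 2) / (2 * (sqrt pi * sqrt v * b))" by (simp only: times_divide_times_eq)
      then show ?thesis by (simp add: ac_simps)
    qed
    ultimately show "C / sqrt (2 * pi) * (2 / (b * r)) \<le> C / (b * sqrt v)" by simp
  qed
  finally have "ennreal (LINT x|M. exp (- v * x\<^sup>2)) \<le> ennreal (C / (b * sqrt v))" .
  moreover have "(\<integral>\<^sup>+x. ennreal (exp (- v * x\<^sup>2)) \<partial>M) = ennreal (LINT x|M. exp (- v * x\<^sup>2))"
    using intM by (intro nn_integral_eq_integral) auto
  ultimately show ?thesis by simp
qed

lemma nn_integral_powr_exp: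
  assumes p: "0 < p" and a: "0 < a"
  shows "(\<integral>\<^sup>+v. ennreal (v powr (p - 1) * exp (- a * v)) * indicator {0<..} v \<partial>lborel) = ennreal (Gamma p * a powr (- p))"
proof -
  have "ennreal (Gamma p) = (\<integral>\<^sup>+t. ennreal (indicator {0..} t * t powr (p - 1) / exp t) \<partial>lborel)"
    by (rule Gamma_conv_nn_integral_real[OF p])
  also have "\<dots> = \<bar>a\<bar> * (\<integral>\<^sup>+v. ennreal (indicator {0..} (0 + a * v) * (0 + a * v) powr (p - 1) / exp (0 + a * v)) \<partial>lborel)"
    using a by (intro nn_integral_real_affine) auto
  also have "(\<integral>\<^sup>+v. ennreal (indicator {0..} (0 + a * v) * (0 + a * v) powr (p - 1) / exp (0 + a * v)) \<partial>lborel) =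
     (\<integral>\<^sup>+v. ennreal (a powr (p - 1)) * (ennreal (v powr (p - 1) * exp (- a * v)) * indicator {0<..} v) \<partial>lborel)"
  proof (intro nn_integral_cong)
    fix v :: real
    show "ennreal (indicator {0..} (0 + a * v) * (0 + a * v) powr (p - 1) / exp (0 + a * v)) =
       ennreal (a powr (p - 1)) * (ennreal (v powr (p - 1) * exp (- a * v)) * indicator {0<..} v)"
      using a by (cases "v > 0") (auto simp: indicator_def powr_mult exp_minus field_simps zero_le_mult_iff ennreal_mult[symmetric])
  qed
  also have "\<dots> = ennreal (a powr (p - 1)) * (\<integral>\<^sup>+v. ennreal (v powr (p - 1) * exp (- a * v)) * indicator {0<..} v \<partial>lborel)"
    by (rule nn_integral_cmult) measurable
  finally have eq: "ennreal (Gamma p) = ennreal a * (ennreal (a powr (p - 1)) * (\<integral>\<^sup>+v. ennreal (v powr (p - 1) * exp (- a * v)) * indicator {0<..} v \<partial>lborel))"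
    using a by simp
  have "ennreal (Gamma p * a powr (- p)) = ennreal (a powr (- p)) * ennreal (Gamma p)"
    using p by (subst ennreal_mult[symmetric]) (auto simp: mult.commute intro: less_imp_le Gamma_real_pos)
  also have "\<dots> = ennreal (a powr (- p) * (a * a powr (p - 1))) * (\<integral>\<^sup>+v. ennreal (v powr (p - 1) * exp (- a * v)) * indicator {0<..} v \<partial>lborel)"
    unfolding eq using a by (simp add: ennreal_mult mult.assoc)
  also have "a powr (- p) * (a * a powr (p - 1)) = a powr (- p) * (a powr 1 * a powr (p - 1))" using a by simp
  also have "\<dots> = a powr (- p + (1 + (p - 1)))" by (simp only: powr_add)
  also have "\<dots> = 1" using a by simp
  finally show ?thesis by simp
qed

text \<open>The kernel is a mixture of Gaussians,
  \<open>(h\<^sup>2 + x\<^sup>2)\<^bsup>-\<gamma>/2\<^esup> = 1/\<Gamma>(\<gamma>/2) \<integral> v\<^bsup>\<gamma>/2-1\<^esup> exp(-v(h\<^sup>2 + x\<^sup>2)) dv\<close>; the exponent \<open>\<theta>\<close> interpolates between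
  the trivial bound \<open>1\<close> and the Gaussian bound.\<close>

lemma (in real_distribution) nn_integral_riesz_kernel_le:
  assumes h: "0 < h" and C: "0 < C" and b: "0 < b" and dec: "\<And>\<xi>. norm (char M \<xi>) \<le> C * exp (- b * \<bar>\<xi>\<bar>)"
    and \<theta>: "0 \<le> \<theta>" "\<theta> \<le> 1" "\<theta> < \<gamma>"
  shows "(\<integral>\<^sup>+x. ennreal ((h\<^sup>2 + x\<^sup>2) powr (- \<gamma> / 2)) \<partial>M) \<le>
     ennreal (Gamma ((\<gamma> - \<theta>) / 2) / Gamma (\<gamma> / 2) * (C / b) powr \<theta> * h powr (- (\<gamma> - \<theta>)))"
proof -
  define G where "G = Gamma (\<gamma> / 2)"
  have \<gamma>: "0 < \<gamma>" using \<theta> by linarith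
  have G: "0 < G" using \<gamma> by (simp add: G_def Gamma_real_pos)
  have mix: "ennreal ((h\<^sup>2 + x\<^sup>2) powr (- \<gamma> / 2)) =
     (\<integral>\<^sup>+v. ennreal (1 / G * v powr (\<gamma> / 2 - 1) * exp (- v * h\<^sup>2)) * ennreal (exp (- v * x\<^sup>2)) * indicator {0<..} v \<partial>lborel)" for x
  proof -
    have pos: "0 < h\<^sup>2 + x\<^sup>2" using h by (simp add: add_pos_nonneg)
    have "(\<integral>\<^sup>+v. ennreal (1 / G * v powr (\<gamma> / 2 - 1) * exp (- v * h\<^sup>2)) * ennreal (exp (- v * x\<^sup>2)) * indicator {0<..} v \<partial>lborel) =
      (\<integral>\<^sup>+v. ennreal (1 / G) * (ennreal (v powr (\<gamma> / 2 - 1) * exp (- (h\<^sup>2 + x\<^sup>2) * v)) * indicator {0<..} v) \<partial>lborel)"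
    proof (intro nn_integral_cong)
      fix v :: real
      have "exp (- (h\<^sup>2 + x\<^sup>2) * v) = exp (- v * h\<^sup>2) * exp (- v * x\<^sup>2)" by (simp add: exp_add[symmetric] algebra_simps)
      then show "ennreal (1 / G * v powr (\<gamma> / 2 - 1) * exp (- v * h\<^sup>2)) * ennreal (exp (- v * x\<^sup>2)) * indicator {0<..} v =
         ennreal (1 / G) * (ennreal (v powr (\<gamma> / 2 - 1) * exp (- (h\<^sup>2 + x\<^sup>2) * v)) * indicator {0<..} v)"
        using G by (simp add: indicator_def ennreal_mult[symmetric] mult.assoc)
    qed
    also have "\<dots> = ennreal (1 / G) * ennreal (G * (h\<^sup>2 + x\<^sup>2) powr (- (\<gamma> / 2)))"
      using nn_integral_powr_exp[of "\<gamma> / 2" "h\<^sup>2 + x\<^sup>2"] \<gamma> pos unfolding G_def[symmetric]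
      by (subst nn_integral_cmult) auto
    also have "\<dots> = ennreal ((h\<^sup>2 + x\<^sup>2) powr (- \<gamma> / 2))" using G by (simp add: ennreal_mult[symmetric])
    finally show ?thesis by simp
  qed
  have gauss: "(\<integral>\<^sup>+x. ennreal (exp (- v * x\<^sup>2)) \<partial>M) \<le> ennreal ((C / b) powr \<theta> * v powr (- \<theta> / 2))" if v: "0 < v" for v
  proof -
    have 1: "(\<integral>\<^sup>+x. ennreal (exp (- v * x\<^sup>2)) \<partial>M) \<le> ennreal (C / (b * sqrt v))"
      by (rule nn_integral_gaussian_le) (use v C b dec in auto)
    have "(\<integral>\<^sup>+x. ennreal (exp (- v * x\<^sup>2)) \<partial>M) \<le> (\<integral>\<^sup>+x. 1 \<partial>M)"
      using v by (intro nn_integral_mono) auto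
    then have 2: "(\<integral>\<^sup>+x. ennreal (exp (- v * x\<^sup>2)) \<partial>M) \<le> ennreal 1" using emeasure_space_1 by simp
    define w where "w = C / (b * sqrt v)"
    have w: "0 < w" using C b v by (simp add: w_def)
    \<comment> \<open>The interpolation: for \<theta> between 0 and 1 the power dominates the
      smaller of the two bounds \<open>w\<close> and 1.\<close>
    have "min w 1 \<le> w powr \<theta>"
    proof (cases "w \<le> 1")
      case True
      then have "w powr 1 \<le> w powr \<theta>" using w \<theta> by (intro powr_mono') auto
      then show ?thesis using w by simp
    next
      case False
      then have "1 powr \<theta> \<le> w powr \<theta>" using \<theta> by (intro powr_mono2) auto
      then show ?thesis by simp
    qed
    moreover have "w powr \<theta> = (C / b) powr \<theta> * v powr (- \<theta> / 2)"
    proof -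
      have "w = (C / b) * v powr (- (1/2))" using v by (simp add: w_def powr_half_sqrt[symmetric] powr_minus field_simps)
      then have "w powr \<theta> = (C / b) powr \<theta> * (v powr (- (1/2))) powr \<theta>" using C b by (simp only: powr_mult)
      then show ?thesis by (simp add: powr_powr)
    qed
    moreover have "(\<integral>\<^sup>+x. ennreal (exp (- v * x\<^sup>2)) \<partial>M) \<le> ennreal (min w 1)" using 1 2 by (simp add: w_def min_def)
    ultimately show ?thesis by (metis ennreal_leI order_trans)
  qed
  have "(\<integral>\<^sup>+x. ennreal ((h\<^sup>2 + x\<^sup>2) powr (- \<gamma> / 2)) \<partial>M) =
     (\<integral>\<^sup>+v. \<integral>\<^sup>+x. ennreal (1 / G * v powr (\<gamma> / 2 - 1) * exp (- v * h\<^sup>2)) * ennreal (exp (- v * x\<^sup>2)) * indicator {0<..} v \<partial>M \<partial>lborel)"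
  proof -
    interpret Q: pair_sigma_finite lborel M ..
    show ?thesis unfolding mix by (rule Q.Fubini') measurable
  qed
  also have "\<dots> \<le> (\<integral>\<^sup>+v. ennreal (1 / G * (C / b) powr \<theta>) * (ennreal (v powr ((\<gamma> - \<theta>) / 2 - 1) * exp (- h\<^sup>2 * v)) * indicator {0<..} v) \<partial>lborel)"
  proof (rule nn_integral_mono)
    fix v :: real
    show "(\<integral>\<^sup>+x. ennreal (1 / G * v powr (\<gamma> / 2 - 1) * exp (- v * h\<^sup>2)) * ennreal (exp (- v * x\<^sup>2)) * indicator {0<..} v \<partial>M) \<le>
      ennreal (1 / G * (C / b) powr \<theta>) * (ennreal (v powr ((\<gamma> - \<theta>) / 2 - 1) * exp (- h\<^sup>2 * v)) * indicator {0<..} v)"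
    proof (cases "0 < v")
      case True
      have "(\<integral>\<^sup>+x. ennreal (1 / G * v powr (\<gamma> / 2 - 1) * exp (- v * h\<^sup>2)) * ennreal (exp (- v * x\<^sup>2)) * indicator {0<..} v \<partial>M)
         = ennreal (1 / G * v powr (\<gamma> / 2 - 1) * exp (- v * h\<^sup>2)) * (\<integral>\<^sup>+x. ennreal (exp (- v * x\<^sup>2)) \<partial>M)"
        using True by (simp add: nn_integral_cmult)
      also have "\<dots> \<le> ennreal (1 / G * v powr (\<gamma> / 2 - 1) * exp (- v * h\<^sup>2)) * ennreal ((C / b) powr \<theta> * v powr (- \<theta> / 2))"
        by (intro mult_left_mono gauss True) simp
      also have "\<dots> = ennreal ((1 / G * v powr (\<gamma> / 2 - 1) * exp (- v * h\<^sup>2)) * ((C / b) powr \<theta> * v powr (- \<theta> / 2)))"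
        using G by (intro ennreal_mult[symmetric]) auto
      also have "(1 / G * v powr (\<gamma> / 2 - 1) * exp (- v * h\<^sup>2)) * ((C / b) powr \<theta> * v powr (- \<theta> / 2)) =
         1 / G * (C / b) powr \<theta> * ((v powr (\<gamma> / 2 - 1) * v powr (- \<theta> / 2)) * exp (- h\<^sup>2 * v))" by (simp add: ac_simps)
      also have "v powr (\<gamma> / 2 - 1) * v powr (- \<theta> / 2) = v powr ((\<gamma> - \<theta>) / 2 - 1)"
        by (subst powr_add[symmetric], rule arg_cong[where f = "(powr) v"]) (simp add: diff_divide_distrib)
      also have "ennreal (1 / G * (C / b) powr \<theta> * (v powr ((\<gamma> - \<theta>) / 2 - 1) * exp (- h\<^sup>2 * v))) =
         ennreal (1 / G * (C / b) powr \<theta>) * (ennreal (v powr ((\<gamma> - \<theta>) / 2 - 1) * exp (- h\<^sup>2 * v)) * indicator {0<..} v)"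
        using True G by (subst ennreal_mult) auto
      finally show ?thesis .
    qed simp
  qed
  also have "\<dots> = ennreal (1 / G * (C / b) powr \<theta>) * ennreal (Gamma ((\<gamma> - \<theta>) / 2) * (h\<^sup>2) powr (- ((\<gamma> - \<theta>) / 2)))"
    using nn_integral_powr_exp[of "(\<gamma> - \<theta>) / 2" "h\<^sup>2"] \<theta> h by (subst nn_integral_cmult) auto
  also have "(h\<^sup>2) powr (- ((\<gamma> - \<theta>) / 2)) = h powr (- (\<gamma> - \<theta>))"
  proof -
    have "h\<^sup>2 = h powr 2" using h by simp
    moreover have "2 * (- ((\<gamma> - \<theta>) / 2)) = - (\<gamma> - \<theta>)" by (simp add: field_simps)
    ultimately show ?thesis by (simp only: powr_powr)
  qed
  also have "ennreal (1 / G * (C / b) powr \<theta>) * ennreal (Gamma ((\<gamma> - \<theta>) / 2) * h powr (- (\<gamma> - \<theta>))) =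
     ennreal (Gamma ((\<gamma> - \<theta>) / 2) / Gamma (\<gamma> / 2) * (C / b) powr \<theta> * h powr (- (\<gamma> - \<theta>)))"
    using G \<theta> Gamma_real_pos[of "(\<gamma> - \<theta>) / 2"] by (subst ennreal_mult[symmetric]) (auto simp: G_def ac_simps)
  finally show ?thesis .
qed

lemma char_scale:
  assumes "Y \<in> borel_measurable M"
  shows "char (distr M borel (\<lambda>\<omega>. a * Y \<omega> :: real)) \<xi> = char (distr M borel Y) (a * \<xi>)"
  using assms by (simp add: char_def integral_distr ac_simps)

section \<open>Moduli of the characteristic functions of increments\<close>

context levy_process
begin

text \<open>The modulus removes the rotation due to drift: it is multiplicative in time with factors
  at most 1, hence decreasing in time.\<close>

definition char_abs :: "real \<Rightarrow> real \<Rightarrow> real" where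
  "char_abs t \<xi> = norm (char (distr M borel (\<lambda>\<omega>. X t \<omega> - X 0 \<omega>)) \<xi>)"

lemma measurable_diff_X [measurable]: "0 \<le> s \<Longrightarrow> 0 \<le> t \<Longrightarrow> (\<lambda>\<omega>. X t \<omega> - X s \<omega>) \<in> borel_measurable M"
  by (intro borel_measurable_diff measurable_X)

lemma real_distribution_diff: "0 \<le> s \<Longrightarrow> 0 \<le> t \<Longrightarrow> real_distribution (distr M borel (\<lambda>\<omega>. X t \<omega> - X s \<omega>))"
  by (intro real_distribution_distr measurable_diff_X)

lemma char_abs_nonneg [simp]: "0 \<le> char_abs t \<xi>" by (simp add: char_abs_def)

lemma char_abs_le_1: "0 \<le> t \<Longrightarrow> char_abs t \<xi> \<le> 1"
  unfolding char_abs_def using real_distribution.cmod_char_le_1 real_distribution_diff by simp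

lemma char_abs_add:
  assumes "0 < s" "0 < t" shows "char_abs (s + t) \<xi> = char_abs s \<xi> * char_abs t \<xi>"
proof -
  define \<tau> where "\<tau> i = (if i = 0 then 0 else if i = 1 then s else s + t)" for i :: nat
  have ind: "indep_vars (\<lambda>_. borel) (\<lambda>i \<omega>. X (\<tau> (Suc i)) \<omega> - X (\<tau> i) \<omega>) {..<2}"
    using assms by (intro independent_increments) (auto simp: \<tau>_def)
  have "char (distr M borel (\<lambda>\<omega>. \<Sum>i\<in>{..<2}. X (\<tau> (Suc i)) \<omega> - X (\<tau> i) \<omega>)) \<xi> =
     (\<Prod>i\<in>{..<2::nat}. char (distr M borel (\<lambda>\<omega>. X (\<tau> (Suc i)) \<omega> - X (\<tau> i) \<omega>)) \<xi>)"
    by (rule char_distr_sum[OF ind])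
  moreover have "{..<2::nat} = {0, 1}" by auto
  ultimately have "char (distr M borel (\<lambda>\<omega>. X (s + t) \<omega> - X 0 \<omega>)) \<xi> =
     char (distr M borel (\<lambda>\<omega>. X s \<omega> - X 0 \<omega>)) \<xi> * char (distr M borel (\<lambda>\<omega>. X (s + t) \<omega> - X s \<omega>)) \<xi>"
    by (simp add: \<tau>_def)
  then show ?thesis unfolding char_abs_def using stationary_increments[of s t] assms by (simp add: norm_mult)
qed

lemma char_abs_antimono:
  assumes "0 < s" "s \<le> t" shows "char_abs t \<xi> \<le> char_abs s \<xi>"
proof (cases "s = t")
  case False
  then have "char_abs t \<xi> = char_abs s \<xi> * char_abs (t - s) \<xi>" using char_abs_add[of s "t - s" \<xi>] assms by simp
  also have "\<dots> \<le> char_abs s \<xi> * 1" using assms by (intro mult_left_mono char_abs_le_1) auto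
  finally show ?thesis by simp
qed simp

lemma char_abs_of_nat: "char_abs (real (Suc n)) \<xi> = char_abs 1 \<xi> ^ Suc n"
proof (induction n)
  case (Suc n)
  have "char_abs (real (Suc (Suc n))) \<xi> = char_abs (real (Suc n)) \<xi> * char_abs 1 \<xi>"
    using char_abs_add[of "real (Suc n)" 1 \<xi>] by (simp add: add.commute)
  then show ?case using Suc by simp
qed simp

end

text \<open>Each \<open>\<xi> k\<close> confines \<open>Y\<close> to a lattice of span \<open>2\<pi>/|\<xi> k|\<close>, and these spans tend to infinity.\<close>

lemma (in prob_space) char_abs_eq_1_imp_AE_const:
  assumes Y[measurable]: "random_variable borel (Y :: 'a \<Rightarrow> real)"
    and \<xi>: "\<And>k::nat. \<xi> k \<noteq> 0" "\<xi> \<longlonglongrightarrow> 0" and 1: "\<And>k. norm (char (distr M borel Y) (\<xi> k)) = 1"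
  shows "\<exists>a. AE \<omega> in M. Y \<omega> = a"
proof -
  define z where "z k = char (distr M borel Y) (\<xi> k)" for k
  have "AE \<omega> in M. iexp (\<xi> k * Y \<omega>) = z k" for k
  proof -
    \<comment> \<open>The product with \<open>cnj (z k)\<close> has mean |z k|^2 = 1, so
      \<open>g\<close> is nonnegative with mean 0 and vanishes almost surely. A number of modulus 1
      and real part 1 is 1, which fixes the exponential.\<close>
    define g where "g \<omega> = 1 - Re (cnj (z k) * iexp (\<xi> k * Y \<omega>))" for \<omega>
    have int: "integrable M (\<lambda>\<omega>. cnj (z k) * iexp (\<xi> k * Y \<omega>))"
      by (intro integrable_const_bound[of _ 1]) (auto simp: norm_mult z_def 1)
    have zk: "z k = expectation (\<lambda>\<omega>. iexp (\<xi> k * Y \<omega>))"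
      unfolding z_def char_def by (simp add: integral_distr)
    have "expectation g = 1 - Re (expectation (\<lambda>\<omega>. cnj (z k) * iexp (\<xi> k * Y \<omega>)))"
      unfolding g_def integral_bounded_linear[OF bounded_linear_Re int, symmetric]
      using integrable_bounded_linear[OF bounded_linear_Re int]
      by (subst Bochner_Integration.integral_diff) (auto simp only: integrable_const lebesgue_integral_const prob_space scaleR_one)
    also have "expectation (\<lambda>\<omega>. cnj (z k) * iexp (\<xi> k * Y \<omega>)) = cnj (z k) * z k"
      unfolding zk by simp
    also have "cnj (z k) * z k = 1" using complex_norm_square[of "z k"] 1[of k] by (simp add: z_def mult.commute)
    finally have "expectation g = 0" by simp
    moreover have g0: "0 \<le> g \<omega>" for \<omega>
      using complex_Re_le_cmod[of "cnj (z k) * iexp (\<xi> k * Y \<omega>)"] 1[of k] by (simp add: g_def norm_mult z_def)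
    moreover have "integrable M g" unfolding g_def
      by (intro Bochner_Integration.integrable_diff integrable_const integrable_bounded_linear[OF bounded_linear_Re int])
    ultimately have "AE \<omega> in M. g \<omega> = 0" using integral_nonneg_eq_0_iff_AE[of M g] by auto
    then show ?thesis
    proof eventually_elim
      case (elim \<omega>)
      define u where "u = cnj (z k) * iexp (\<xi> k * Y \<omega>)"
      have "Re u = 1" "norm u = 1" using elim 1[of k] by (auto simp: g_def u_def norm_mult z_def)
      then have "u = 1" by (simp add: complex_eq_iff cmod_def) 
      then have "z k * u = z k" by simp
      then have "(z k * cnj (z k)) * iexp (\<xi> k * Y \<omega>) = z k" by (simp add: u_def mult.assoc)
      moreover have "z k * cnj (z k) = 1" using complex_norm_square[of "z k"] 1[of k] by (simp add: z_def)
      ultimately show ?case by (simp only: mult_1_left)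
    qed
  qed
  then have ae: "AE \<omega> in M. \<forall>k. iexp (\<xi> k * Y \<omega>) = z k" by (simp add: AE_all_countable)
  then obtain \<omega>0 where \<omega>0: "\<And>k. iexp (\<xi> k * Y \<omega>0) = z k"
    using eventually_happens'[OF _ ae] by (auto simp: ae_filter_eq_bot_iff emeasure_space_1)
  from ae have "AE \<omega> in M. Y \<omega> = Y \<omega>0"
  proof eventually_elim
    case (elim \<omega>)
    define D where "D = Y \<omega> - Y \<omega>0"
    have "(\<lambda>k. \<bar>\<xi> k * D\<bar>) \<longlonglongrightarrow> \<bar>0 * D\<bar>" using \<xi>(2) by (intro tendsto_intros)
    then have "\<forall>\<^sub>F k in sequentially. \<bar>\<xi> k * D\<bar> < 2 * pi" by (intro order_tendstoD) auto
    then obtain k where k: "\<bar>\<xi> k * D\<bar> < 2 * pi" by (auto simp: eventually_sequentially)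
    have "exp (\<i> * complex_of_real (\<xi> k * D)) = iexp (\<xi> k * Y \<omega>) / iexp (\<xi> k * Y \<omega>0)"
      by (simp add: D_def exp_diff[symmetric] algebra_simps)
    also have "\<dots> = 1" using elim[rule_format, of k] \<omega>0[of k] by (metis divide_self exp_not_eq_zero)
    finally have "exp (\<i> * complex_of_real (\<xi> k * D)) = 1" .
    then obtain n :: int where n: "\<xi> k * D = of_int (2 * n) * pi" by (auto simp: exp_eq_1)
    then have "\<bar>real_of_int n\<bar> * (2 * pi) < 1 * (2 * pi)" using k by (simp add: abs_mult mult.commute)
    then have "\<bar>real_of_int n\<bar> < 1" by (subst (asm) mult_less_cancel_right) auto
    then have "n = 0" by linarith
    then have "D = 0" using n \<xi>(1)[of k] by simp
    then show ?case by (simp add: D_def)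
  qed
  then show ?thesis by blast
qed

context semistable_levy_process
begin

lemma char_abs_scaled:
  assumes "0 \<le> t"
  shows "char_abs (c powr (- real k) * t) \<xi> = char_abs t (c powr (- real k / \<alpha>) * \<xi>)"
  unfolding char_abs_def distr_scaled_down[OF assms] using assms
  by (subst char_scale) auto

text \<open>Shorter times can only raise the modulus, so modulus 1 at \<xi> persists at all times
  c^-k. Scaling translates this to time 1 and the frequencies c^(-k/\<alpha>) \<xi>, which tend to
  0; then \<open>X 1\<close> is almost surely constant, against fullness.\<close>

lemma char_abs_less_1:
  assumes "\<xi> \<noteq> 0" shows "char_abs 1 \<xi> < 1"
proof (rule ccontr)
  assume "\<not> ?thesis"
  then have 1: "1 \<le> char_abs 1 \<xi>" by simp
  define \<zeta> where "\<zeta> k = c powr (- real k / \<alpha>) * \<xi>" for k :: nat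
  have "char_abs 1 (\<zeta> k) = 1" for k
  proof -
    have "char_abs 1 (\<zeta> k) = char_abs (c powr (- real k)) \<xi>"
      using char_abs_scaled[of 1 k \<xi>] by (simp add: \<zeta>_def)
    also have "\<dots> \<ge> char_abs 1 \<xi>" using length_le_1 c_gt_1 by (intro char_abs_antimono) auto
    finally have "1 \<le> char_abs 1 (\<zeta> k)" using 1 by linarith
    then show ?thesis using char_abs_le_1[of 1 "\<zeta> k"] by simp
  qed
  moreover have "\<zeta> \<longlonglongrightarrow> 0"
  proof -
    have "c powr (- 1 / \<alpha>) < c powr 0" using c_gt_1 alpha_pos by (intro powr_less_mono) auto
    then have "(\<lambda>k. (c powr (- 1 / \<alpha>)) ^ k * \<xi>) \<longlonglongrightarrow> 0 * \<xi>"
      using c_gt_1 by (intro tendsto_mult LIMSEQ_power_zero tendsto_const) auto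
    moreover have "(c powr (- 1 / \<alpha>)) ^ k * \<xi> = \<zeta> k" for k
      using c_gt_1 by (simp add: \<zeta>_def powr_realpow[symmetric] powr_powr)
    ultimately show ?thesis by simp
  qed
  moreover have "\<zeta> k \<noteq> 0" for k using assms c_gt_1 by (simp add: \<zeta>_def)
  ultimately obtain a where "AE \<omega> in M. X 1 \<omega> - X 0 \<omega> = a"
    using char_abs_eq_1_imp_AE_const[of "\<lambda>\<omega>. X 1 \<omega> - X 0 \<omega>" \<zeta>] unfolding char_abs_def by auto
  then have "AE \<omega> in M. X 1 \<omega> = a" using X_0 by eventually_elim simp
  moreover have [measurable]: "X 1 \<in> borel_measurable M" by (rule measurable_X) simp
  have "{\<omega>\<in>space M. X 1 \<omega> = a} \<in> events" by measurable
  ultimately have "prob {\<omega>\<in>space M. X 1 \<omega> = a} = 1" by (simp add: prob_Collect_eq_1)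
  then show False using full by blast
qed

text \<open>On the shell \<open>S\<close> the modulus has a maximum below 1 by compactness. A
  frequency in the k-th shell at time 1 scales to one in \<open>S\<close> at time c^k, so the
  modulus is at most \<kappa>^n with \<open>n\<close> the integer part of c^k; and c^k is at least
  c^(k/\<alpha>) for \<alpha> > 1, which has the order of |\<xi>|.\<close>

lemma char_abs_1_decay:
  assumes \<alpha>: "1 < \<alpha>"
  shows "\<exists>C>0. \<exists>b>0. \<forall>\<xi>. char_abs 1 \<xi> \<le> C * exp (- b * \<bar>\<xi>\<bar>)"
proof -
  define L where "L = c powr (1 / \<alpha>)"
  have L: "1 < L" using c_gt_1 alpha_pos powr_less_mono[of 0 "1/\<alpha>" c] by (simp add: L_def)
  define S where "S = {\<xi>::real. 1 \<le> \<bar>\<xi>\<bar> \<and> \<bar>\<xi>\<bar> \<le> L}"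
  have "compact S"
  proof -
    have "S = {1..L} \<union> {-L..-1}" using L by (auto simp: S_def abs_if)
    then show ?thesis by (simp add: compact_Un)
  qed
  moreover have "S \<noteq> {}" using L by (auto simp: S_def intro: exI[of _ 1])
  moreover have "continuous_on S (char_abs 1)"
    unfolding char_abs_def using real_distribution.isCont_char[OF real_distribution_diff[of 0 1]]
    by (intro continuous_on_norm continuous_at_imp_continuous_on) auto
  ultimately obtain \<xi>0 where \<xi>0: "\<xi>0 \<in> S" "\<And>\<xi>. \<xi> \<in> S \<Longrightarrow> char_abs 1 \<xi> \<le> char_abs 1 \<xi>0"
    using continuous_attains_sup[of S "char_abs 1"] by blast
  \<comment> \<open>The 1/2 keeps \<kappa> positive, so that its logarithm is meaningful.\<close>
  define \<kappa> where "\<kappa> = max (1/2) (char_abs 1 \<xi>0)"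
  have \<kappa>: "0 < \<kappa>" "\<kappa> < 1" using char_abs_less_1[of \<xi>0] \<xi>0(1) by (auto simp: \<kappa>_def S_def)
  define b where "b = - ln \<kappa>"
  have b: "0 < b" using \<kappa> by (simp add: b_def)
  have bound: "char_abs 1 \<xi> \<le> exp b * exp (- (b / L) * \<bar>\<xi>\<bar>)" for \<xi>
  proof (cases "1 \<le> \<bar>\<xi>\<bar>")
    case False
    \<comment> \<open>For |\<xi>| < 1 the factor \<open>exp b\<close> lifts the bound above
      1.\<close>
    have "b / L * \<bar>\<xi>\<bar> \<le> b * 1" using False L b by (intro mult_mono) (auto simp: divide_le_eq)
    then have "exp 0 \<le> exp (b + - (b / L) * \<bar>\<xi>\<bar>)" by (subst exp_le_cancel_iff) simp
    then have "1 \<le> exp b * exp (- (b / L) * \<bar>\<xi>\<bar>)" by (simp add: exp_add[symmetric])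
    then show ?thesis using char_abs_le_1[of 1 \<xi>] by linarith
  next
    case True
    define k where "k = nat \<lfloor>log L \<bar>\<xi>\<bar>\<rfloor>"
    have "0 \<le> log L \<bar>\<xi>\<bar>" using True L by simp
    then have k: "real k \<le> log L \<bar>\<xi>\<bar>" "log L \<bar>\<xi>\<bar> \<le> real k + 1" unfolding k_def by linarith+
    have Lk: "L powr (real k) \<le> \<bar>\<xi>\<bar>" "\<bar>\<xi>\<bar> \<le> L powr (real k + 1)"
      using powr_mono[OF k(1), of L] powr_mono[OF k(2), of L] True L by simp_all
    have Lc: "L powr (real k) = c powr (real k / \<alpha>)" using c_gt_1 by (simp add: L_def powr_powr)
    define \<xi>' where "\<xi>' = c powr (- real k / \<alpha>) * \<xi>"
    have "\<bar>\<xi>'\<bar> = \<bar>\<xi>\<bar> / L powr (real k)" unfolding \<xi>'_def Lc by (simp add: abs_mult powr_minus divide_inverse mult.commute)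
    moreover have "1 \<le> \<bar>\<xi>\<bar> / L powr (real k)" using Lk(1) L by (subst le_divide_eq_1_pos) auto
    moreover have "\<bar>\<xi>\<bar> / L powr (real k) \<le> L" using Lk(2) L by (subst pos_divide_le_eq) (auto simp: powr_add mult.commute)
    ultimately have "\<xi>' \<in> S" by (simp add: S_def)
    then have le\<kappa>: "char_abs 1 \<xi>' \<le> \<kappa>" using \<xi>0(2) by (simp add: \<kappa>_def le_max_iff_disj)
    define n where "n = nat \<lfloor>c powr (real k)\<rfloor>"
    have ck1: "1 \<le> c powr (real k)" using c_gt_1 by (simp add: ge_one_powr_ge_zero)
    then have n: "1 \<le> n" "real n \<le> c powr (real k)" "c powr (real k) \<le> real n + 1" unfolding n_def by linarith+
    have "char_abs 1 \<xi> = char_abs (c powr (- real k) * c powr (real k)) \<xi>"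
      using c_gt_1 by (simp add: powr_add[symmetric])
    also have "\<dots> = char_abs (c powr (real k)) \<xi>'" unfolding \<xi>'_def by (rule char_abs_scaled) simp
    also have "\<dots> \<le> char_abs (real n) \<xi>'" using n by (intro char_abs_antimono) auto
    also have "\<dots> = char_abs 1 \<xi>' ^ n" using char_abs_of_nat[of "n - 1" \<xi>'] n by simp
    also have "\<dots> \<le> \<kappa> ^ n" by (intro power_mono le\<kappa>) simp
    also have "\<dots> = exp (- b * real n)" using \<kappa> by (simp add: b_def mult.commute[of _ "real n"] exp_of_nat_mult)
    also have "\<dots> \<le> exp (b + - (b / L) * \<bar>\<xi>\<bar>)"
    proof -
      have "c powr (real k / \<alpha>) \<le> c powr (real k)" using c_gt_1 \<alpha> by (intro powr_mono) (auto simp: divide_le_eq mult_le_cancel_left1)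
      then have "L powr (real k) \<le> real n + 1" using n Lc by simp
      moreover have "\<bar>\<xi>\<bar> / L \<le> L powr (real k)" using Lk L by (simp add: powr_add divide_le_eq)
      ultimately have "\<bar>\<xi>\<bar> / L \<le> real n + 1" by linarith
      then have "b * (\<bar>\<xi>\<bar> / L) \<le> b * (real n + 1)" using b by (intro mult_left_mono) auto
      then show ?thesis by (simp add: distrib_left)
    qed
    finally show ?thesis by (simp add: exp_add[symmetric])
  qed
  show ?thesis using bound b L by (intro exI[of _ "exp b"] conjI exI[of _ "b / L"]) auto
qed

text \<open>Let c^-k be the largest such power not exceeding \<open>h\<close>, and write
  \<open>h\<close> as c^-k times \<open>u\<close> with \<open>u >= 1\<close>. Scaling and
  monotonicity in time reduce to time 1, and c^-k being at least \<open>h / c\<close> costs the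
  factor c^(-1/\<alpha>) in \<open>b'\<close>.\<close>

lemma char_abs_decay:
  assumes \<alpha>: "1 < \<alpha>"
  shows "\<exists>C>0. \<exists>b>0. \<forall>h \<xi>. 0 < h \<longrightarrow> h \<le> 1 \<longrightarrow> char_abs h \<xi> \<le> C * exp (- (b * h powr (1 / \<alpha>)) * \<bar>\<xi>\<bar>)"
proof -
  obtain C b where C: "0 < C" "0 < b" "\<And>\<xi>. char_abs 1 \<xi> \<le> C * exp (- b * \<bar>\<xi>\<bar>)"
    using char_abs_1_decay[OF \<alpha>] by blast
  define b' where "b' = b * c powr (- 1 / \<alpha>)"
  have "char_abs h \<xi> \<le> C * exp (- (b' * h powr (1 / \<alpha>)) * \<bar>\<xi>\<bar>)" if h: "0 < h" "h \<le> 1" for h \<xi>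
  proof -
    define k where "k = nat \<lceil>- log c h\<rceil>"
    have "0 \<le> - log c h" using h c_gt_1 by simp
    then have k: "- log c h \<le> real k" "real k \<le> - log c h + 1" unfolding k_def by linarith+
    have hc: "c powr (log c h) = h" using h c_gt_1 by simp
    have "c powr (- real k) \<le> c powr (log c h)" "c powr (log c h - 1) \<le> c powr (- real k)"
      using k c_gt_1 by (auto intro!: powr_mono)
    then have ck: "c powr (- real k) \<le> h" "h / c \<le> c powr (- real k)" using hc c_gt_1 by (auto simp: powr_diff)
    define u where "u = h * c powr (real k)"
    have inv: "c powr (- real k) * c powr (real k) = 1" using c_gt_1 by (simp add: powr_add[symmetric])
    have u1: "1 \<le> u" using ck(1) mult_right_mono[OF ck(1), of "c powr (real k)"] inv by (simp add: u_def)
    have hu: "h = c powr (- real k) * u" using inv by (simp add: u_def mult.left_commute)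
    have "char_abs h \<xi> = char_abs u (c powr (- real k / \<alpha>) * \<xi>)" unfolding hu using u1 by (intro char_abs_scaled) simp
    also have "\<dots> \<le> char_abs 1 (c powr (- real k / \<alpha>) * \<xi>)" using u1 by (intro char_abs_antimono) auto
    also have "\<dots> \<le> C * exp (- b * \<bar>c powr (- real k / \<alpha>) * \<xi>\<bar>)" by (rule C)
    also have "\<dots> \<le> C * exp (- (b' * h powr (1 / \<alpha>)) * \<bar>\<xi>\<bar>)"
    proof -
      have "(h / c) powr (1 / \<alpha>) \<le> (c powr (- real k)) powr (1 / \<alpha>)" using ck h c_gt_1 alpha_pos by (intro powr_mono2) auto
      then have "c powr (- 1 / \<alpha>) * h powr (1 / \<alpha>) \<le> c powr (- real k / \<alpha>)"
        using h c_gt_1 unfolding powr_length[symmetric] minus_divide_left[symmetric] powr_minus_divide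
        by (simp only: powr_divide) (simp add: powr_powr)
      then have "b * (c powr (- 1 / \<alpha>) * h powr (1 / \<alpha>)) * \<bar>\<xi>\<bar> \<le> b * c powr (- real k / \<alpha>) * \<bar>\<xi>\<bar>"
        using C by (intro mult_right_mono mult_left_mono) auto
      then show ?thesis using C by (simp add: b'_def abs_mult mult.assoc)
    qed
    finally show ?thesis .
  qed
  moreover have "0 < b'" using C c_gt_1 by (simp add: b'_def)
  ultimately show ?thesis using C(1) by blast
qed

text \<open>With the decay rate \<open>b * h powr (1 / \<alpha>)\<close>, the Gaussian bound
  contributes the exponent -\<theta>/\<alpha> in \<open>h\<close> and the rest of the kernel
  -(\<gamma> - \<theta>). The constant is uniform in the two times.\<close>

lemma nn_integral_kernel_increment_le:
  assumes \<alpha>: "1 < \<alpha>" and \<theta>: "0 \<le> \<theta>" "\<theta> \<le> 1" "\<theta> < \<gamma>"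
  shows "\<exists>A>0. \<forall>s t. 0 \<le> s \<longrightarrow> 0 \<le> t \<longrightarrow> s \<noteq> t \<longrightarrow> \<bar>s - t\<bar> \<le> 1 \<longrightarrow>
     (\<integral>\<^sup>+\<omega>. ennreal (((s - t)\<^sup>2 + (X s \<omega> - X t \<omega>)\<^sup>2) powr (- \<gamma> / 2)) \<partial>M) \<le> ennreal (A * \<bar>s - t\<bar> powr (- ((\<gamma> - \<theta>) + \<theta> / \<alpha>)))"
proof -
  obtain C b where C: "0 < C" "0 < b" "\<And>h \<xi>. 0 < h \<Longrightarrow> h \<le> 1 \<Longrightarrow> char_abs h \<xi> \<le> C * exp (- (b * h powr (1 / \<alpha>)) * \<bar>\<xi>\<bar>)"
    using char_abs_decay[OF \<alpha>] by blast
  define A where "A = Gamma ((\<gamma> - \<theta>) / 2) / Gamma (\<gamma> / 2) * (C / b) powr \<theta>"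
  have A: "0 < A" using \<theta> C Gamma_real_pos[of "(\<gamma> - \<theta>) / 2"] Gamma_real_pos[of "\<gamma> / 2"] by (simp add: A_def)
  have ordered: "(\<integral>\<^sup>+\<omega>. ennreal (((s - t)\<^sup>2 + (X s \<omega> - X t \<omega>)\<^sup>2) powr (- \<gamma> / 2)) \<partial>M) \<le> ennreal (A * \<bar>s - t\<bar> powr (- ((\<gamma> - \<theta>) + \<theta> / \<alpha>)))"
    if st: "0 \<le> s" "0 \<le> t" "t < s" "\<bar>s - t\<bar> \<le> 1" for s t
  proof -
    define h where "h = s - t"
    have h: "0 < h" "h \<le> 1" using st by (auto simp: h_def)
    interpret D: real_distribution "distr M borel (\<lambda>\<omega>. X h \<omega> - X 0 \<omega>)" using h by (intro real_distribution_diff) auto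
    have [measurable]: "(\<lambda>\<omega>. X s \<omega> - X t \<omega>) \<in> borel_measurable M" using st by measurable
    have "(\<integral>\<^sup>+\<omega>. ennreal ((h\<^sup>2 + (X s \<omega> - X t \<omega>)\<^sup>2) powr (- \<gamma> / 2)) \<partial>M) =
       (\<integral>\<^sup>+x. ennreal ((h\<^sup>2 + x\<^sup>2) powr (- \<gamma> / 2)) \<partial>distr M borel (\<lambda>\<omega>. X s \<omega> - X t \<omega>))"
      by (subst nn_integral_distr) auto
    also have "distr M borel (\<lambda>\<omega>. X s \<omega> - X t \<omega>) = distr M borel (\<lambda>\<omega>. X h \<omega> - X 0 \<omega>)"
      using stationary_increments[of t h] st h by (simp add: h_def)
    also have "(\<integral>\<^sup>+x. ennreal ((h\<^sup>2 + x\<^sup>2) powr (- \<gamma> / 2)) \<partial>distr M borel (\<lambda>\<omega>. X h \<omega> - X 0 \<omega>)) \<le>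
       ennreal (Gamma ((\<gamma> - \<theta>) / 2) / Gamma (\<gamma> / 2) * (C / (b * h powr (1 / \<alpha>))) powr \<theta> * h powr (- (\<gamma> - \<theta>)))"
      using C h \<theta> unfolding char_abs_def by (intro D.nn_integral_riesz_kernel_le) auto
    also have "Gamma ((\<gamma> - \<theta>) / 2) / Gamma (\<gamma> / 2) * (C / (b * h powr (1 / \<alpha>))) powr \<theta> * h powr (- (\<gamma> - \<theta>)) =
       A * h powr (- ((\<gamma> - \<theta>) + \<theta> / \<alpha>))"
    proof -
      have "C / (b * h powr (1 / \<alpha>)) = C / b * h powr (- 1 / \<alpha>)" by (simp add: powr_minus divide_inverse)
      then have "(C / (b * h powr (1 / \<alpha>))) powr \<theta> = (C / b) powr \<theta> * h powr (- (\<theta> / \<alpha>))"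
        using C by (simp only: powr_mult powr_powr) simp
      moreover have "h powr (- (\<theta> / \<alpha>)) * h powr (- (\<gamma> - \<theta>)) = h powr (- ((\<gamma> - \<theta>) + \<theta> / \<alpha>))"
        by (subst powr_add[symmetric]) (simp add: algebra_simps)
      ultimately show ?thesis by (simp add: A_def mult.assoc)
    qed
    finally show ?thesis using h by (simp add: h_def)
  qed
  have "(\<integral>\<^sup>+\<omega>. ennreal (((s - t)\<^sup>2 + (X s \<omega> - X t \<omega>)\<^sup>2) powr (- \<gamma> / 2)) \<partial>M) \<le> ennreal (A * \<bar>s - t\<bar> powr (- ((\<gamma> - \<theta>) + \<theta> / \<alpha>)))"
    if st: "0 \<le> s" "0 \<le> t" "s \<noteq> t" "\<bar>s - t\<bar> \<le> 1" for s t
  proof (cases "t < s")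
    case False
    then show ?thesis using ordered[of t s] st by (simp add: power2_commute[of s t] power2_commute[of "X s _"] abs_minus_commute)
  qed (use ordered st in blast)
  then show ?thesis using A by blast
qed

end

section \<open>The energy method\<close>

text \<open>The potential \<open>g\<close> is finite almost everywhere, hence bounded by some
  \<open>N\<close> on a set \<open>T N\<close> of positive mass. A set of diameter \<open>d\<close>
  contains the graph points over a part of \<open>T N\<close> of mass at most
  \<open>N * d powr \<gamma>\<close>, so covers cannot be arbitrarily cheap.\<close>

lemma hausdorff_measure_graph_neq_0:
  fixes f :: "real \<Rightarrow> real"
  assumes f[measurable]: "f \<in> borel_measurable borel" and fin: "finite_measure \<mu>" and sets[measurable_cong]: "sets \<mu> = sets borel"
    and pos: "0 < emeasure \<mu> UNIV" and K: "emeasure \<mu> (- K) = 0" "K \<in> sets borel" "K \<subseteq> B"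
    and atomless: "\<And>x. emeasure \<mu> {x} = 0" and \<gamma>: "0 < \<gamma>"
    and energy: "(\<integral>\<^sup>+t. \<integral>\<^sup>+u. ennreal (((t - u)\<^sup>2 + (f t - f u)\<^sup>2) powr (- \<gamma> / 2)) \<partial>\<mu> \<partial>\<mu>) \<noteq> \<infinity>"
  shows "hausdorff_measure \<gamma> ((\<lambda>t. (t, f t)) ` B) \<noteq> 0"
proof
  assume "hausdorff_measure \<gamma> ((\<lambda>t. (t, f t)) ` B) = 0"
  then have 0: "hausdorff_content \<gamma> ((\<lambda>t. (t, f t)) ` B) = 0" using hausdorff_measure_eq_0_iff[OF \<gamma>] by blast
  interpret finite_measure \<mu> by fact
  have sp[simp]: "space \<mu> = UNIV" using sets_eq_imp_space_eq[OF sets] by simp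
  define g where "g t = (\<integral>\<^sup>+u. ennreal (((t - u)\<^sup>2 + (f t - f u)\<^sup>2) powr (- \<gamma> / 2)) \<partial>\<mu>)" for t
  have gm[measurable]: "g \<in> borel_measurable \<mu>" unfolding g_def by measurable
  have ae: "AE t in \<mu>. g t \<noteq> \<infinity>" using energy unfolding g_def[symmetric] by (intro nn_integral_PInf_AE) auto
  define T where "T N = {t\<in>K. g t \<le> of_nat N}" for N :: nat
  have Tm[measurable]: "T N \<in> sets \<mu>" for N
  proof -
    have "T N = K \<inter> {t\<in>space \<mu>. g t \<le> of_nat N}" by (auto simp: T_def)
    also have "\<dots> \<in> sets \<mu>" using K sets by (intro sets.Int) (auto, measurable)
    finally show ?thesis .
  qed
  have "\<exists>N. 0 < emeasure \<mu> (T N)"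
  proof (rule ccontr)
    assume "\<not> ?thesis"
    then have "emeasure \<mu> (T N) = 0" for N by (simp add: zero_less_iff_neq_zero)
    then have "(\<Union>N. T N) \<in> null_sets \<mu>" using Tm by (intro null_sets_UN) auto
    moreover have "- K \<in> null_sets \<mu>" using K sets by auto
    moreover have "{t. g t = \<infinity>} \<in> null_sets \<mu>"
      using ae by (subst (asm) AE_iff_null) auto
    ultimately have "(\<Union>N. T N) \<union> - K \<union> {t. g t = \<infinity>} \<in> null_sets \<mu>" by (intro null_sets.Un)
    moreover have "(\<Union>N. T N) \<union> - K \<union> {t. g t = \<infinity>} = UNIV"
    proof -
      have "\<exists>N::nat. g t \<le> of_nat N" if "g t \<noteq> \<infinity>" for t
        using that ennreal_Ex_less_of_nat[of "g t"] by (auto simp: less_top intro: less_imp_le)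
      then show ?thesis by (auto simp: T_def)
    qed
    ultimately show False using pos by auto
  qed
  then obtain N where N: "0 < emeasure \<mu> (T N)" by blast
  \<comment> \<open>The \<open>+ 1\<close> avoids a division by 0 at \<open>N = 0\<close>.\<close>
  define e where "e = emeasure \<mu> (T N) / (of_nat N + 1)"
  have "e > 0" using N unfolding e_def by (simp add: ennreal_zero_less_divide of_nat_less_top)
  then obtain C where C: "\<And>i. bounded (C i)" "(\<lambda>t. (t, f t)) ` B \<subseteq> (\<Union>i. C i)" "(\<Sum>i. diameter_pow (C i) \<gamma>) < e"
    using 0 hausdorff_content_less_iff[of \<gamma> "(\<lambda>t. (t, f t)) ` B" e] by auto
  have piece: "\<exists>S\<in>sets \<mu>. {u\<in>T N. (u, f u) \<in> C i} \<subseteq> S \<and> emeasure \<mu> S \<le> of_nat N * diameter_pow (C i) \<gamma>" for i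
  proof (cases "\<exists>t\<in>T N. (t, f t) \<in> C i")
    case False then show ?thesis by (intro bexI[of _ "{}"]) auto
  next
    case True
    then obtain t where t: "t \<in> T N" "(t, f t) \<in> C i" by blast
    define d where "d = diameter (C i)"
    have d0: "0 \<le> d" using diameter_ge_0[OF C(1)] by (simp add: d_def)
    \<comment> \<open>\<open>C i\<close> is arbitrary, so the times it catches are enclosed in a
      measurable set: those with graph point within \<open>d\<close> of the one at
      \<open>t\<close>.\<close>
    define S where "S = {u. (t - u)\<^sup>2 + (f t - f u)\<^sup>2 \<le> d\<^sup>2}"
    have Sm: "S \<in> sets \<mu>"
    proof -
      have "{u\<in>space borel. (t - u)\<^sup>2 + (f t - f u)\<^sup>2 \<le> d\<^sup>2} \<in> sets borel" by measurable
      then show ?thesis by (simp add: S_def sets)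
    qed
    have sub: "{u\<in>T N. (u, f u) \<in> C i} \<subseteq> S"
    proof
      fix u assume "u \<in> {u\<in>T N. (u, f u) \<in> C i}"
      then have "dist (t, f t) (u, f u) \<le> d" using diameter_bounded_bound[OF C(1) t(2)] by (auto simp: d_def)
      then have "sqrt ((t - u)\<^sup>2 + (f t - f u)\<^sup>2) \<le> d" by (simp add: dist_prod_def dist_real_def)
      then show "u \<in> S" unfolding S_def using d0 by (simp add: real_sqrt_le_iff sqrt_le_D)
    qed
    have dp: "diameter_pow (C i) \<gamma> = ennreal (d powr \<gamma>)" using t \<gamma> by (auto simp: diameter_pow_def d_def)
    have "emeasure \<mu> S \<le> of_nat N * ennreal (d powr \<gamma>)"
    proof (cases "d = 0")
      case True
      have "S \<subseteq> {t}" using True by (auto simp: S_def add_nonneg_eq_0_iff power2_eq_iff sum_power2_le_zero_iff)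
      then have "emeasure \<mu> S \<le> emeasure \<mu> {t}" using sets by (intro emeasure_mono) auto
      then show ?thesis using atomless by simp
    next
      case False
      then have d: "0 < d" using d0 by simp
      \<comment> \<open>At \<open>u = t\<close> the kernel has the default value
        \<open>0 powr _ = 0\<close> instead of infinity, so this point is removed; it carries no
        mass.\<close>
      have "emeasure \<mu> S \<le> emeasure \<mu> ((S - {t}) \<union> {t})" using Sm sets by (intro emeasure_mono) auto
      also have "\<dots> \<le> emeasure \<mu> (S - {t}) + emeasure \<mu> {t}" using Sm sets by (intro emeasure_subadditive) auto
      also have "\<dots> = emeasure \<mu> (S - {t})" using atomless by simp
      also have "\<dots> = (\<integral>\<^sup>+u. indicator (S - {t}) u \<partial>\<mu>)" using Sm sets by (intro nn_integral_indicator[symmetric]) auto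
      also have "\<dots> \<le> (\<integral>\<^sup>+u. ennreal (d powr \<gamma>) * ennreal (((t - u)\<^sup>2 + (f t - f u)\<^sup>2) powr (- \<gamma> / 2)) \<partial>\<mu>)"
      proof (rule nn_integral_mono)
        fix u
        show "indicator (S - {t}) u \<le> ennreal (d powr \<gamma>) * ennreal (((t - u)\<^sup>2 + (f t - f u)\<^sup>2) powr (- \<gamma> / 2))"
        proof (cases "u \<in> S - {t}")
          case True
          define x where "x = (t - u)\<^sup>2 + (f t - f u)\<^sup>2"
          have x: "0 < x" "x \<le> d\<^sup>2" using True by (auto simp: x_def S_def intro!: add_pos_nonneg)
          have "(d\<^sup>2) powr (- \<gamma> / 2) \<le> x powr (- \<gamma> / 2)" using x \<gamma> by (intro powr_mono2') auto
          moreover have "(d\<^sup>2) powr (- \<gamma> / 2) = d powr (- \<gamma>)"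
          proof -
            have "d\<^sup>2 = d powr 2" using d by simp
            then show ?thesis by (simp only: powr_powr) simp
          qed
          ultimately have "d powr \<gamma> * d powr (- \<gamma>) \<le> d powr \<gamma> * x powr (- \<gamma> / 2)" by (intro mult_left_mono) auto
          then have "1 \<le> d powr \<gamma> * x powr (- \<gamma> / 2)" using d by (simp add: powr_add[symmetric])
          then show ?thesis using True unfolding x_def[symmetric] by (simp add: ennreal_mult[symmetric])
        qed simp
      qed
      also have "\<dots> = ennreal (d powr \<gamma>) * g t" unfolding g_def by (rule nn_integral_cmult) measurable
      also have "\<dots> \<le> ennreal (d powr \<gamma>) * of_nat N" using t by (intro mult_left_mono) (auto simp: T_def)
      finally show ?thesis by (simp add: mult.commute)
    qed
    then show ?thesis using sub Sm dp by auto
  qed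
  have "\<exists>S. \<forall>i. S i \<in> sets \<mu> \<and> {u\<in>T N. (u, f u) \<in> C i} \<subseteq> S i \<and> emeasure \<mu> (S i) \<le> of_nat N * diameter_pow (C i) \<gamma>"
    by (rule choice) (use piece in blast)
  then obtain S where S: "\<And>i. S i \<in> sets \<mu>" "\<And>i. {u\<in>T N. (u, f u) \<in> C i} \<subseteq> S i"
     "\<And>i. emeasure \<mu> (S i) \<le> of_nat N * diameter_pow (C i) \<gamma>" by blast
  have "T N \<subseteq> (\<Union>i. S i)"
  proof
    fix u assume u: "u \<in> T N"
    then have "(u, f u) \<in> (\<lambda>t. (t, f t)) ` B" using K by (auto simp: T_def)
    then obtain i where "(u, f u) \<in> C i" using C(2) by blast
    then show "u \<in> (\<Union>i. S i)" using S(2) u by blast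
  qed
  then have "emeasure \<mu> (T N) \<le> emeasure \<mu> (\<Union>i. S i)" using S(1) by (intro emeasure_mono) auto
  also have "\<dots> \<le> (\<Sum>i. emeasure \<mu> (S i))" using S(1) by (intro emeasure_subadditive_countably) auto
  also have "\<dots> \<le> (\<Sum>i. of_nat N * diameter_pow (C i) \<gamma>)" by (intro suminf_le S summableI)
  also have "\<dots> = of_nat N * (\<Sum>i. diameter_pow (C i) \<gamma>)" by simp
  also have "\<dots> \<le> (of_nat N + 1) * (\<Sum>i. diameter_pow (C i) \<gamma>)" by (intro mult_right_mono) auto
  also have "\<dots> < (of_nat N + 1) * e"
    using C(3) by (intro ennreal_mult_strict_left_mono) (auto simp: of_nat_less_top zero_less_iff_neq_zero)
  also have "\<dots> = emeasure \<mu> (T N)" unfolding e_def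
    by (simp add: ennreal_times_divide ennreal_mult_divide_eq ennreal_of_nat_eq_real_of_nat mult_divide_eq_ennreal mult.commute)
  finally show False by simp
qed

text \<open>Dyadic shells: at distance of order 2^-n from \<open>t\<close> the kernel is at most
  2^((n+1) p) and the mass at most A 2^(-n s), which gives a geometric series of ratio
  \<open>2 powr (p - s)\<close>.\<close>

lemma nn_integral_powr_distance_le:
  assumes sets[measurable_cong]: "sets \<mu> = sets borel" and A: "0 \<le> A"
    and ball: "\<And>x n. emeasure \<mu> {x - 1 / 2^n .. x + 1 / 2^n} \<le> ennreal (A * (1 / 2^n) powr s)"
    and p: "0 < p" "p < s"
  shows "\<exists>D\<ge>0. \<forall>t. (\<integral>\<^sup>+u. ennreal (\<bar>t - u\<bar> powr (- p)) * indicator {u. \<bar>t - u\<bar> \<le> 1} u \<partial>\<mu>) \<le> ennreal D"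
proof -
  define q where "q = 2 powr (p - s)"
  have q: "0 < q" "q < 1"
  proof -
    have "2 powr (p - s) < 2 powr (0::real)" using p by (intro powr_less_mono) auto
    then show "q < 1" "0 < q" by (auto simp: q_def)
  qed
  define D where "D = A * 2 powr p * (1 / (1 - q))"
  have "(\<integral>\<^sup>+u. ennreal (\<bar>t - u\<bar> powr (- p)) * indicator {u. \<bar>t - u\<bar> \<le> 1} u \<partial>\<mu>) \<le> ennreal D" for t
  proof -
    define I where "I n = {t - 1 / 2^n .. t + 1 / 2^n}" for n :: nat
    have "(\<integral>\<^sup>+u. ennreal (\<bar>t - u\<bar> powr (- p)) * indicator {u. \<bar>t - u\<bar> \<le> 1} u \<partial>\<mu>) \<le>
      (\<integral>\<^sup>+u. (\<Sum>n. ennreal ((2^Suc n) powr p) * indicator (I n) u) \<partial>\<mu>)"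
    proof (rule nn_integral_mono)
      fix u
      show "ennreal (\<bar>t - u\<bar> powr (- p)) * indicator {u. \<bar>t - u\<bar> \<le> 1} u \<le> (\<Sum>n. ennreal ((2^Suc n) powr p) * indicator (I n) u)"
      proof (cases "u \<noteq> t \<and> \<bar>t - u\<bar> \<le> 1")
        case True
        define n where "n = nat \<lfloor>- log 2 \<bar>t - u\<bar>\<rfloor>"
        have "0 \<le> - log 2 \<bar>t - u\<bar>" using True by simp
        then have n: "real n \<le> - log 2 \<bar>t - u\<bar>" "- log 2 \<bar>t - u\<bar> \<le> real n + 1" unfolding n_def by linarith+
        have "\<bar>t - u\<bar> = 2 powr (log 2 \<bar>t - u\<bar>)" using True by simp
        moreover have "2 powr (log 2 \<bar>t - u\<bar>) \<le> 2 powr (- real n)" "2 powr (- (real n + 1)) \<le> 2 powr (log 2 \<bar>t - u\<bar>)"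
          using n by (auto intro!: powr_mono)
        ultimately have le: "\<bar>t - u\<bar> \<le> 2 powr (- real n)" "2 powr (- (real n + 1)) \<le> \<bar>t - u\<bar>" by simp_all
        have "2 powr (- real n) = 1 / 2^n" by (simp add: powr_minus powr_realpow divide_inverse)
        then have uI: "u \<in> I n" using le by (auto simp: I_def abs_le_iff)
        have "\<bar>t - u\<bar> powr (- p) \<le> (2 powr (- (real n + 1))) powr (- p)"
          using le p by (intro powr_mono2') auto
        also have "\<dots> = (2 powr (real (Suc n))) powr p"
          unfolding powr_powr by (rule arg_cong[where f = "(powr) 2"]) (simp add: algebra_simps)
        also have "2 powr (real (Suc n)) = (2::real)^Suc n" by (rule powr_realpow) simp
        finally have "ennreal (\<bar>t - u\<bar> powr (- p)) \<le> ennreal ((2^Suc n) powr p) * indicator (I n) u"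
          using uI by (simp add: ennreal_leI del: power_Suc)
        also have "\<dots> \<le> (\<Sum>n. ennreal ((2^Suc n) powr p) * indicator (I n) u)"
          by (rule ennreal_le_suminf)
        finally show ?thesis using True by simp
      qed (auto simp: indicator_def)
    qed
    also have "\<dots> = (\<Sum>n. ennreal ((2^Suc n) powr p) * emeasure \<mu> (I n))"
      by (subst nn_integral_suminf) (auto simp: I_def sets nn_integral_cmult simp del: power_Suc)
    also have "\<dots> \<le> (\<Sum>n. ennreal ((2^Suc n) powr p) * ennreal (A * (1 / 2^n) powr s))"
      unfolding I_def by (intro suminf_le mult_left_mono ball summableI) auto
    also have "\<dots> = (\<Sum>n. ennreal (A * 2 powr p * q ^ n))"
    proof (intro suminf_cong)
      fix n :: nat
      have pw: "(2::real)^k = 2 powr real k" for k by (simp add: powr_realpow)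
      have "(2^Suc n) powr p * (1 / 2^n) powr s = (2 powr (real (Suc n) * p)) * 2 powr (- real n * s)"
        unfolding pw by (simp add: powr_powr powr_minus_divide[symmetric] del: of_nat_Suc)
      also have "\<dots> = 2 powr (p + real n * (p - s))" by (subst powr_add[symmetric]) (simp add: algebra_simps)
      also have "\<dots> = 2 powr p * q ^ n" by (simp add: powr_add q_def powr_realpow[symmetric] powr_powr mult.commute)
      finally have *: "(2^Suc n) powr p * (1 / 2^n) powr s = 2 powr p * q ^ n" .
      have "ennreal ((2^Suc n) powr p) * ennreal (A * (1 / 2^n) powr s) = ennreal (A * ((2^Suc n) powr p * (1 / 2^n) powr s))"
        using A by (subst ennreal_mult[symmetric]) (auto simp: mult.left_commute)
      then show "ennreal ((2^Suc n) powr p) * ennreal (A * (1 / 2^n) powr s) = ennreal (A * 2 powr p * q ^ n)"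
        unfolding * by (simp add: mult.assoc)
    qed
    also have "\<dots> = ennreal D"
      unfolding D_def using sums_mult[OF geometric_sums[of q], of "A * 2 powr p"] q A by (intro suminf_ennreal_eq) auto
    finally show ?thesis .
  qed
  moreover have "0 \<le> D" using A q by (simp add: D_def)
  ultimately show ?thesis by blast
qed

section \<open>Joint measurability and the expected energy\<close>

context levy_process
begin

text \<open>Right continuity makes the process a limit of its values at dyadic times approached from
  the right; \<open>max 0\<close> freezes it at negative times.\<close>

lemma measurable_process_pair:
  "(\<lambda>(t, \<omega>). X (max 0 t) \<omega>) \<in> borel_measurable (borel \<Otimes>\<^sub>M M)"
proof (rule borel_measurable_LIMSEQ_metric)
  \<comment> \<open>The \<open>+ 1\<close> puts the dyadic time strictly to the right of
    \<open>max 0 t\<close>, even if that time is itself dyadic, so the limit can be taken along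
    \<open>at_right\<close>.\<close>
  define r where "r n t = (real_of_int \<lfloor>max 0 t * 2^n\<rfloor> + 1) / 2^n" for n :: nat and t :: real
  have r0: "0 \<le> r n t" for n t by (simp add: r_def)
  show "(\<lambda>(t, \<omega>). X (max 0 (r n t)) \<omega>) \<in> borel_measurable (borel \<Otimes>\<^sub>M M)" for n
  proof -
    have "(\<lambda>p :: real \<times> 'a. X (max 0 ((real_of_int \<lfloor>max 0 (fst p) * 2^n\<rfloor> + 1) / 2^n)) (snd p)) \<in> borel_measurable (borel \<Otimes>\<^sub>M M)"
    proof (rule measurable_compose_countable[where f = "\<lambda>k p. X (max 0 ((real_of_int k + 1) / 2^n)) (snd p)" and g = "\<lambda>p. \<lfloor>max 0 (fst p) * 2^n :: real\<rfloor>"])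
      show "(\<lambda>p. X (max 0 ((real_of_int k + 1) / 2^n)) (snd p)) \<in> borel_measurable (borel \<Otimes>\<^sub>M M)" for k
        by (intro measurable_compose[OF measurable_snd measurable_X]) simp
      show "(\<lambda>p. \<lfloor>max 0 (fst p) * 2^n :: real\<rfloor>) \<in> measurable (borel \<Otimes>\<^sub>M M) (count_space UNIV)" by measurable
    qed
    then show ?thesis by (simp add: r_def case_prod_beta')
  qed
  fix p :: "real \<times> 'a" assume "p \<in> space (borel \<Otimes>\<^sub>M M)"
  then obtain t \<omega> where p: "p = (t, \<omega>)" "\<omega> \<in> space M" by (auto simp: space_pair_measure)
  define t' where "t' = max 0 t"
  have r: "t' < r n t" "r n t \<le> t' + 1 / 2^n" for n
  proof -
    have "t' * 2^n < real_of_int \<lfloor>t' * 2^n\<rfloor> + 1" "real_of_int \<lfloor>t' * 2^n\<rfloor> \<le> t' * 2^n" by linarith+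
    then show "t' < r n t" "r n t \<le> t' + 1 / 2^n" unfolding r_def t'_def[symmetric] by (auto simp: field_simps)
  qed
  have "(\<lambda>n. r n t) \<longlonglongrightarrow> t'"
  proof (rule tendsto_sandwich[of "\<lambda>_. t'" _ _ "\<lambda>n. t' + 1 / 2^n"])
    have "(\<lambda>n. t' + (1/2)^n) \<longlonglongrightarrow> t' + 0" by (intro tendsto_intros LIMSEQ_power_zero) auto
    then show "(\<lambda>n. t' + 1 / 2^n) \<longlonglongrightarrow> t'" by (simp add: power_divide)
  qed (use less_imp_le[OF r(1)] r(2) in auto)
  then have "filterlim (\<lambda>n. r n t) (at_right t') sequentially"
    using r(1) by (auto simp: filterlim_at intro!: always_eventually)
  then have "(\<lambda>n. X (r n t) \<omega>) \<longlonglongrightarrow> X t' \<omega>"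
    by (rule filterlim_compose[OF tendsto_right[OF p(2)], rotated]) (simp add: t'_def)
  then show "(\<lambda>n. case p of (t, \<omega>) \<Rightarrow> X (max 0 (r n t)) \<omega>) \<longlonglongrightarrow> (case p of (t, \<omega>) \<Rightarrow> X (max 0 t) \<omega>)"
    using r0 by (simp add: p t'_def max_def)
qed

end

text \<open>The last condition on \<theta> says that the exponent \<open>p\<close> of the expected
  kernel is below \<open>s\<close>, so the Frostman measure has a bounded potential for that
  exponent and the expected energy is finite.\<close>

theorem (in semistable_levy_process) hausdorff_measure_graph_neq_0_AE:
  assumes \<alpha>: "1 < \<alpha>" and B: "B \<in> sets borel" "B \<subseteq> {0..}" and s: "0 < s" "hausdorff_measure s B \<noteq> 0"
    and \<theta>: "0 \<le> \<theta>" "\<theta> \<le> 1" "\<theta> < \<gamma>" "(\<gamma> - \<theta>) + \<theta> / \<alpha> < s"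
  shows "AE \<omega> in M. hausdorff_measure \<gamma> (process_graph X B \<omega>) \<noteq> 0"
proof -
  obtain K \<mu> where K: "compact K" "K \<subseteq> B" "\<And>x y. x \<in> K \<Longrightarrow> y \<in> K \<Longrightarrow> \<bar>x - y\<bar> \<le> 1"
    and \<mu>: "finite_measure \<mu>" "sets \<mu> = sets borel" "emeasure \<mu> (- K) = 0" "0 < emeasure \<mu> UNIV"
    "\<And>x n. emeasure \<mu> {x - 1 / 2^n .. x + 1 / 2^n} \<le> ennreal (6 * (1 / 2^n) powr s)"
    using frostman[OF B(1) s] by blast
  interpret \<mu>: finite_measure \<mu> by fact
  note [measurable_cong] = \<mu>(2)
  define p where "p = (\<gamma> - \<theta>) + \<theta> / \<alpha>"
  have p: "0 < p" "p < s" using \<theta> \<alpha> by (auto simp: p_def intro!: add_pos_nonneg)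
  obtain A where A: "0 < A" "\<And>u t. 0 \<le> t \<Longrightarrow> 0 \<le> u \<Longrightarrow> t \<noteq> u \<Longrightarrow> \<bar>t - u\<bar> \<le> 1 \<Longrightarrow>
     (\<integral>\<^sup>+\<omega>. ennreal (((t - u)\<^sup>2 + (X t \<omega> - X u \<omega>)\<^sup>2) powr (- \<gamma> / 2)) \<partial>M) \<le> ennreal (A * \<bar>t - u\<bar> powr (- p))"
    using nn_integral_kernel_increment_le[OF \<alpha> \<theta>(1-3)] unfolding p_def by blast
  obtain D where D: "0 \<le> D" "\<And>t. (\<integral>\<^sup>+u. ennreal (\<bar>t - u\<bar> powr (- p)) * indicator {u. \<bar>t - u\<bar> \<le> 1} u \<partial>\<mu>) \<le> ennreal D"
    using nn_integral_powr_distance_le[OF \<mu>(2) _ \<mu>(5) p] by auto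
  have atomless: "emeasure \<mu> {x} = 0" for x
  proof -
    have "emeasure \<mu> {x} \<le> ennreal (6 * (1 / 2^n) powr s)" for n
      using emeasure_mono[of "{x}" "{x - 1 / 2^n .. x + 1 / 2^n}" \<mu>] \<mu>(5)[of x n] \<mu>(2) by (auto intro: order_trans)
    moreover have "(\<lambda>n. ennreal (6 * (1 / 2^n) powr s)) \<longlonglongrightarrow> ennreal (6 * 0)"
    proof (intro tendsto_ennrealI tendsto_mult tendsto_const)
      have "(\<lambda>n. (1/2)^n :: real) \<longlonglongrightarrow> 0" by (rule LIMSEQ_power_zero) simp
      then have "(\<lambda>n. ((1/2)^n :: real) powr s) \<longlonglongrightarrow> 0 powr s" using s by (intro tendsto_powr2 tendsto_const) auto
      then show "(\<lambda>n. (1 / 2^n) powr s) \<longlonglongrightarrow> 0" using s by (simp add: power_divide)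
    qed
    ultimately have "emeasure \<mu> {x} \<le> ennreal (6 * 0)" by (intro tendsto_lowerbound) (auto intro: always_eventually)
    then show ?thesis by simp
  qed
  define Y where "Y t \<omega> = X (max 0 t) \<omega>" for t \<omega>
  have Ym: "(\<lambda>q. Y (fst q) (snd q)) \<in> borel_measurable (borel \<Otimes>\<^sub>M M)"
    using measurable_process_pair unfolding Y_def by (simp add: case_prod_beta')
  have Y2[measurable (raw)]: "(\<lambda>x. Y (g x) (h x)) \<in> borel_measurable N"
    if "g \<in> borel_measurable N" "h \<in> measurable N M" for g h and N :: "'x measure"
    using measurable_compose[OF measurable_Pair[OF that] Ym] by simp
  define k where "k \<omega> t u = ennreal (((t - u)\<^sup>2 + (Y t \<omega> - Y u \<omega>)\<^sup>2) powr (- \<gamma> / 2))" for \<omega> t u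
  have KB: "K \<in> sets borel" by (rule borel_compact[OF K(1)])
  have AE_K: "AE t in \<mu>. t \<in> K"
    using \<mu>(3) KB \<mu>(2) by (intro AE_I[of _ _ "- K"]) auto
  have inner: "(\<integral>\<^sup>+\<omega>. k \<omega> t u \<partial>M) \<le> ennreal A * (ennreal (\<bar>t - u\<bar> powr (- p)) * indicator {u. \<bar>t - u\<bar> \<le> 1} u)"
    if "t \<in> K" "u \<in> K" "u \<noteq> t" for t u
  proof -
    have "0 \<le> t" "0 \<le> u" "\<bar>t - u\<bar> \<le> 1" using that K B by auto
    then have "(\<integral>\<^sup>+\<omega>. k \<omega> t u \<partial>M) \<le> ennreal (A * \<bar>t - u\<bar> powr (- p))"
      using A(2)[of t u] that by (simp add: k_def Y_def)
    then show ?thesis using A \<open>\<bar>t - u\<bar> \<le> 1\<close> by (simp add: ennreal_mult)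
  qed
  have AE_ne: "AE u in \<mu>. u \<noteq> t" for t
    using atomless \<mu>(2) by (intro AE_I[of _ _ "{t}"]) auto
  interpret P: pair_sigma_finite M \<mu> ..
  interpret P': pair_sigma_finite \<mu> M ..
  \<comment> \<open>Tonelli's theorem moves the expectation inside, past one time variable after the
    other; this rests on the joint measurability of \<open>Y\<close>.\<close>
  have "(\<integral>\<^sup>+\<omega>. \<integral>\<^sup>+t. \<integral>\<^sup>+u. k \<omega> t u \<partial>\<mu> \<partial>\<mu> \<partial>M) = (\<integral>\<^sup>+t. \<integral>\<^sup>+\<omega>. \<integral>\<^sup>+u. k \<omega> t u \<partial>\<mu> \<partial>M \<partial>\<mu>)"
    unfolding k_def by (rule P'.Fubini') measurable
  also have "\<dots> = (\<integral>\<^sup>+t. \<integral>\<^sup>+u. \<integral>\<^sup>+\<omega>. k \<omega> t u \<partial>M \<partial>\<mu> \<partial>\<mu>)"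
    unfolding k_def by (intro nn_integral_cong P'.Fubini') measurable
  also have "\<dots> \<le> (\<integral>\<^sup>+t. ennreal A * ennreal D \<partial>\<mu>)"
  proof (rule nn_integral_mono_AE)
    show "AE t in \<mu>. (\<integral>\<^sup>+u. \<integral>\<^sup>+\<omega>. k \<omega> t u \<partial>M \<partial>\<mu>) \<le> ennreal A * ennreal D"
      using AE_K
    proof eventually_elim
      case (elim t)
      have "(\<integral>\<^sup>+u. \<integral>\<^sup>+\<omega>. k \<omega> t u \<partial>M \<partial>\<mu>) \<le> (\<integral>\<^sup>+u. ennreal A * (ennreal (\<bar>t - u\<bar> powr (- p)) * indicator {u. \<bar>t - u\<bar> \<le> 1} u) \<partial>\<mu>)"
      proof (rule nn_integral_mono_AE)
        show "AE u in \<mu>. (\<integral>\<^sup>+\<omega>. k \<omega> t u \<partial>M) \<le> ennreal A * (ennreal (\<bar>t - u\<bar> powr (- p)) * indicator {u. \<bar>t - u\<bar> \<le> 1} u)"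
          using AE_K AE_ne[of t] by eventually_elim (rule inner[OF elim])
      qed
      also have "\<dots> = ennreal A * (\<integral>\<^sup>+u. ennreal (\<bar>t - u\<bar> powr (- p)) * indicator {u. \<bar>t - u\<bar> \<le> 1} u \<partial>\<mu>)"
        by (rule nn_integral_cmult) measurable
      also have "\<dots> \<le> ennreal A * ennreal D" by (intro mult_left_mono D) auto
      finally show ?case .
    qed
  qed
  also have "\<dots> < top" using \<mu>.emeasure_finite[of "space \<mu>"]
    by (simp add: ennreal_mult_less_top less_top[symmetric] ennreal_mult_eq_top_iff)
  finally have "(\<integral>\<^sup>+\<omega>. \<integral>\<^sup>+t. \<integral>\<^sup>+u. k \<omega> t u \<partial>\<mu> \<partial>\<mu> \<partial>M) \<noteq> \<infinity>" by simp
  moreover have "(\<lambda>\<omega>. \<integral>\<^sup>+t. \<integral>\<^sup>+u. k \<omega> t u \<partial>\<mu> \<partial>\<mu>) \<in> borel_measurable M"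
    unfolding k_def by measurable
  ultimately have "AE \<omega> in M. (\<integral>\<^sup>+t. \<integral>\<^sup>+u. k \<omega> t u \<partial>\<mu> \<partial>\<mu>) \<noteq> \<infinity>" by (rule nn_integral_PInf_AE[rotated])
  then show ?thesis
  proof (rule AE_mp, intro AE_I2 impI)
    fix \<omega> assume \<omega>: "\<omega> \<in> space M" and fin: "(\<integral>\<^sup>+t. \<integral>\<^sup>+u. k \<omega> t u \<partial>\<mu> \<partial>\<mu>) \<noteq> \<infinity>"
    have "hausdorff_measure \<gamma> ((\<lambda>t. (t, Y t \<omega>)) ` B) \<noteq> 0"
    proof (rule hausdorff_measure_graph_neq_0[where K = K and \<mu> = \<mu>])
      show "(\<lambda>t. Y t \<omega>) \<in> borel_measurable borel" using \<omega> by measurable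
      show "(\<integral>\<^sup>+t. \<integral>\<^sup>+u. ennreal (((t - u)\<^sup>2 + (Y t \<omega> - Y u \<omega>)\<^sup>2) powr (- \<gamma> / 2)) \<partial>\<mu> \<partial>\<mu>) \<noteq> \<infinity>"
        using fin unfolding k_def .
    qed (use \<mu> K KB atomless \<theta> in auto)
    moreover have "(\<lambda>t. (t, Y t \<omega>)) ` B = process_graph X B \<omega>"
      unfolding process_graph_eq Y_def using B by (intro image_cong) (auto simp: max_def)
    ultimately show "hausdorff_measure \<gamma> (process_graph X B \<omega>) \<noteq> 0" by simp
  qed
qed

section \<open>The dimension of the graph\<close>

lemma hausdorff_dim_nonneg: "0 \<le> hausdorff_dim (F :: real set)"
  unfolding hausdorff_dim_def
  by (rule cInf_greatest) (use hausdorff_measure_real_eq_0[of 2 F] in \<open>auto intro: exI[of _ 2]\<close>)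

lemma hausdorff_measure_eq_0_above_dim:
  assumes "hausdorff_dim (F :: real set) < s" shows "hausdorff_measure s F = 0"
proof -
  have "{s. 0 \<le> s \<and> hausdorff_measure s F = 0} \<noteq> {}"
    using hausdorff_measure_real_eq_0[of 2 F] by (auto intro: exI[of _ 2])
  then obtain t where "0 \<le> t" "hausdorff_measure t F = 0" "t < s"
    using cInf_lessD[OF _ assms[unfolded hausdorff_dim_def]] by blast
  then show ?thesis using hausdorff_measure_eq_0_mono[of t F s] by simp
qed

lemma hausdorff_dim_real_le_1: "hausdorff_dim (F :: real set) \<le> 1"
proof (rule field_le_epsilon)
  fix e :: real assume "0 < e"
  then show "hausdorff_dim F \<le> 1 + e" by (intro hausdorff_dim_le hausdorff_measure_real_eq_0) auto
qed

context semistable_levy_process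
begin

text \<open>\<open>B\<close> need not be null at its own dimension, so a sequence of exponents
  decreasing to it is used, at the price of one null event each, and continuity of \<open>g\<close>
  gives the limit. The null exponent of the graph is recorded for the lower bound.\<close>

lemma hausdorff_dim_graph_le_AE:
  assumes B: "B \<subseteq> {0..}" and g: "mono g" "continuous_on UNIV g" "\<And>s. 0 \<le> s \<Longrightarrow> 0 \<le> g s"
    and up: "\<And>s. 0 < s \<Longrightarrow> hausdorff_measure s B = 0 \<Longrightarrow> AE \<omega> in M. hausdorff_measure (g s) (process_graph X B \<omega>) = 0"
  shows "AE \<omega> in M. (\<exists>s\<ge>0. hausdorff_measure s (process_graph X B \<omega>) = 0) \<and> hausdorff_dim (process_graph X B \<omega>) \<le> g (hausdorff_dim B)"
proof -
  define \<beta> where "\<beta> = hausdorff_dim B"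
  have \<beta>0: "0 \<le> \<beta>" unfolding \<beta>_def by (rule hausdorff_dim_nonneg)
  have z: "hausdorff_measure (\<beta> + 1 / real (Suc n)) B = 0" for n
    by (rule hausdorff_measure_eq_0_above_dim) (simp add: \<beta>_def)
  have "AE \<omega> in M. \<forall>n. hausdorff_measure (g (\<beta> + 1 / real (Suc n))) (process_graph X B \<omega>) = 0"
    unfolding AE_all_countable using z \<beta>0 by (intro allI up) (auto intro: add_nonneg_pos)
  then show ?thesis
  proof eventually_elim
    case (elim \<omega>)
    have g0: "0 \<le> g (\<beta> + 1 / real (Suc n))" for n using \<beta>0 by (intro g(3)) auto
    have "hausdorff_dim (process_graph X B \<omega>) \<le> g (\<beta> + 1 / real (Suc n))" for n
      using elim g0 by (intro hausdorff_dim_le) auto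
    moreover have "(\<lambda>n. g (\<beta> + 1 / real (Suc n))) \<longlonglongrightarrow> g (\<beta> + 0)"
    proof (rule continuous_on_tendsto_compose[OF g(2)])
      show "(\<lambda>n. \<beta> + 1 / real (Suc n)) \<longlonglongrightarrow> \<beta> + 0" by (intro tendsto_intros LIMSEQ_Suc lim_1_over_n)
    qed auto
    ultimately have "hausdorff_dim (process_graph X B \<omega>) \<le> g (\<beta> + 0)"
      by (intro tendsto_lowerbound) (auto intro: always_eventually)
    then show ?case using elim g0 by (auto simp: \<beta>_def)
  qed
qed

text \<open>If \<open>\<gamma>'\<close> is not null for the graph, no smaller positive exponent is,
  so \<gamma> may first be raised to a value that admits a suitable \<theta>. The null exponent is a
  premise because the infimum over an empty set would be unspecified.\<close>

lemma hausdorff_dim_graph_ge_AE: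
  assumes \<alpha>: "1 < \<alpha>" and B: "B \<in> sets borel" "B \<subseteq> {0..}" and \<theta>: "\<And>\<gamma>. \<gamma> < d \<Longrightarrow> 0 < \<gamma> \<Longrightarrow> \<exists>\<gamma>' \<theta>. \<gamma> \<le> \<gamma>' \<and> 0 \<le> \<theta> \<and> \<theta> \<le> 1 \<and> \<theta> < \<gamma>' \<and> (\<gamma>' - \<theta>) + \<theta> / \<alpha> < hausdorff_dim B"
  shows "AE \<omega> in M. (\<exists>s\<ge>0. hausdorff_measure s (process_graph X B \<omega>) = 0) \<longrightarrow> d \<le> hausdorff_dim (process_graph X B \<omega>)"
proof -
  have lower: "AE \<omega> in M. hausdorff_measure \<gamma> (process_graph X B \<omega>) \<noteq> 0" if \<gamma>: "\<gamma> < d" "0 < \<gamma>" for \<gamma>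
  proof -
    obtain \<gamma>' \<theta> where t: "\<gamma> \<le> \<gamma>'" "0 \<le> \<theta>" "\<theta> \<le> 1" "\<theta> < \<gamma>'" "(\<gamma>' - \<theta>) + \<theta> / \<alpha> < hausdorff_dim B" using \<theta>[OF \<gamma>] by blast
    obtain s where s: "(\<gamma>' - \<theta>) + \<theta> / \<alpha> < s" "s < hausdorff_dim B" using dense t by blast
    have "0 \<le> \<theta> / \<alpha>" using t \<alpha> by simp
    then have s0: "0 < s" using s t by linarith
    then have "hausdorff_measure s B \<noteq> 0" using hausdorff_dim_le[of s B] s by auto
    then have "AE \<omega> in M. hausdorff_measure \<gamma>' (process_graph X B \<omega>) \<noteq> 0"
      using t s s0 by (intro hausdorff_measure_graph_neq_0_AE[OF \<alpha> B]) auto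
    then show ?thesis
      by eventually_elim (use hausdorff_measure_eq_0_mono t \<gamma> in \<open>metis less_imp_le\<close>)
  qed
  have "AE \<omega> in M. \<forall>n. 0 < d - 1 / real (Suc n) \<longrightarrow> hausdorff_measure (d - 1 / real (Suc n)) (process_graph X B \<omega>) \<noteq> 0"
    unfolding AE_all_countable
  proof
    fix n
    show "AE \<omega> in M. 0 < d - 1 / real (Suc n) \<longrightarrow> hausdorff_measure (d - 1 / real (Suc n)) (process_graph X B \<omega>) \<noteq> 0"
      using lower[of "d - 1 / real (Suc n)"] by (cases "0 < d - 1 / real (Suc n)") auto
  qed
  then show ?thesis
  proof (eventually_elim, intro impI)
    fix \<omega> assume nz: "\<forall>n. 0 < d - 1 / real (Suc n) \<longrightarrow> hausdorff_measure (d - 1 / real (Suc n)) (process_graph X B \<omega>) \<noteq> 0"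
      and "\<exists>s\<ge>0. hausdorff_measure s (process_graph X B \<omega>) = 0"
    then obtain s where s: "0 \<le> s" "hausdorff_measure s (process_graph X B \<omega>) = 0" by blast
    show "d \<le> hausdorff_dim (process_graph X B \<omega>)"
    proof (rule hausdorff_dim_geI[OF s(2,1)])
      fix t assume t: "0 < t" "t < d"
      obtain n where n: "1 / real (Suc n) < d - t" using nat_approx_posE[of "d - t"] t by auto
      have "hausdorff_measure (d - 1 / real (Suc n)) (process_graph X B \<omega>) \<noteq> 0" using nz[rule_format, of n] n t by auto
      then show "hausdorff_measure t (process_graph X B \<omega>) \<noteq> 0"
        using hausdorff_measure_eq_0_mono[of t "process_graph X B \<omega>" "d - 1 / real (Suc n)"] n t by auto
    qed
  qed
qed

end

theorem theorem3p2:
  fixes M :: "'a measure" and X :: "real \<Rightarrow> 'a \<Rightarrow> real"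
    and \<alpha> c :: real and B :: "real set"
  assumes "1 < c" and "0 < \<alpha>" and "\<alpha> \<le> 2"
    and "semistable_levy_process M X \<alpha> c"
    and "B \<in> sets borel" and "B \<subseteq> {0..}"
  shows "AE \<omega> in M. hausdorff_dim (process_graph X B \<omega>) =
    (if \<alpha> * hausdorff_dim B \<le> 1
     then hausdorff_dim B * max \<alpha> 1
     else 1 + hausdorff_dim B - 1 / \<alpha>)"
proof -
  interpret semistable_levy_process M X \<alpha> c by fact
  define \<beta> where "\<beta> = hausdorff_dim B"
  have \<beta>0: "0 \<le> \<beta>" unfolding \<beta>_def by (rule hausdorff_dim_nonneg)
  have \<beta>1: "\<beta> \<le> 1" unfolding \<beta>_def by (rule hausdorff_dim_real_le_1)
  have upper_max: "AE \<omega> in M. (\<exists>s\<ge>0. hausdorff_measure s (process_graph X B \<omega>) = 0) \<and>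
      hausdorff_dim (process_graph X B \<omega>) \<le> \<beta> * max \<alpha> 1"
    unfolding \<beta>_def
    by (rule hausdorff_dim_graph_le_AE[where g = "\<lambda>s. s * max \<alpha> 1"])
       (use assms in \<open>auto intro!: monoI mult_right_mono continuous_intros hausdorff_measure_graph_eq_0_max\<close>)
  \<comment> \<open>Since \<open>\<beta> <= 1\<close>, the case \<alpha> \<le> 1 always falls under
    the first formula, with dimension \<beta>.\<close>
  consider "\<alpha> \<le> 1" | "1 < \<alpha>" "\<alpha> * \<beta> \<le> 1" | "1 < \<alpha>" "1 < \<alpha> * \<beta>" by linarith
  then show ?thesis
  proof cases
    case 1
    have "\<alpha> * \<beta> \<le> 1" using mult_mono[of \<alpha> 1 \<beta> 1] 1 \<beta>0 \<beta>1 by simp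
    moreover have "\<beta> \<le> hausdorff_dim (process_graph X B \<omega>)"
      if ex: "\<exists>s\<ge>0. hausdorff_measure s (process_graph X B \<omega>) = 0" for \<omega>
    proof -
      obtain s where s: "0 \<le> s" "hausdorff_measure s (process_graph X B \<omega>) = 0" using ex by blast
      have "fst ` process_graph X B \<omega> = B" by (simp add: process_graph_eq image_image)
      then have proj: "hausdorff_measure t B = 0" if "hausdorff_measure t (process_graph X B \<omega>) = 0" "0 \<le> t" for t
        using hausdorff_measure_projection_eq_0[of fst t "process_graph X B \<omega>"] that by (simp add: dist_fst_le)
      have "hausdorff_measure t (process_graph X B \<omega>) \<noteq> 0" if "0 < t" "t < \<beta>" for t
        using proj[of t] hausdorff_dim_le[of t B] that unfolding \<beta>_def by auto
      then show ?thesis using s by (intro hausdorff_dim_geI) auto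
    qed
    ultimately have low: "\<alpha> * \<beta> \<le> 1"
      "\<And>\<omega>. \<exists>s\<ge>0. hausdorff_measure s (process_graph X B \<omega>) = 0 \<Longrightarrow> \<beta> \<le> hausdorff_dim (process_graph X B \<omega>)" .
    from upper_max show ?thesis unfolding \<beta>_def[symmetric]
    proof eventually_elim
      case (elim \<omega>)
      then show ?case using low(1) low(2)[of \<omega>] 1 by (simp add: max_def)
    qed
  next
    case 2
    have "AE \<omega> in M. (\<exists>s\<ge>0. hausdorff_measure s (process_graph X B \<omega>) = 0) \<longrightarrow> \<beta> * \<alpha> \<le> hausdorff_dim (process_graph X B \<omega>)"
    proof (rule hausdorff_dim_graph_ge_AE[OF 2(1) assms(5,6)])
      fix \<gamma> assume \<gamma>: "\<gamma> < \<beta> * \<alpha>" "0 < \<gamma>"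
      have "\<gamma> / \<alpha> < \<beta>" using \<gamma> 2 by (simp add: divide_less_eq)
      \<comment> \<open>With \<open>\<theta> = \<gamma> - e\<close> the exponent is
        \<open>e + (\<gamma> - e) / \<alpha>\<close>, below \<beta> because
        \<open>e < \<beta> - \<gamma> / \<alpha>\<close>; and \<open>\<theta> <= 1\<close> follows
        from \<open>\<alpha> * \<beta> <= 1\<close>.\<close>
      then obtain e where e: "0 < e" "e < \<gamma>" "e < \<beta> - \<gamma> / \<alpha>"
        using field_lbound_gt_zero[of \<gamma> "\<beta> - \<gamma> / \<alpha>"] \<gamma> by auto
      have "0 \<le> e / \<alpha>" using e 2 by simp
      then have "(\<gamma> - (\<gamma> - e)) + (\<gamma> - e) / \<alpha> < \<beta>" using e by (simp add: diff_divide_distrib)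
      moreover have "\<gamma> - e \<le> 1" using \<gamma> e 2 by (simp add: mult.commute)
      ultimately show "\<exists>\<gamma>' \<theta>. \<gamma> \<le> \<gamma>' \<and> 0 \<le> \<theta> \<and> \<theta> \<le> 1 \<and> \<theta> < \<gamma>' \<and> (\<gamma>' - \<theta>) + \<theta> / \<alpha> < hausdorff_dim B"
        using e by (intro exI[of _ \<gamma>] exI[of _ "\<gamma> - e"]) (auto simp: \<beta>_def)
    qed
    with upper_max show ?thesis unfolding \<beta>_def[symmetric]
      by eventually_elim (use 2 in \<open>auto simp: max_def\<close>)
  next
    case 3
    have \<beta>\<alpha>: "1 / \<alpha> < \<beta>" using 3 by (simp add: divide_less_eq mult.commute)
    have "1 / \<alpha> < 1" using 3 by simp
    then have "1 / \<alpha> \<le> 1 + s" if "0 \<le> s" for s using that by linarith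
    then have "AE \<omega> in M. (\<exists>s\<ge>0. hausdorff_measure s (process_graph X B \<omega>) = 0) \<and>
      hausdorff_dim (process_graph X B \<omega>) \<le> 1 + \<beta> - 1 / \<alpha>"
      unfolding \<beta>_def
      by (intro hausdorff_dim_graph_le_AE[where g = "\<lambda>s. 1 + s - 1 / \<alpha>"])
         (use assms 3 in \<open>auto intro!: monoI continuous_intros hausdorff_measure_graph_eq_0_squares\<close>)
    moreover have "AE \<omega> in M. (\<exists>s\<ge>0. hausdorff_measure s (process_graph X B \<omega>) = 0) \<longrightarrow> 1 + \<beta> - 1 / \<alpha> \<le> hausdorff_dim (process_graph X B \<omega>)"
    proof (rule hausdorff_dim_graph_ge_AE[OF 3(1) assms(5,6)])
      fix \<gamma> assume \<gamma>: "\<gamma> < 1 + \<beta> - 1 / \<alpha>" "0 < \<gamma>"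
      \<comment> \<open>With \<open>\<theta> = 1\<close> the exponent is
        \<open>\<gamma>' - 1 + 1 / \<alpha>\<close>, below \<beta> exactly when
        \<open>\<gamma>' < 1 + \<beta> - 1 / \<alpha>\<close>. Since
        \<open>1 / \<alpha> < \<beta>\<close>, there is room for \<open>\<gamma>'\<close> above 1,
        as \<open>\<theta> < \<gamma>'\<close> demands.\<close>
      obtain \<gamma>' where "max \<gamma> 1 < \<gamma>'" "\<gamma>' < 1 + \<beta> - 1 / \<alpha>" using dense[of "max \<gamma> 1" "1 + \<beta> - 1 / \<alpha>"] \<gamma> \<beta>\<alpha> by auto
      then show "\<exists>\<gamma>' \<theta>. \<gamma> \<le> \<gamma>' \<and> 0 \<le> \<theta> \<and> \<theta> \<le> 1 \<and> \<theta> < \<gamma>' \<and> (\<gamma>' - \<theta>) + \<theta> / \<alpha> < hausdorff_dim B"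
        by (intro exI[of _ \<gamma>'] exI[of _ 1]) (auto simp: \<beta>_def)
    qed
    ultimately show ?thesis unfolding \<beta>_def[symmetric]
      by eventually_elim (use 3 in auto)
  qed
qed

end
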